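(* Let $X$ be a Kobayashi hyperbolic complex manifold. Let $\gamma:[0,T]\to X$ be a non-constant absolutely continuous path. Then there exists an absolutely continuous path $\sigma_\gamma:[0,\tau]\to X$ such that $\langle\gamma\rangle=\langle\sigma_\gamma\rangle$ and such that $k_X(\sigma_\gamma(t);\sigma_\gamma'(t))=1$ for almost every $t\in[0,\tau]$. Moreover, writing $\mathscr{S}(\gamma):=\{t\in[0,T]:\gamma'(t)=0\}$: (a) $\gamma$ can be reparametrized with respect to its $k_X$-length as an absolutely continuous path if and only if $\mathscr{S}(\gamma)$ contains no intervals of positive length. (b) When $\mathscr{S}(\gamma)$ contains no intervals of positive length, the path $\sigma_\gamma$ is obtained by reparametrizing $\gamma$ with respect to its $k_X$-length (i.e., $\sigma_\gamma=\gamma\circ g^{-1}$ on $[0,g(T)]$, where $g(t)=\int_0^t k_X(\gamma(s);\gamma'(s))\,ds$, has the properties stated above).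
   Context: For a complex manifold $X$, $K_X$ denotes the Kobayashi pseudodistance and $k_X(x;v)$, for $x\in X$, $v\in T^{(1,0)}_xX$, the Kobayashi (Kobayashi--Royden) metric. $X$ is Kobayashi hyperbolic if $K_X$ is a distance. A path is a continuous map of an interval into the space in question; $\langle\gamma\rangle$ denotes the image of the path $\gamma$. Let $n=\dim_{\mathbb{C}}X$. A path $\gamma:I\to X$ ($I\subseteq\mathbb{R}$ an interval) is locally absolutely continuous if for each $t_0\in I$, each holomorphic chart $(U,\varphi)$ around $\gamma(t_0)$, and each closed and bounded interval $I(\varphi,t_0)\subseteq\gamma^{-1}(U)$ containing $t_0$, the map $\varphi\circ\gamma|_{I(\varphi,t_0)}$ is absolutely continuous as a path in $\mathbb{R}^{2n}$. It is absolutely continuous if, in addition, $I\subsetneq\mathbb{R}$ is closed and bounded. Such a path is differentiable almost everywhere; at a point $t$ of differentiability, $\gamma'(t)\in T^{(1,0)}_{\gamma(t)}X$ denotes the vector canonically identified with $D\gamma(t)1\in T_{\gamma(t)}X$. In the set $\mathscr{S}(\gamma)$, the condition $\gamma'(t)=0$ means that $\gamma'(t)$ exists and equals $0$. For an absolutely continuous path $\gamma:[0,T]\to X$, let $g(t):=\int_0^t k_X(\gamma(s);\gamma'(s))\,ds$, $t\in[0,T]$, so that $g(t)-g(s)$ is the $k_X$-length of $\gamma|_{[s,t]}$. That $\gamma$ can be reparametrized with respect to its $k_X$-length as an absolutely continuous path means that $g$ is invertible as a map $[0,T]\to[0,g(T)]$ and that $\gamma\circ g^{-1}:[0,g(T)]\to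 X$ is an absolutely continuous path; $\gamma\circ g^{-1}$ is then the path obtained by reparametrizing $\gamma$ with respect to its $k_X$-length. *)

theory Defs
  imports "HOL-Analysis.Analysis"
begin

section \<open>Complex manifolds\<close>

text \<open>
  A manifold is a set \<open>M\<close> with its subspace topology, together with a maximal holomorphic atlas
  \<open>A\<close>. The dimension is \<open>CARD('n)\<close>. A chart is a pair \<open>(U, \<phi>)\<close>; the values of \<open>\<phi>\<close> outside
  \<open>U\<close> are irrelevant.
\<close>

type_synonym ('a, 'n) chart = "'a set \<times> ('a \<Rightarrow> complex ^ 'n)"

definition holomorphic_map_on ::
    "(complex ^ 'n::finite \<Rightarrow> complex ^ 'm::finite) \<Rightarrow> (complex ^ 'n) set \<Rightarrow> bool" where
  "holomorphic_map_on f S \<longleftrightarrow>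
     (\<forall>z\<in>S. \<exists>D. Vector_Spaces.linear (*s) (*s) D \<and> (f has_derivative D) (at z))"

definition chart_on :: "'a::topological_space set \<Rightarrow> ('a, 'n::finite) chart \<Rightarrow> bool" where
  "chart_on M = (\<lambda>(U, \<phi>). openin (top_of_set M) U \<and> open (\<phi> ` U) \<and>
     homeomorphism U (\<phi> ` U) \<phi> (inv_into U \<phi>))"

definition transition :: "('a, 'n::finite) chart \<Rightarrow> ('a, 'n::finite) chart \<Rightarrow> complex ^ 'n \<Rightarrow> complex ^ 'n" where
  "transition = (\<lambda>(U, \<phi>) (V, \<psi>). \<psi> \<circ> inv_into U \<phi>)"

definition compatible :: "('a, 'n::finite) chart \<Rightarrow> ('a, 'n::finite) chart \<Rightarrow> bool" where
  "compatible c d \<longleftrightarrow>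
     holomorphic_map_on (transition c d) (snd c ` (fst c \<inter> fst d)) \<and>
     holomorphic_map_on (transition d c) (snd d ` (fst c \<inter> fst d))"

definition complex_manifold ::
    "'a::{t2_space, second_countable_topology} set \<Rightarrow> ('a, 'n::finite) chart set \<Rightarrow> bool" where
  "complex_manifold M A \<longleftrightarrow>
     (\<forall>c\<in>A. chart_on M c) \<and>
     (\<Union>c\<in>A. fst c) = M \<and>
     (\<forall>c\<in>A. \<forall>d\<in>A. compatible c d) \<and>
     (\<forall>c. chart_on M c \<and> (\<forall>d\<in>A. compatible c d) \<longrightarrow> c \<in> A)"

text \<open>
  A (1,0)-tangent vector at \<open>x\<close> is the family of its coordinate vectors in all charts around
  \<open>x\<close> (the coefficients of the \<open>\<partial>/\<partial>z\<^sub>i\<close>), set to \<open>0\<close> for all other arguments so that the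
  family is determined by the vector. In these coordinates the canonical identification of the
  real tangent space with the (1,0)-tangent space is the identity of \<open>complex ^ 'n\<close>.
\<close>

definition tangent_space ::
    "('a, 'n::finite) chart set \<Rightarrow> 'a \<Rightarrow> (('a, 'n::finite) chart \<Rightarrow> complex ^ 'n) set" where
  "tangent_space A x = {v.
     (\<forall>c\<in>A. \<forall>d\<in>A. x \<in> fst c \<and> x \<in> fst d \<longrightarrow>
        v d = frechet_derivative (transition c d) (at (snd c x)) (v c)) \<and>
     (\<forall>c. \<not> (c \<in> A \<and> x \<in> fst c) \<longrightarrow> v c = 0)}"


section \<open>The Kobayashi pseudodistance and the Kobayashi--Royden metric\<close>

definition holomorphic_disc ::
    "'a::topological_space set \<Rightarrow> ('a, 'n::finite) chart set \<Rightarrow> (complex \<Rightarrow> 'a) \<Rightarrow> bool" where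
  "holomorphic_disc M A f \<longleftrightarrow>
     continuous_on (ball 0 1) f \<and> f ` ball 0 1 \<subseteq> M \<and>
     (\<forall>(U, \<phi>)\<in>A. \<forall>i. (\<lambda>\<zeta>. \<phi> (f \<zeta>) $ i) holomorphic_on {\<zeta> \<in> ball 0 1. f \<zeta> \<in> U})"

text \<open>
  The Poincare distance is normalised so that its infinitesimal form at \<open>0\<close> is the Euclidean
  norm, in accordance with the Kobayashi--Royden metric below.
\<close>

definition poincare_dist :: "complex \<Rightarrow> complex \<Rightarrow> real" where
  "poincare_dist a b = artanh (cmod ((a - b) / (1 - cnj b * a)))"

text \<open>
  Infimum over chains of discs; it is \<open>\<infinity>\<close> if there is no chain from \<open>p\<close> to \<open>q\<close>, that is, if
  \<open>p\<close> and \<open>q\<close> lie in different components.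
\<close>

definition kobayashi_pdist ::
    "'a::topological_space set \<Rightarrow> ('a, 'n::finite) chart set \<Rightarrow> 'a \<Rightarrow> 'a \<Rightarrow> ennreal" where
  "kobayashi_pdist M A p q = Inf {(\<Sum>i<m. ennreal (poincare_dist (a i) (b i))) | m x f a b.
     x 0 = p \<and> x m = q \<and>
     (\<forall>i<m. holomorphic_disc M A (f i) \<and> a i \<in> ball 0 1 \<and> b i \<in> ball 0 1 \<and>
        f i (a i) = x i \<and> f i (b i) = x (Suc i))}"

definition kobayashi_hyperbolic ::
    "'a::topological_space set \<Rightarrow> ('a, 'n::finite) chart set \<Rightarrow> bool" where
  "kobayashi_hyperbolic M A \<longleftrightarrow>
     (\<forall>p\<in>M. \<forall>q\<in>M. kobayashi_pdist M A p q < \<infinity>) \<and>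
     Metric_space M (\<lambda>p q. enn2real (kobayashi_pdist M A p q))"

definition kobayashi_metric ::
    "'a::topological_space set \<Rightarrow> ('a, 'n::finite) chart set \<Rightarrow> 'a \<Rightarrow>
     (('a, 'n::finite) chart \<Rightarrow> complex ^ 'n) \<Rightarrow> real" where
  "kobayashi_metric M A x v = Inf {\<alpha>. \<alpha> > 0 \<and> (\<exists>f. holomorphic_disc M A f \<and> f 0 = x \<and>
     (\<forall>(U, \<phi>)\<in>A. x \<in> U \<longrightarrow>
        v (U, \<phi>) = \<alpha> *\<^sub>R (\<chi> i. deriv (\<lambda>\<zeta>. \<phi> (f \<zeta>) $ i) 0)))}"


section \<open>Absolutely continuous paths\<close>

definition abs_continuous_on :: "real set \<Rightarrow> (real \<Rightarrow> 'b::real_normed_vector) \<Rightarrow> bool" where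
  "abs_continuous_on J f \<longleftrightarrow> (\<forall>\<epsilon>>0. \<exists>\<delta>>0. \<forall>P::(real \<times> real) set.
     finite P \<and> (\<forall>(a, b)\<in>P. a \<le> b \<and> {a..b} \<subseteq> J) \<and>
     disjoint_family_on (\<lambda>(a, b). {a<..<b}) P \<and> (\<Sum>(a, b)\<in>P. b - a) < \<delta>
     \<longrightarrow> (\<Sum>(a, b)\<in>P. norm (f b - f a)) < \<epsilon>)"

definition locally_abs_continuous_path ::
    "'a::topological_space set \<Rightarrow> ('a, 'n::finite) chart set \<Rightarrow> real set \<Rightarrow> (real \<Rightarrow> 'a) \<Rightarrow> bool" where
  "locally_abs_continuous_path M A I \<gamma> \<longleftrightarrow>
     is_interval I \<and> continuous_on I \<gamma> \<and> \<gamma> ` I \<subseteq> M \<and>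
     (\<forall>t\<^sub>0\<in>I. \<forall>(U, \<phi>)\<in>A. \<gamma> t\<^sub>0 \<in> U \<longrightarrow>
        (\<forall>a b. t\<^sub>0 \<in> {a..b} \<and> {a..b} \<subseteq> {t\<in>I. \<gamma> t \<in> U} \<longrightarrow> abs_continuous_on {a..b} (\<phi> \<circ> \<gamma>)))"

definition abs_continuous_path ::
    "'a::topological_space set \<Rightarrow> ('a, 'n::finite) chart set \<Rightarrow> real set \<Rightarrow> (real \<Rightarrow> 'a) \<Rightarrow> bool" where
  "abs_continuous_path M A I \<gamma> \<longleftrightarrow>
     locally_abs_continuous_path M A I \<gamma> \<and> closed I \<and> bounded I"

text \<open>
  \<open>has_velocity A I \<gamma> t v\<close>: the derivative of the path \<open>\<gamma>\<close>, defined on \<open>I\<close>, exists at \<open>t\<close> and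
  equals \<open>v\<close> (one-sided at an end point of \<open>I\<close>).
\<close>

definition has_velocity ::
    "('a, 'n::finite) chart set \<Rightarrow> real set \<Rightarrow> (real \<Rightarrow> 'a) \<Rightarrow> real \<Rightarrow>
     (('a, 'n::finite) chart \<Rightarrow> complex ^ 'n) \<Rightarrow> bool" where
  "has_velocity A I \<gamma> t v \<longleftrightarrow>
     v \<in> tangent_space A (\<gamma> t) \<and>
     (\<forall>(U, \<phi>)\<in>A. \<gamma> t \<in> U \<longrightarrow> ((\<phi> \<circ> \<gamma>) has_vector_derivative v (U, \<phi>)) (at t within I))"

text \<open>
  Unspecified where \<open>\<gamma>\<close> is not differentiable, which is a null set for the paths considered here.
\<close>

definition velocity ::
    "('a, 'n::finite) chart set \<Rightarrow> real set \<Rightarrow> (real \<Rightarrow> 'a) \<Rightarrow> real \<Rightarrow> ('a, 'n::finite) chart \<Rightarrow> complex ^ 'n" where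
  "velocity A I \<gamma> t = (THE v. has_velocity A I \<gamma> t v)"

definition stationary_set ::
    "('a, 'n::finite) chart set \<Rightarrow> real set \<Rightarrow> (real \<Rightarrow> 'a) \<Rightarrow> real set" where
  "stationary_set A I \<gamma> = {t\<in>I. has_velocity A I \<gamma> t (\<lambda>_. 0)}"

definition contains_nontrivial_interval :: "real set \<Rightarrow> bool" where
  "contains_nontrivial_interval S \<longleftrightarrow> (\<exists>a b. a < b \<and> {a..b} \<subseteq> S)"


section \<open>Reparametrisation by Kobayashi length\<close>

text \<open>
  In the following, \<open>\<gamma>\<close> is a path on \<open>{0..T}\<close>. The completed measure \<open>lebesgue\<close> makes the
  values of the integrand on the null set where \<open>\<gamma>\<close> is not differentiable irrelevant.
\<close>

definition kobayashi_length ::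
    "'a::topological_space set \<Rightarrow> ('a, 'n::finite) chart set \<Rightarrow> real \<Rightarrow> (real \<Rightarrow> 'a) \<Rightarrow> real \<Rightarrow> real" where
  "kobayashi_length M A T \<gamma> t =
     (LINT s:{0..t}|lebesgue. kobayashi_metric M A (\<gamma> s) (velocity A {0..T} \<gamma> s))"

definition length_reparam ::
    "'a::topological_space set \<Rightarrow> ('a, 'n::finite) chart set \<Rightarrow> real \<Rightarrow> (real \<Rightarrow> 'a) \<Rightarrow> real \<Rightarrow> 'a" where
  "length_reparam M A T \<gamma> = \<gamma> \<circ> inv_into {0..T} (kobayashi_length M A T \<gamma>)"

definition length_reparametrizable ::
    "'a::topological_space set \<Rightarrow> ('a, 'n::finite) chart set \<Rightarrow> real \<Rightarrow> (real \<Rightarrow> 'a) \<Rightarrow> bool" where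
  "length_reparametrizable M A T \<gamma> \<longleftrightarrow>
     (let g = kobayashi_length M A T \<gamma> in
        bij_betw g {0..T} {0..g T} \<and>
        abs_continuous_path M A {0..g T} (length_reparam M A T \<gamma>))"

end

theory Submission
  imports Defs "HOL-Complex_Analysis.Cauchy_Integral_Formula"
begin

text \<open>
  On a hyperbolic manifold \<open>k\<^sub>X\<close> is, over a compact subset of a chart, comparable with the Euclidean
  norm of the coordinate vector: discs centred near a point stay in a chart for a definite Poincare
  radius, and Cauchy's estimate applies. Hence the length function \<open>g\<close> of \<open>\<gamma>\<close> is well defined, \<open>\<gamma>\<close> is
  constant wherever \<open>g\<close> is, and \<open>\<sigma> := \<gamma> \<circ> g\<inverse>\<close> makes sense for any right inverse \<open>g\<inverse>\<close> of
  \<open>g\<close>, also when \<open>g\<close> is not injective. In charts \<open>\<sigma>\<close> is locally Lipschitz. By Lebesgue's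
  differentiation theorem \<open>\<sigma>' = \<gamma>' / g'\<close> and \<open>g' = k\<^sub>X(\<gamma>; \<gamma>')\<close> at \<open>g(t)\<close> for all \<open>t\<close> outside a set on which
  \<open>g'\<close> integrates to \<open>0\<close>, and the image of such a set under \<open>g\<close> is null.
  The measurability of \<open>k\<^sub>X(\<gamma>; \<gamma>')\<close> does not need the upper semicontinuity of \<open>k\<^sub>X\<close>: by
  hyperbolicity the discs into a fixed compact set form a compact family, so sublevel sets
  of \<open>k\<^sub>X\<close> are countable unions of compact sets.
\<close>

section \<open>Differentiation of indefinite integrals\<close>

text \<open>The obstacle is that \<open>\<gamma>\<close> may stand still on a set of positive
  measure that contains no interval, such as a fat Cantor set. Then \<open>g\<close> is injective,
  but its inverse maps a null set onto a set of positive measure and is not absolutely continuous,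
  so \<open>\<sigma>\<close> cannot be handled as a composition of absolutely continuous maps.
  Instead the increments of \<open>\<gamma>\<close> in a chart are compared directly with those of
  \<open>g\<close>; this comparison makes sense whether or not \<open>g\<close> is injective. The
  bounds on \<open>k\<^sub>X\<close> are pointwise, whereas absolute continuity is an
  \<epsilon>-\<delta> condition in charts. Integrating the bounds along the path takes the
  fundamental theorem of calculus for absolutely continuous functions: the densities come from the
  Radon-Nikodym theorem, applied to the Stieltjes measures of two increasing functions built from
  the variation, and differentiability almost everywhere comes from Vitali's covering
  theorem.\<close>

lemma set_integral_Icc_split:
  fixes f :: "real \<Rightarrow> 'b::{banach, second_countable_topology}"
  assumes f: "set_integrable lebesgue {a..c} f" and abc: "a \<le> b" "b \<le> c"
  shows "(LINT x:{a..c}|lebesgue. f x) = (LINT x:{a..b}|lebesgue. f x) + (LINT x:{b..c}|lebesgue. f x)"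
proof -
  have si: "set_integrable lebesgue {a..b} f" "set_integrable lebesgue {b<..c} f" "set_integrable lebesgue {b..c} f"
    using abc by (auto intro!: set_integrable_subset[OF f])
  have "(LINT x:{a..b} \<union> {b<..c}|lebesgue. f x) = (LINT x:{a..b}|lebesgue. f x) + (LINT x:{b<..c}|lebesgue. f x)"
    by (rule set_integral_Un) (use si in auto)
  moreover have "{a..b} \<union> {b<..c} = {a..c}" using abc by auto
  moreover have "(LINT x:{b<..c}|lebesgue. f x) = (LINT x:{b..c}|lebesgue. f x)"
    unfolding set_lebesgue_integral_def
  proof (rule integral_cong_AE)
    show "AE x in lebesgue. indicat_real {b<..c} x *\<^sub>R f x = indicat_real {b..c} x *\<^sub>R f x"
      by (rule AE_I'[of "{b}"]) (auto split: split_indicator)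
  qed (use si in \<open>auto simp: set_integrable_def\<close>)
  ultimately show ?thesis by simp
qed

lemma sum_integral_disjoint_le:
  fixes k :: "'x \<Rightarrow> real"
  assumes F: "finite F" and k: "integrable M k" "\<And>x. 0 \<le> k x"
    and S: "\<And>i. i \<in> F \<Longrightarrow> S i \<in> sets M" "\<And>i. i \<in> F \<Longrightarrow> S i \<subseteq> B" "B \<in> sets M"
    and dj: "\<And>i j. i \<in> F \<Longrightarrow> j \<in> F \<Longrightarrow> i \<noteq> j \<Longrightarrow> S i \<inter> S j = {}"
  shows "(\<Sum>i\<in>F. LINT x:S i|M. k x) \<le> (LINT x:B|M. k x)"
proof -
  have "(\<Sum>i\<in>F. LINT x:S i|M. k x) = (LINT x:(\<Union>i\<in>F. S i)|M. k x)"
  proof (rule set_integral_finite_Union[symmetric])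
    show "set_integrable M (S i) k" if "i \<in> F" for i
      unfolding set_integrable_def using S(1)[OF that] k(1) by (rule integrable_mult_indicator)
  qed (use F S dj in \<open>auto simp: disjoint_family_on_def\<close>)
  also have "\<dots> \<le> (LINT x:B|M. k x)"
    unfolding set_lebesgue_integral_def
  proof (rule integral_mono)
    show "integrable M (\<lambda>x. indicat_real (\<Union>i\<in>F. S i) x *\<^sub>R k x)" 
      by (rule integrable_mult_indicator[OF _ k(1)]) (use F S in auto)
    show "integrable M (\<lambda>x. indicat_real B x *\<^sub>R k x)" by (rule integrable_mult_indicator[OF S(3) k(1)])
    show "indicat_real (\<Union>i\<in>F. S i) x *\<^sub>R k x \<le> indicat_real B x *\<^sub>R k x" for x
      using S(2) k(2)[of x] by (auto split: split_indicator)
  qed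
  finally show ?thesis .
qed

lemma integrable_indicator_lmeasurable:
  "X \<in> lmeasurable \<Longrightarrow> integrable lebesgue (indicat_real (X :: 'a::euclidean_space set))"
  by (rule integrable_real_indicator) (auto simp: fmeasurable_def)

text \<open>Absolute continuity of the integral. Truncating \<open>k\<close> at a height
  \<open>n\<close> loses less than \<open>e/2\<close> of the integral, and the truncated function
  contributes at most \<open>n\<close> times the measure of \<open>X\<close>.\<close>

lemma integral_small_measure:
  fixes k :: "real \<Rightarrow> real"
  assumes "integrable lebesgue k" "\<And>x. 0 \<le> k x" "0 < e"
  shows "\<exists>d>0. \<forall>X\<in>lmeasurable. measure lebesgue X < d \<longrightarrow> (LINT x:X|lebesgue. k x) < e"
proof -
  have [measurable]: "k \<in> borel_measurable lebesgue" using assms(1) by auto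
  have "(\<lambda>n. LINT x|lebesgue. min (k x) (real n)) \<longlonglongrightarrow> (LINT x|lebesgue. k x)"
  proof (rule integral_dominated_convergence[where w=k])
    show "AE x in lebesgue. (\<lambda>n. min (k x) (real n)) \<longlonglongrightarrow> k x"
    proof (intro always_eventually allI)
      fix x
      have "\<forall>\<^sub>F n in sequentially. min (k x) (real n) = k x"
      proof -
        obtain N where "k x \<le> real N" using real_arch_simple by blast
        then show ?thesis by (auto simp: eventually_sequentially min_def intro!: exI[of _ N])
      qed
      then show "(\<lambda>n. min (k x) (real n)) \<longlonglongrightarrow> k x" by (rule tendsto_eventually)
    qed
  qed (use assms in \<open>auto simp: min_def\<close>)
  then have "\<forall>\<^sub>F n in sequentially. \<bar>(LINT x|lebesgue. min (k x) (real n)) - (LINT x|lebesgue. k x)\<bar> < e/2"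
    using assms(3) unfolding tendsto_iff dist_real_def by (metis half_gt_zero)
  then obtain n where n: "\<bar>(LINT x|lebesgue. min (k x) (real n)) - (LINT x|lebesgue. k x)\<bar> < e/2"
    by (auto simp: eventually_sequentially)
  have im: "integrable lebesgue (\<lambda>x. min (k x) (real n))"
    by (rule Bochner_Integration.integrable_bound[OF assms(1)]) (use assms in \<open>auto simp: min_def\<close>)
  show ?thesis
  \<comment> \<open>Adding 1 to \<open>n\<close> keeps the bound meaningful for
    \<open>n = 0\<close>.\<close>
  proof (intro exI[of _ "e / (2 * (real n + 1))"] conjI ballI impI)
    show "0 < e / (2 * (real n + 1))" using assms(3) by simp
    fix X :: "real set" assume X: "X \<in> lmeasurable" and mX: "measure lebesgue X < e / (2 * (real n + 1))"
    have [measurable]: "X \<in> sets lebesgue" using X by auto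
    have iX: "integrable lebesgue (indicat_real X)"
      using X by (rule integrable_indicator_lmeasurable)
    have "(LINT x:X|lebesgue. k x) \<le> (LINT x|lebesgue. (k x - min (k x) (real n)) + real n * indicator X x)"
      unfolding set_lebesgue_integral_def
      by (rule integral_mono[OF integrable_mult_indicator]) (use assms im iX in \<open>auto split: split_indicator\<close>)
    also have "\<dots> = (LINT x|lebesgue. k x) - (LINT x|lebesgue. min (k x) (real n)) + real n * measure lebesgue X"
      using assms im iX by (subst Bochner_Integration.integral_add) auto
    also have "\<dots> < e"
    proof -
      have "real n * measure lebesgue X \<le> real n * (e / (2 * (real n + 1)))"
        using mX by (intro mult_left_mono) auto
      also have "\<dots> \<le> e/2" using assms(3) by (simp add: field_simps)
      finally show ?thesis using n by linarith
    qed
    finally show "(LINT x:X|lebesgue. k x) < e" .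
  qed
qed

text \<open>One half of Lebesgue's differentiation theorem. On a suitable open neighbourhood of
  \<open>{h < l'}\<close> the positive part of \<open>h - l'\<close> has small integral, yet each
  interval with average above \<open>l\<close> contributes at least \<open>l - l'\<close> times its
  length. By Vitali's theorem disjoint intervals of this kind cover the set up to a null set, so
  their total length is small.\<close>

lemma negligible_upper_average:
  fixes h :: "real \<Rightarrow> real"
  assumes h: "integrable lebesgue h" and l: "l' < l"
  shows "negligible {t. h t < l' \<and>
    (\<forall>d>0. \<exists>p q. p \<le> t \<and> t \<le> q \<and> p < q \<and> q - p < d \<and> l * (q - p) < (LINT s:{p..q}|lebesgue. h s))}"
    (is "negligible ?E")
proof -
  have hm[measurable]: "h \<in> borel_measurable lebesgue" using h by auto
  \<comment> \<open>On a bounded window the positive part of \<open>h - l'\<close> is integrable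
    also for negative \<open>l'\<close>.\<close>
  have *: "negligible (?E \<inter> {-N<..<N})" for N :: real
    unfolding negligible_outer_le
  proof (intro allI impI)
    fix e :: real assume e: "0 < e"
    let ?B = "{-N<..<N}"
    define A where "A = {t\<in>?B. h t < l'}"
    define k where "k = (\<lambda>t. max 0 (h t - l') * indicator ?B t)"
    have ki: "integrable lebesgue k"
    proof (rule Bochner_Integration.integrable_bound[where f="\<lambda>t. \<bar>h t\<bar> + \<bar>l'\<bar> * indicator ?B t"])
      show "integrable lebesgue (\<lambda>t. \<bar>h t\<bar> + \<bar>l'\<bar> * indicator ?B t)"
        using h by (intro Bochner_Integration.integrable_add integrable_mult_right integrable_abs
            integrable_indicator_lmeasurable) auto
      show "k \<in> borel_measurable lebesgue" unfolding k_def using hm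
        by (intro borel_measurable_times borel_measurable_max borel_measurable_diff borel_measurable_indicator) auto
    qed (auto simp: k_def split: split_indicator)
    have k0: "0 \<le> k x" for x by (auto simp: k_def)
    obtain d where d: "d > 0" "\<And>X. X \<in> lmeasurable \<Longrightarrow> measure lebesgue X < d \<Longrightarrow> (LINT x:X|lebesgue. k x) < e * (l - l')"
      using integral_small_measure[OF ki k0, of "e * (l-l')"] e l by auto
    have Am: "A \<in> sets lebesgue"
    proof -
      have "A = ?B \<inter> {t \<in> space lebesgue. h t < l'}" by (auto simp: A_def)
      moreover have "{t \<in> space lebesgue. h t < l'} \<in> sets lebesgue" by measurable
      ultimately show ?thesis by auto
    qed
    obtain O1 where O1: "open O1" "A \<subseteq> O1" "O1 - A \<in> lmeasurable" "emeasure lebesgue (O1 - A) < ennreal d"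
      using sets_lebesgue_outer_open[OF Am d(1)] by auto
    define O2 where "O2 = O1 \<inter> ?B"
    have O2: "open O2" "A \<subseteq> O2" using O1 by (auto simp: O2_def A_def)
    have O2B: "O2 \<subseteq> ?B" by (auto simp: O2_def)
    have O2s: "O2 \<in> sets lebesgue" using O2(1) by auto
    have dm: "O2 - A \<in> lmeasurable"
      by (rule fmeasurableI2[OF O1(3)]) (use O2s Am in \<open>auto simp: O2_def\<close>)
    have "measure lebesgue (O2 - A) \<le> measure lebesgue (O1 - A)"
      by (rule measure_mono_fmeasurable[OF _ _ O1(3)]) (use O2s Am in \<open>auto simp: O2_def\<close>)
    also have "\<dots> < d" using O1(3,4) d(1) by (simp add: emeasure_eq_measure2 ennreal_less_iff)
    finally have small: "(LINT x:O2-A|lebesgue. k x) < e * (l - l')" using d(2)[OF dm] by auto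
    \<comment> \<open>\<open>k\<close> vanishes on \<open>A\<close>, so that only the small
      remainder \<open>O2 - A\<close> counts.\<close>
    have "(LINT x:O2|lebesgue. k x) = (LINT x:O2-A|lebesgue. k x)"
      unfolding set_lebesgue_integral_def
      by (rule Bochner_Integration.integral_cong) (auto simp: k_def A_def split: split_indicator)
    with small have kO: "(LINT x:O2|lebesgue. k x) < e * (l - l')" by simp
    \<comment> \<open>The Vitali family: closed intervals inside \<open>O2\<close> on which the
      average of \<open>h\<close> exceeds \<open>l\<close>. Centres \<open>c\<close> and radii
      \<open>r\<close> are introduced because the covering theorem is about balls.\<close>
    define K where "K = {(p,q). p < q \<and> {p..q} \<subseteq> O2 \<and> l * (q - p) < (LINT s:{p..q}|lebesgue. h s)}"
    define c where "c = (\<lambda>(p::real,q). (p+q)/2)"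
    define r where "r = (\<lambda>(p::real,q). (q-p)/2)"
    have cb: "cball (c i) (r i) = {fst i..snd i}" for i
      by (cases i) (auto simp: c_def r_def cball_eq_atLeastAtMost field_simps)
    have V1: "0 < r i" if "i \<in> K" for i using that by (auto simp: K_def r_def)
    have V2: "\<exists>i. i \<in> K \<and> x \<in> cball (c i) (r i) \<and> r i < d" if x: "x \<in> ?E \<inter> ?B" and d: "0 < d" for x d
    proof -
      have "x \<in> O2" using x O2 by (auto simp: A_def)
      then obtain d' where d': "d' > 0" "ball x d' \<subseteq> O2" using O2(1) openE by blast
      obtain p q where pq: "p \<le> x \<and> x \<le> q \<and> p < q \<and> q - p < min d d' \<and> l * (q - p) < (LINT s:{p..q}|lebesgue. h s)"
      proof -
        have "\<forall>d>0. \<exists>p q. p \<le> x \<and> x \<le> q \<and> p < q \<and> q - p < d \<and> l * (q - p) < (LINT s:{p..q}|lebesgue. h s)"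
          using x by blast
        moreover have "0 < min d d'" using d d' by simp
        ultimately show ?thesis using that by blast
      qed
      have "{p..q} \<subseteq> ball x d'" using pq by (auto simp: dist_real_def)
      then have "(p,q) \<in> K" using pq d' by (auto simp: K_def)
      moreover have "x \<in> cball (c (p,q)) (r (p,q))" unfolding cb using pq by simp
      moreover have "r (p,q) < d" using pq by (simp add: r_def)
      ultimately show ?thesis by blast
    qed
    obtain C where C: "countable C" "C \<subseteq> K"
      "pairwise (\<lambda>i j. disjnt (cball (c i) (r i)) (cball (c j) (r j))) C"
      "negligible (?E \<inter> ?B - (\<Union>i\<in>C. cball (c i) (r i)))"
      by (rule Vitali_covering_theorem_cballs[of K r "?E \<inter> ?B" c, OF V1 V2]) (assumption | rule that)+
    \<comment> \<open>A bound for all finite subfamilies passes to the countable selection.\<close>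
    have bnd: "measure lebesgue (\<Union>i\<in>F. {fst i..snd i}) \<le> e" if F: "F \<subseteq> C" "finite F" for F
    proof -
      have FK: "\<And>i. i \<in> F \<Longrightarrow> i \<in> K" using F C by auto
      have h0: "set_integrable lebesgue {p..q} h" for p q :: real
        unfolding set_integrable_def using h by (intro integrable_mult_indicator) auto
      have c0: "set_integrable lebesgue {p..q} (\<lambda>_. l')" for p q :: real
        unfolding set_integrable_def real_scaleR_def
        by (intro integrable_mult_left integrable_indicator_lmeasurable) auto
      have hi: "set_integrable lebesgue {p..q} (\<lambda>x. h x - l')" for p q :: real
        using h0 c0 by (rule set_integral_diff(1))
      have kii: "set_integrable lebesgue X k" if "X \<in> sets lebesgue" for X
        unfolding set_integrable_def using that ki by (rule integrable_mult_indicator)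
      have "measure lebesgue (\<Union>i\<in>F. {fst i..snd i}) * (l - l') \<le> (\<Sum>i\<in>F. measure lebesgue {fst i..snd i}) * (l - l')"
        using l F by (intro mult_right_mono measure_UNION_le) auto
      also have "\<dots> = (\<Sum>i\<in>F. (l - l') * (snd i - fst i))"
        unfolding sum_distrib_right by (rule sum.cong) (use FK in \<open>fastforce simp: K_def\<close>)+
      also have "\<dots> \<le> (\<Sum>i\<in>F. LINT s:{fst i..snd i}|lebesgue. k s)"
      proof (rule sum_mono)
        fix i assume i: "i \<in> F"
        obtain p q where [simp]: "i = (p,q)" by (cases i)
        have pq: "p < q" "{p..q} \<subseteq> O2" "l * (q - p) < (LINT s:{p..q}|lebesgue. h s)" using FK[OF i] by (auto simp: K_def)
        have "(LINT s:{p..q}|lebesgue. h s - l') = (LINT s:{p..q}|lebesgue. h s) - (LINT s:{p..q}|lebesgue. l')"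
          using h0 c0 by (rule set_integral_diff(2))
        also have "(LINT s:{p..q}|lebesgue. l') = l' * (q - p)" using pq by (simp add: set_lebesgue_integral_def)
        finally have "(l - l') * (q - p) \<le> (LINT s:{p..q}|lebesgue. h s - l')" using pq by (simp add: algebra_simps)
        also have "\<dots> \<le> (LINT s:{p..q}|lebesgue. k s)"
        proof (rule set_integral_mono)
          fix x assume "x \<in> {p..q}"
          then have "x \<in> ?B" using pq(2) O2B by blast
          then show "h x - l' \<le> k x" by (simp add: k_def)
        qed (use hi kii in auto)
        finally show "(l - l') * (snd i - fst i) \<le> (LINT s:{fst i..snd i}|lebesgue. k s)" by simp
      qed
      also have "\<dots> \<le> (LINT s:O2|lebesgue. k s)"
      proof (rule sum_integral_disjoint_le[OF F(2) ki k0])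
        show "{fst i..snd i} \<subseteq> O2" if "i \<in> F" for i using FK[OF that] by (auto simp: K_def)
        show "{fst i..snd i} \<inter> {fst j..snd j} = {}" if "i \<in> F" "j \<in> F" "i \<noteq> j" for i j
          using C(3) that F(1) unfolding pairwise_def disjnt_def cb by blast
      qed (use O2s in auto)
      also have "\<dots> \<le> e * (l - l')" using kO by simp
      finally show ?thesis using l by (simp add: mult_le_cancel_right)
    qed
    let ?W = "\<Union>i\<in>C. {fst i..snd i}"
    have W: "?W \<in> lmeasurable" "measure lebesgue ?W \<le> e"
      using fmeasurable_UN_bound[OF C(1), of "\<lambda>i. {fst i..snd i}" lebesgue e] 
        measure_UN_bound[OF C(1), of "\<lambda>i. {fst i..snd i}" lebesgue e] bnd by auto
    define Z where "Z = ?E \<inter> ?B - ?W"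
    have Z: "negligible Z" using C(4) by (simp add: cb Z_def)
    show "\<exists>T. ?E \<inter> ?B \<subseteq> T \<and> T \<in> lmeasurable \<and> measure lebesgue T \<le> e"
    proof (intro exI[of _ "?W \<union> Z"] conjI)
      show "?E \<inter> ?B \<subseteq> ?W \<union> Z" by (auto simp: Z_def)
      show "?W \<union> Z \<in> lmeasurable" by (rule fmeasurable.Un[OF W(1) negligible_imp_measurable[OF Z]])
      have "measure lebesgue (?W \<union> Z) \<le> measure lebesgue ?W + measure lebesgue Z"
        using fmeasurableD[OF W(1)] negligible_imp_sets[OF Z] by (rule measure_Un_le)
      then show "measure lebesgue (?W \<union> Z) \<le> e"
        using W(2) negligible_imp_measure0[OF Z] by linarith
    qed
  qed
  have "?E \<subseteq> (\<Union>n::nat. ?E \<inter> {-real n<..<real n})"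
  proof
    fix t assume t: "t \<in> ?E"
    obtain n :: nat where "\<bar>t\<bar> < real n" using reals_Archimedean2 by blast
    then have "t \<in> {-real n<..<real n}" by auto
    with t show "t \<in> (\<Union>n::nat. ?E \<inter> {-real n<..<real n})" by blast
  qed
  then show ?thesis using * by (meson negligible_Union_nat negligible_subset negligible_countable_Union)
qed

text \<open>Each failure of the limit is witnessed by two rationals that separate the value from the
  averages, for \<open>h\<close> or for \<open>- h\<close>, so countably many null sets suffice. The
  intervals need only contain \<open>t\<close>; with \<open>t\<close> as an end point they give the
  difference quotients of the indefinite integral.\<close>

lemma lebesgue_point_ae:
  fixes h :: "real \<Rightarrow> real"
  assumes h: "integrable lebesgue h"
  shows "negligible {t. \<not> (\<forall>e>0. \<exists>d>0. \<forall>p q. p \<le> t \<and> t \<le> q \<and> p < q \<and> q - p < d \<longrightarrow>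
    \<bar>(LINT s:{p..q}|lebesgue. h s) - h t * (q - p)\<bar> \<le> e * (q - p))}" (is "negligible ?Z")
proof -
  define U where "U = (\<lambda>(f::real\<Rightarrow>real) l' l. {t. f t < l' \<and>
    (\<forall>d>0. \<exists>p q. p \<le> t \<and> t \<le> q \<and> p < q \<and> q - p < d \<and> l * (q - p) < (LINT s:{p..q}|lebesgue. f s))})"
  define I where "I = {(a::real,b::real). a \<in> \<rat> \<and> b \<in> \<rat> \<and> a < b}"
  have cI: "countable I"
    by (rule countable_subset[of _ "\<rat> \<times> \<rat>"]) (auto simp: I_def countable_rat)
  define V where "V = (\<lambda>f. \<Union>(a,b)\<in>I. U f a b)"
  have nV: "negligible (V f)" if f: "integrable lebesgue f" for f :: "real \<Rightarrow> real"
    unfolding V_def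
  proof (rule negligible_countable_Union)
    show "countable ((\<lambda>(a, b). U f a b) ` I)" using cI by simp
    show "negligible T" if "T \<in> (\<lambda>(a, b). U f a b) ` I" for T
      using that negligible_upper_average[OF f] by (auto simp: I_def U_def)
  qed
  have key: "\<exists>d>0. \<forall>p q. p \<le> t \<and> t \<le> q \<and> p < q \<and> q - p < d \<longrightarrow>
      (LINT s:{p..q}|lebesgue. f s) \<le> (f t + e) * (q - p)"
    if t: "t \<notin> V f" and e: "0 < e" for t e and f :: "real \<Rightarrow> real"
  proof -
    obtain a where a: "a \<in> \<rat>" "f t < a" "a < f t + e" using Rats_dense_in_real[of "f t" "f t + e"] e by auto
    obtain b where b: "b \<in> \<rat>" "a < b" "b < f t + e" using Rats_dense_in_real[of a "f t + e"] a by auto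
    have "(a,b) \<in> I" using a b by (auto simp: I_def)
    then have "t \<notin> U f a b" using t unfolding V_def by (metis (mono_tags, lifting) UN_I case_prod_conv)
    then obtain d where d: "d > 0" 
      "\<And>p q. p \<le> t \<Longrightarrow> t \<le> q \<Longrightarrow> p < q \<Longrightarrow> q - p < d \<Longrightarrow> (LINT s:{p..q}|lebesgue. f s) \<le> b * (q - p)"
      using a(2) unfolding U_def by (simp add: not_less) (meson not_less)
    show ?thesis
    proof (intro exI[of _ d] conjI allI impI d)
      fix p q assume pq: "p \<le> t \<and> t \<le> q \<and> p < q \<and> q - p < d"
      have "b * (q - p) \<le> (f t + e) * (q - p)" using b pq by (intro mult_right_mono) auto
      moreover have "(LINT s:{p..q}|lebesgue. f s) \<le> b * (q - p)" using d(2)[of p q] pq by blast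
      ultimately show "(LINT s:{p..q}|lebesgue. f s) \<le> (f t + e) * (q - p)" by linarith
    qed
  qed
  have "?Z \<subseteq> V h \<union> V (\<lambda>x. - h x)"
  proof (rule subsetI, rule ccontr)
    fix t assume tZ: "t \<in> ?Z" and t: "t \<notin> V h \<union> V (\<lambda>x. - h x)"
    have t1: "t \<notin> V h" and t2: "t \<notin> V (\<lambda>x. - h x)" using t by blast+
    have "\<exists>d>0. \<forall>p q. p \<le> t \<and> t \<le> q \<and> p < q \<and> q - p < d \<longrightarrow>
      \<bar>(LINT s:{p..q}|lebesgue. h s) - h t * (q - p)\<bar> \<le> e * (q - p)" if e: "0 < e" for e
    proof -
      obtain d1 where d1: "d1 > 0" "\<forall>p q. p \<le> t \<and> t \<le> q \<and> p < q \<and> q - p < d1 \<longrightarrow>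
        (LINT s:{p..q}|lebesgue. h s) \<le> (h t + e) * (q - p)" using key[OF t1 e] by blast
      obtain d2 where d2: "d2 > 0" "\<forall>p q. p \<le> t \<and> t \<le> q \<and> p < q \<and> q - p < d2 \<longrightarrow>
        (LINT s:{p..q}|lebesgue. - h s) \<le> (- h t + e) * (q - p)" using key[OF t2 e] by blast
      show ?thesis
      proof (intro exI[of _ "min d1 d2"] conjI allI impI)
        fix p q assume pq: "p \<le> t \<and> t \<le> q \<and> p < q \<and> q - p < min d1 d2"
        have "(LINT s:{p..q}|lebesgue. - h s) = - (LINT s:{p..q}|lebesgue. h s)"
          by (simp add: set_lebesgue_integral_def)
        moreover have "(LINT s:{p..q}|lebesgue. h s) \<le> (h t + e) * (q - p)"
          using d1(2)[rule_format, of p q] pq by simp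
        moreover have "(LINT s:{p..q}|lebesgue. - h s) \<le> (- h t + e) * (q - p)"
          using d2(2)[rule_format, of p q] pq by simp
        ultimately have "(LINT s:{p..q}|lebesgue. h s) \<le> (h t + e) * (q - p)"
            "- (LINT s:{p..q}|lebesgue. h s) \<le> (- h t + e) * (q - p)" by simp_all
        then show "\<bar>(LINT s:{p..q}|lebesgue. h s) - h t * (q - p)\<bar> \<le> e * (q - p)"
          by (simp add: abs_le_iff algebra_simps)
      qed (use d1 d2 in auto)
    qed
    with tZ show False by blast
  qed
  then show ?thesis
    by (rule negligible_subset[OF negligible_Un[OF nV[OF h] nV[OF Bochner_Integration.integrable_minus[OF h]]]])
qed

lemma lebesgue_differentiation_real:
  fixes h :: "real \<Rightarrow> real"
  assumes h: "set_integrable lebesgue {a..b} h"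
  shows "negligible {t\<in>{a<..<b}. \<not> ((\<lambda>x. LINT s:{a..x}|lebesgue. h s) has_real_derivative h t) (at t)}"
proof -
  \<comment> \<open>Cut off outside \<open>{a..b}\<close>, the function is integrable on the whole
    line; at interior points nothing changes.\<close>
  define f where "f = (\<lambda>t. indicator {a..b} t * h t)"
  have f: "integrable lebesgue f" using h by (simp add: f_def set_integrable_def)
  let ?H = "\<lambda>x. LINT s:{a..x}|lebesgue. h s"
  have diff: "?H q - ?H p = (LINT s:{p..q}|lebesgue. f s)" if "a \<le> p" "p \<le> q" "q \<le> b" for p q
  proof -
    have si: "set_integrable lebesgue X f" if "X \<in> sets lebesgue" for X
      unfolding set_integrable_def by (rule integrable_mult_indicator[OF that f])
    have e: "?H x = (LINT s:{a..x}|lebesgue. f s)" if "x \<le> b" for x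
      unfolding set_lebesgue_integral_def f_def using that
      by (intro Bochner_Integration.integral_cong) (auto split: split_indicator)
    have "set_integrable lebesgue {a..q} f" by (rule si) simp
    from set_integral_Icc_split[OF this that(1,2)] show ?thesis using e that by simp
  qed
  show ?thesis
  proof (rule negligible_subset[OF lebesgue_point_ae[OF f]], rule subsetI, rule ccontr)
    fix t assume t: "t \<in> {t\<in>{a<..<b}. \<not> (?H has_real_derivative h t) (at t)}"
    assume "t \<notin> {t. \<not> (\<forall>e>0. \<exists>d>0. \<forall>p q. p \<le> t \<and> t \<le> q \<and> p < q \<and> q - p < d \<longrightarrow>
    \<bar>(LINT s:{p..q}|lebesgue. f s) - f t * (q - p)\<bar> \<le> e * (q - p))}"
    then have L: "\<forall>e>0. \<exists>d>0. \<forall>p q. p \<le> t \<and> t \<le> q \<and> p < q \<and> q - p < d \<longrightarrow>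
    \<bar>(LINT s:{p..q}|lebesgue. f s) - f t * (q - p)\<bar> \<le> e * (q - p)" by blast
    have ft: "f t = h t" using t by (auto simp: f_def)
    have "(?H has_derivative (\<lambda>x. h t * x)) (at t)"
      unfolding has_derivative_within_alt
    proof (intro conjI allI impI)
      fix e :: real assume "e > 0"
      then obtain d where d: "d > 0" "\<forall>p q. p \<le> t \<and> t \<le> q \<and> p < q \<and> q - p < d \<longrightarrow>
          \<bar>(LINT s:{p..q}|lebesgue. f s) - h t * (q - p)\<bar> \<le> e * (q - p)" using L ft by metis
      show "\<exists>d>0. \<forall>y\<in>UNIV. norm (y - t) < d \<longrightarrow> norm (?H y - ?H t - h t * (y - t)) \<le> e * norm (y - t)"
      proof (intro exI[of _ "min d (min (t - a) (b - t))"] conjI ballI impI)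
        show "0 < min d (min (t - a) (b - t))" using d t by auto
        fix y assume y: "norm (y - t) < min d (min (t - a) (b - t))"
        consider "y = t" | "y < t" | "t < y" by linarith
        then show "norm (?H y - ?H t - h t * (y - t)) \<le> e * norm (y - t)"
        proof cases
          case 2
          then have "\<bar>(LINT s:{y..t}|lebesgue. f s) - h t * (t - y)\<bar> \<le> e * (t - y)" using d(2) y by auto
          moreover have "?H t - ?H y = (LINT s:{y..t}|lebesgue. f s)" using 2 y t by (intro diff) auto
          ultimately show ?thesis using 2 by (simp add: abs_le_iff algebra_simps)
        next
          case 3
          then have "\<bar>(LINT s:{t..y}|lebesgue. f s) - h t * (y - t)\<bar> \<le> e * (y - t)" using d(2) y by auto
          moreover have "?H y - ?H t = (LINT s:{t..y}|lebesgue. f s)" using 3 y t by (intro diff) auto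
          ultimately show ?thesis using 3 by (simp add: abs_le_iff algebra_simps)
        qed simp
      qed
    qed (rule bounded_linear_mult_right)
    then show False using t by (simp add: has_field_derivative_def)
  qed
qed

section \<open>Absolutely continuous functions\<close>

definition var_family :: "real \<Rightarrow> real \<Rightarrow> (real \<times> real) set set" where
  "var_family s t = {P. finite P \<and> (\<forall>(p,q)\<in>P. s \<le> p \<and> p < q \<and> q \<le> t) \<and>
     disjoint_family_on (\<lambda>(p, q). {p<..<q}) P}"

definition var_sum :: "(real \<Rightarrow> real) \<Rightarrow> (real \<times> real) set \<Rightarrow> real" where
  "var_sum f P = (\<Sum>(p,q)\<in>P. \<bar>f q - f p\<bar>)"

text \<open>\<open>ennreal\<close> lets the supremum exist before it is known to be finite.
  Admitting all systems of non-overlapping intervals, not just partitions, gives the same value and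
  matches the systems in the definition of absolute continuity.\<close>

definition variation :: "(real \<Rightarrow> real) \<Rightarrow> real \<Rightarrow> real \<Rightarrow> ennreal" where
  "variation f s t = (SUP P\<in>var_family s t. ennreal (var_sum f P))"

lemma var_sum_nonneg: "0 \<le> var_sum f P"
  unfolding var_sum_def by (intro sum_nonneg) auto

lemma var_family_empty: "{} \<in> var_family s t"
  by (auto simp: var_family_def disjoint_family_on_def)

lemma var_family_finite: "P \<in> var_family s t \<Longrightarrow> finite P"
  by (auto simp: var_family_def)

lemma var_familyD: "P \<in> var_family s t \<Longrightarrow> x \<in> P \<Longrightarrow> s \<le> fst x \<and> fst x < snd x \<and> snd x \<le> t"
  by (force simp: var_family_def)

lemma var_family_disjoint:
  "P \<in> var_family s t \<Longrightarrow> x \<in> P \<Longrightarrow> y \<in> P \<Longrightarrow> x \<noteq> y \<Longrightarrow> {fst x<..<snd x} \<inter> {fst y<..<snd y} = {}"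
  unfolding var_family_def disjoint_family_on_def by (auto simp: case_prod_unfold)

lemma var_familyI:
  assumes "finite P" "\<And>x. x \<in> P \<Longrightarrow> s \<le> fst x \<and> fst x < snd x \<and> snd x \<le> t"
    "\<And>x y. x \<in> P \<Longrightarrow> y \<in> P \<Longrightarrow> x \<noteq> y \<Longrightarrow> {fst x<..<snd x} \<inter> {fst y<..<snd y} = {}"
  shows "P \<in> var_family s t"
  unfolding var_family_def disjoint_family_on_def
  using assms(1) assms(2) assms(3) by (simp add: case_prod_unfold)

text \<open>The strict inequality in \<open>var_family\<close> makes all interiors non-empty, so no
  interval lies in the refinements of two different members and the double sum has no
  repetitions.\<close>

lemma var_family_UN:
  assumes P: "P \<in> var_family s t" and Q: "\<And>x. x \<in> P \<Longrightarrow> Q x \<in> var_family (fst x) (snd x)"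
  shows "(\<Union>x\<in>P. Q x) \<in> var_family s t"
    and "\<And>F. (\<Sum>y\<in>(\<Union>x\<in>P. Q x). F y) = (\<Sum>x\<in>P. \<Sum>y\<in>Q x. (F y :: real))"
proof -
  have sub: "{fst y<..<snd y} \<subseteq> {fst x<..<snd x}" "{fst y<..<snd y} \<noteq> {}" if "x \<in> P" "y \<in> Q x" for x y
    using var_familyD[OF Q[OF that(1)] that(2)] by auto
  have ne: "Q x \<inter> Q y = {}" if "x \<in> P" "y \<in> P" "x \<noteq> y" for x y
    using sub[OF that(1)] sub[OF that(2)] var_family_disjoint[OF P that] by blast
  show "(\<Union>x\<in>P. Q x) \<in> var_family s t"
  proof (rule var_familyI)
    show "finite (\<Union>x\<in>P. Q x)" using var_family_finite[OF P] var_family_finite[OF Q] by blast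
    fix y assume "y \<in> (\<Union>x\<in>P. Q x)"
    then obtain x where x: "x \<in> P" "y \<in> Q x" by auto
    show "s \<le> fst y \<and> fst y < snd y \<and> snd y \<le> t"
      using var_familyD[OF P x(1)] var_familyD[OF Q[OF x(1)] x(2)] by auto
    fix y' assume "y' \<in> (\<Union>x\<in>P. Q x)" and ny: "y \<noteq> y'"
    then obtain x' where x': "x' \<in> P" "y' \<in> Q x'" by auto
    show "{fst y<..<snd y} \<inter> {fst y'<..<snd y'} = {}"
    proof (cases "x = x'")
      case True then show ?thesis using var_family_disjoint[OF Q[OF x(1)] x(2) _ ny] x' by auto
    next
      case False then show ?thesis
        using sub[OF x] sub[OF x'] var_family_disjoint[OF P x(1) x'(1)] by blast
    qed
  qed
  fix F :: "real \<times> real \<Rightarrow> real"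
  show "(\<Sum>y\<in>(\<Union>x\<in>P. Q x). F y) = (\<Sum>x\<in>P. \<Sum>y\<in>Q x. F y)"
    by (rule sum.UNION_disjoint[OF var_family_finite[OF P]]) (simp_all add: var_family_finite[OF Q] ne)
qed

lemma var_family_length_eq:
  assumes P: "P \<in> var_family s t"
  shows "(\<Sum>(p,q)\<in>P. q - p) = measure lebesgue (\<Union>x\<in>P. {fst x<..<snd x})"
proof -
  have "(\<Sum>x\<in>P. snd x - fst x) = (\<Sum>x\<in>P. measure lebesgue {fst x<..<snd x})"
  proof (rule sum.cong)
    fix x assume "x \<in> P"
    then have "fst x \<le> snd x" using var_familyD[OF P, of x] by linarith
    then show "snd x - fst x = measure lebesgue {fst x<..<snd x}" by simp
  qed simp
  also have "\<dots> = measure lebesgue (\<Union>x\<in>P. {fst x<..<snd x})"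
  proof (rule measure_UNION'[symmetric])
    show "pairwise (\<lambda>x y. disjnt {fst x<..<snd x} {fst y<..<snd y}) P"
      unfolding pairwise_def disjnt_def using var_family_disjoint[OF P] by blast
  qed (use var_family_finite[OF P] in auto)
  finally show ?thesis by (simp add: case_prod_unfold)
qed

lemma var_family_length:
  assumes P: "P \<in> var_family s t" "s \<le> t"
  shows "(\<Sum>(p,q)\<in>P. q - p) \<le> t - s"
proof -
  have "{fst x<..<snd x} \<subseteq> {s..t}" if "x \<in> P" for x using var_familyD[OF P(1) that] by auto
  then have "(\<Union>x\<in>P. {fst x<..<snd x}) \<subseteq> {s..t}" by blast
  then have "measure lebesgue (\<Union>x\<in>P. {fst x<..<snd x}) \<le> measure lebesgue {s..t}"
    using var_family_finite[OF P(1)] by (intro measure_mono_fmeasurable) auto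
  then show ?thesis using P(2) by (simp add: var_family_length_eq[OF P(1)])
qed

lemma disjoint_Ioo:
  assumes "{a<..<b} \<inter> {c<..<d} = {}" "a < b" "c < (d::real)"
  shows "b \<le> c \<or> d \<le> a"
proof (rule ccontr)
  assume "\<not> ?thesis"
  then have "max a c < min b d" using assms by auto
  then obtain x where "max a c < x" "x < min b d" using dense by blast
  then have "x \<in> {a<..<b} \<inter> {c<..<d}" by auto
  then show False using assms by auto
qed

text \<open>Cutting a system down to \<open>{a..b}\<close> prepares the splitting of a system at an
  intermediate point. Intervals outside \<open>{a..b}\<close> collapse to points and are filtered
  out.\<close>

lemma var_family_clip:
  fixes f :: "real \<Rightarrow> real"
  assumes P: "P \<in> var_family s t" and ab: "a \<le> b"
    and clip_def: "clip = (\<lambda>x::real \<times> real. (max a (min b (fst x)), max a (min b (snd x))))"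
  shows "clip ` P \<inter> {x. fst x < snd x} \<in> var_family a b"
    and "(\<Sum>x\<in>P. \<bar>f (snd (clip x)) - f (fst (clip x))\<bar>) = var_sum f (clip ` P \<inter> {x. fst x < snd x})"
proof -
  let ?N = "{x. fst x < (snd x::real)}" and ?F = "\<lambda>x. \<bar>f (snd x) - f (fst x)\<bar>"
  have fP: "finite P" using P by (rule var_family_finite)
  have sub: "{fst (clip x)<..<snd (clip x)} \<subseteq> {fst x<..<snd x}" for x by (auto simp: clip_def max_def min_def)
  show "clip ` P \<inter> ?N \<in> var_family a b"
  proof (rule var_familyI)
    fix x y assume x: "x \<in> clip ` P \<inter> ?N"
    then obtain x' where x': "x' \<in> P" "x = clip x'" by blast
    show "a \<le> fst x \<and> fst x < snd x \<and> snd x \<le> b" using x ab by (auto simp: x' clip_def)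
    assume "y \<in> clip ` P \<inter> ?N" "x \<noteq> y"
    then obtain y' where y': "y' \<in> P" "y = clip y'" "x' \<noteq> y'" using x' by blast
    show "{fst x<..<snd x} \<inter> {fst y<..<snd y} = {}"
      using var_family_disjoint[OF P x'(1) y'(1) y'(3)] sub[of x'] sub[of y'] unfolding x' y' by blast
  qed (use fP in auto)
  \<comment> \<open>\<open>clip\<close> need not be injective, but two different members with the
    same image have collapsed to a point and contribute 0.\<close>
  have "(\<Sum>x\<in>P. ?F (clip x)) = (\<Sum>x\<in>clip ` P. ?F x)"
  proof (subst sum.reindex_nontrivial[OF fP])
    fix x y assume xy: "x \<in> P" "y \<in> P" "x \<noteq> y" "clip x = clip y"
    then have "fst (clip x) = snd (clip x)"
      using disjoint_Ioo[OF var_family_disjoint[OF P xy(1-3)]] var_familyD[OF P xy(1)] var_familyD[OF P xy(2)]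
      by (auto simp: clip_def min_def max_def split: if_splits)
    then show "?F (clip x) = 0" by simp
  qed (simp add: o_def)
  also have "\<dots> = (\<Sum>x\<in>clip ` P \<inter> ?N. ?F x)"
  proof (rule sum.mono_neutral_right)
    show "\<forall>x\<in>clip ` P - clip ` P \<inter> ?N. ?F x = 0"
    proof
      fix x assume x: "x \<in> clip ` P - clip ` P \<inter> ?N"
      then obtain y where y: "y \<in> P" "x = clip y" by blast
      then have "fst x \<le> snd x" using var_familyD[OF P y(1)] by (simp add: clip_def min_def max_def)
      moreover have "\<not> fst x < snd x" using x by blast
      ultimately show "?F x = 0" by simp
    qed
  qed (use fP in auto)
  finally show "(\<Sum>x\<in>P. ?F (clip x)) = var_sum f (clip ` P \<inter> ?N)"
    by (simp add: var_sum_def case_prod_unfold)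
qed

text \<open>For \<open>\<le>\<close> a system is clipped on both sides of \<open>m\<close>, and the
  triangle inequality deals with an interval across \<open>m\<close>; for \<open>\<ge>\<close> a
  system on the left and one on the right are united.\<close>

lemma variation_split:
  assumes "s \<le> m" "m \<le> t"
  shows "variation f s t = variation f s m + variation f m t"
proof (rule antisym)
  show "variation f s t \<le> variation f s m + variation f m t"
    unfolding variation_def[of f s t]
  proof (rule SUP_least)
    fix P assume P: "P \<in> var_family s t"
    define L where "L = (\<lambda>x::real\<times>real. (max s (min m (fst x)), max s (min m (snd x))))"
    define R where "R = (\<lambda>x::real\<times>real. (max m (min t (fst x)), max m (min t (snd x))))"
    let ?N = "{x. fst x < (snd x::real)}" and ?F = "\<lambda>x. \<bar>f (snd x) - f (fst x)\<bar>"
    note L = var_family_clip(1)[OF P assms(1) L_def] var_family_clip(2)[OF P assms(1) L_def, of f]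
    note R = var_family_clip(1)[OF P assms(2) R_def] var_family_clip(2)[OF P assms(2) R_def, of f]
    have "var_sum f P \<le> (\<Sum>x\<in>P. ?F (L x)) + (\<Sum>x\<in>P. ?F (R x))"
      unfolding var_sum_def sum.distrib[symmetric] case_prod_unfold
    proof (rule sum_mono)
      fix x assume "x \<in> P"
      then have "s \<le> fst x" "fst x < snd x" "snd x \<le> t" using var_familyD[OF P] by blast+
      then have "L x = (min m (fst x), min m (snd x))" "R x = (max m (fst x), max m (snd x))"
        using assms by (auto simp: L_def R_def)
      then show "?F x \<le> ?F (L x) + ?F (R x)" by (auto simp: min_def max_def)
    qed
    then have "ennreal (var_sum f P) \<le> ennreal (var_sum f (L ` P \<inter> ?N)) + ennreal (var_sum f (R ` P \<inter> ?N))"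
      unfolding L(2) R(2) by (simp add: ennreal_plus[symmetric] var_sum_nonneg del: ennreal_plus)
    also have "\<dots> \<le> variation f s m + variation f m t"
      unfolding variation_def by (intro add_mono SUP_upper L R)
    finally show "ennreal (var_sum f P) \<le> variation f s m + variation f m t" .
  qed
  show "variation f s m + variation f m t \<le> variation f s t"
  proof -
    have *: "ennreal (var_sum f P) + ennreal (var_sum f Q) \<le> variation f s t"
      if P: "P \<in> var_family s m" and Q: "Q \<in> var_family m t" for P Q
    proof -
      have "False" if "x \<in> P" "x \<in> Q" for x using var_familyD[OF P that(1)] var_familyD[OF Q that(2)] by linarith
      then have dj: "P \<inter> Q = {}" by blast
      have "P \<union> Q \<in> var_family s t"
      proof (rule var_familyI)
        show "finite (P \<union> Q)" using P Q by (auto simp: var_family_finite)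
        fix x assume x: "x \<in> P \<union> Q"
        then show "s \<le> fst x \<and> fst x < snd x \<and> snd x \<le> t"
          using var_familyD[OF P, of x] var_familyD[OF Q, of x] assms by auto
        fix y assume y: "y \<in> P \<union> Q" "x \<noteq> y"
        have PQ: "{fst a<..<snd a} \<inter> {fst b<..<snd b} = {}" if "a \<in> P" "b \<in> Q" for a b
          using var_familyD[OF P that(1)] var_familyD[OF Q that(2)] by auto
        show "{fst x<..<snd x} \<inter> {fst y<..<snd y} = {}"
          using x y PQ var_family_disjoint[OF P _ _ y(2)] var_family_disjoint[OF Q _ _ y(2)] by blast
      qed
      moreover have "var_sum f (P \<union> Q) = var_sum f P + var_sum f Q"
        unfolding var_sum_def using P Q dj by (intro sum.union_disjoint) (auto simp: var_family_finite)
      ultimately show ?thesis unfolding variation_def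
        by (metis SUP_upper ennreal_plus var_sum_nonneg)
    qed
    have "variation f s m + variation f m t = (SUP P\<in>var_family s m. ennreal (var_sum f P) + variation f m t)"
      unfolding variation_def[of f s m] by (rule ennreal_SUP_add_left[symmetric]) (use var_family_empty in blast)+
    also have "\<dots> \<le> variation f s t"
    proof (rule SUP_least)
      fix P assume P: "P \<in> var_family s m"
      have "ennreal (var_sum f P) + variation f m t = (SUP Q\<in>var_family m t. ennreal (var_sum f P) + ennreal (var_sum f Q))"
        unfolding variation_def by (rule ennreal_SUP_add_right) (use var_family_empty in blast)
      also have "\<dots> \<le> variation f s t" by (rule SUP_least) (rule *[OF P])
      finally show "ennreal (var_sum f P) + variation f m t \<le> variation f s t" .
    qed
    finally show ?thesis .
  qed
qed

lemma abs_continuous_on_var_family: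
  assumes f: "abs_continuous_on {a..b} f" and e: "0 < e"
  obtains d where "0 < d" "\<And>P. P \<in> var_family a b \<Longrightarrow> (\<Sum>(p,q)\<in>P. q - p) < d \<Longrightarrow> var_sum f P < e"
proof -
  obtain d where d: "d > 0" and dd: "\<forall>P. finite P \<and> (\<forall>(p, q)\<in>P. p \<le> q \<and> {p..q} \<subseteq> {a..b}) \<and>
     disjoint_family_on (\<lambda>(a, b). {a<..<b}) P \<and> (\<Sum>(a, b)\<in>P. b - a) < d
     \<longrightarrow> (\<Sum>(a, b)\<in>P. norm (f b - f a)) < e"
    using f[unfolded abs_continuous_on_def, rule_format, OF e] by blast
  show ?thesis
  proof (rule that[OF d])
    fix P assume P: "P \<in> var_family a b" and l: "(\<Sum>(p,q)\<in>P. q - p) < d"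
    have "fst x \<le> snd x \<and> {fst x..snd x} \<subseteq> {a..b}" if "x \<in> P" for x using var_familyD[OF P that] by auto
    then have "\<forall>(p, q)\<in>P. p \<le> q \<and> {p..q} \<subseteq> {a..b}" by (auto simp: case_prod_unfold)
    with dd[rule_format, of P] P l show "var_sum f P < e"
      unfolding var_sum_def var_family_def by simp
  qed
qed

text \<open>Refining the members of \<open>P\<close> does not increase the total length, so the
  \<open>d\<close> that controls increments also controls the sums over all refinements, hence the
  sum of the suprema.\<close>

lemma variation_AC:
  assumes f: "abs_continuous_on {a..b} f" and e: "0 < e"
  obtains d where "0 < d" "\<And>P. P \<in> var_family a b \<Longrightarrow> (\<Sum>(p,q)\<in>P. q - p) < d \<Longrightarrow> (\<Sum>(p,q)\<in>P. variation f p q) \<le> ennreal e"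
proof -
  obtain d where d: "0 < d" "\<And>P. P \<in> var_family a b \<Longrightarrow> (\<Sum>(p,q)\<in>P. q - p) < d \<Longrightarrow> var_sum f P < e"
    using abs_continuous_on_var_family[OF f e] by blast
  show ?thesis
  proof (rule that[OF d(1)])
    fix P assume P: "P \<in> var_family a b" and l: "(\<Sum>(p,q)\<in>P. q - p) < d"
    have Q: "ennreal (\<Sum>x\<in>P. var_sum f (Q x)) \<le> ennreal e" if Q: "\<And>x. x \<in> P \<Longrightarrow> Q x \<in> var_family (fst x) (snd x)" for Q
    proof -
      have "(\<Sum>(p,q)\<in>(\<Union>x\<in>P. Q x). q - p) = (\<Sum>x\<in>P. \<Sum>(p,q)\<in>Q x. q - p)"
        by (rule var_family_UN(2)[OF P Q])
      also have "\<dots> \<le> (\<Sum>x\<in>P. snd x - fst x)"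
      proof (rule sum_mono)
        fix x assume x: "x \<in> P"
        show "(\<Sum>(p,q)\<in>Q x. q - p) \<le> snd x - fst x"
          using var_family_length[OF Q[OF x]] var_familyD[OF P x] by simp
      qed
      also have "\<dots> < d" using l by (simp add: case_prod_unfold)
      finally have "(\<Sum>(p,q)\<in>(\<Union>x\<in>P. Q x). q - p) < d" .
      then have "var_sum f (\<Union>x\<in>P. Q x) < e" using d(2) var_family_UN(1)[OF P Q] by blast
      also have "var_sum f (\<Union>x\<in>P. Q x) = (\<Sum>x\<in>P. var_sum f (Q x))"
        unfolding var_sum_def by (rule var_family_UN(2)[OF P Q])
      finally show ?thesis by (intro ennreal_leI) simp
    qed
    \<comment> \<open>The suprema are taken one interval at a time; \<open>c\<close> collects the
      sums over the intervals whose refinement is already fixed.\<close>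
    have *: "(\<Sum>x\<in>P1. variation f (fst x) (snd x)) + ennreal c \<le> ennreal e"
      if "finite P1" "0 \<le> c" "\<And>Q. (\<And>x. x \<in> P1 \<Longrightarrow> Q x \<in> var_family (fst x) (snd x)) \<Longrightarrow> ennreal ((\<Sum>x\<in>P1. var_sum f (Q x)) + c) \<le> ennreal e" for P1 c
      using that
    proof (induction P1 arbitrary: c rule: finite_induct)
      case empty
      then show ?case using empty(2)[of "\<lambda>_. {}"] by simp
    next
      case (insert x P1)
      have "variation f (fst x) (snd x) + ((\<Sum>x\<in>P1. variation f (fst x) (snd x)) + ennreal c) =
        (SUP R\<in>var_family (fst x) (snd x). ennreal (var_sum f R) + ((\<Sum>x\<in>P1. variation f (fst x) (snd x)) + ennreal c))"
        unfolding variation_def[of f "fst x" "snd x"] by (rule ennreal_SUP_add_left[symmetric]) (use var_family_empty in blast)+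
      also have "\<dots> \<le> ennreal e"
      proof (rule SUP_least)
        fix R assume R: "R \<in> var_family (fst x) (snd x)"
        have "(\<Sum>x\<in>P1. variation f (fst x) (snd x)) + ennreal (var_sum f R + c) \<le> ennreal e"
        proof (rule insert.IH)
          show "0 \<le> var_sum f R + c" using insert.prems(1) var_sum_nonneg by simp
          fix Q assume Q: "\<And>x. x \<in> P1 \<Longrightarrow> Q x \<in> var_family (fst x) (snd x)"
          have "(\<Sum>y\<in>P1. var_sum f (if y = x then R else Q y)) = (\<Sum>x\<in>P1. var_sum f (Q x))"
            using insert.hyps by (intro sum.cong) auto
          moreover have "ennreal ((\<Sum>y\<in>insert x P1. var_sum f (if y = x then R else Q y)) + c) \<le> ennreal e"
          proof (rule insert.prems(2))
            fix z assume "z \<in> insert x P1"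
            then show "(if z = x then R else Q z) \<in> var_family (fst z) (snd z)"
              by (cases "z = x") (use Q R in simp_all)
          qed
          ultimately show "ennreal ((\<Sum>x\<in>P1. var_sum f (Q x)) + (var_sum f R + c)) \<le> ennreal e"
            using insert.hyps by (simp add: add_ac)
        qed
        then show "ennreal (var_sum f R) + ((\<Sum>x\<in>P1. variation f (fst x) (snd x)) + ennreal c) \<le> ennreal e"
          using insert.prems(1) var_sum_nonneg[of f R] by (simp add: algebra_simps)
      qed
      finally show ?case using insert.hyps by (simp add: algebra_simps)
    qed
    show "(\<Sum>(p,q)\<in>P. variation f p q) \<le> ennreal e"
      using *[of P 0] Q P by (simp add: case_prod_unfold var_family_finite)
  qed
qed

text \<open>Steps of length \<open>d/2\<close> stay strictly below the \<open>d\<close> that belongs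
  to the bound 1, and finitely many of them reach \<open>b\<close>.\<close>

lemma variation_finite:
  assumes f: "abs_continuous_on {a..b} f" "a \<le> b"
  shows "variation f a b < \<infinity>"
proof -
  obtain d where d: "0 < d" "\<And>P. P \<in> var_family a b \<Longrightarrow> (\<Sum>(p,q)\<in>P. q - p) < d \<Longrightarrow> (\<Sum>(p,q)\<in>P. variation f p q) \<le> ennreal 1"
    using variation_AC[OF f(1), of 1] by auto
  have small: "variation f p q \<le> 1" if "a \<le> p" "p < q" "q \<le> b" "q - p < d" for p q
    using d(2)[of "{(p,q)}"] that by (simp add: var_family_def disjoint_family_on_def)
  have triv: "variation f p p = 0" for p
  proof -
    have "P = {}" if "P \<in> var_family p p" for P
      using var_familyD[OF that] by (metis all_not_in_conv less_le_trans not_less)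
    then have "var_family p p = {{}}" using var_family_empty[of p p] by blast
    then show ?thesis by (simp add: variation_def var_sum_def)
  qed
  have "variation f a (min b (a + real n * (d/2))) < \<infinity>" for n
  proof (induction n)
    case 0 then show ?case using f by (simp add: triv)
  next
    case (Suc n)
    define p where "p = min b (a + real n * (d/2))"
    define q where "q = min b (a + real (Suc n) * (d/2))"
    have pq: "a \<le> p" "p \<le> q" "q \<le> b" "q - p < d" using f(2) d(1) by (auto simp: p_def q_def min_def field_simps)
    have "variation f p q \<le> 1"
      using small[OF pq(1) _ pq(3,4)] pq(2) triv[of p] by (cases "p = q") auto
    then have "variation f p q < top" using le_less_trans ennreal_one_less_top by blast
    then have "variation f a q < top"
      using variation_split[OF pq(1,2), of f] Suc by (simp add: p_def)
    then show ?case by (simp add: q_def)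
  qed
  moreover obtain n where "b - a < real n * (d/2)" using d(1) ex_less_of_nat_mult[of "d/2" "b - a"] by auto
  then have "min b (a + real n * (d/2)) = b" by simp
  ultimately show ?thesis by metis
qed

section \<open>Densities of absolutely continuous functions\<close>

lemma interval_cover:
  assumes E: "E \<in> lmeasurable" "E \<subseteq> {a..b}" and ab: "a < b" and e: "0 < e"
  obtains D :: "(real \<times> real) set" where "countable D" "\<And>F. F \<subseteq> D \<Longrightarrow> finite F \<Longrightarrow> F \<in> var_family a b"
    "E \<subseteq> (\<Union>x\<in>D. {fst x..snd x})" "(\<Union>x\<in>D. {fst x..snd x}) \<in> lmeasurable"
    "measure lebesgue (\<Union>x\<in>D. {fst x..snd x}) \<le> measure lebesgue E + e"
proof -
  have Ecb: "E \<subseteq> cbox a b" using E by simp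
  obtain D where D: "countable D"
      "\<And>K. K \<in> D \<Longrightarrow> K \<subseteq> cbox a b \<and> K \<noteq> {} \<and> (\<exists>c d. K = cbox c d)"
      "pairwise (\<lambda>A B. interior A \<inter> interior B = {}) D"
      "\<And>K. \<lbrakk>K \<in> D; box a b \<noteq> {}\<rbrakk> \<Longrightarrow> interior K \<noteq> {}"
      "E \<subseteq> \<Union>D" "\<Union>D \<in> lmeasurable" "measure lebesgue (\<Union>D) \<le> measure lebesgue E + e"
    using measurable_outer_intervals_bounded[OF E(1) Ecb e] by metis
  define J where "J = (\<lambda>K::real set. (Inf K, Sup K))"
  have K: "{fst (J K)..snd (J K)} = K" "fst (J K) < snd (J K)" "a \<le> fst (J K)" "snd (J K) \<le> b"
    "interior K = {fst (J K)<..<snd (J K)}" if KD: "K \<in> D" for K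
  proof -
    obtain c d where cd: "K = {c..d}" using D(2)[OF KD] by auto
    have "interior K \<noteq> {}" using D(4)[OF KD] ab by auto
    then have "c < d" unfolding cd by auto
    then show "{fst (J K)..snd (J K)} = K" "fst (J K) < snd (J K)" "a \<le> fst (J K)" "snd (J K) \<le> b"
      "interior K = {fst (J K)<..<snd (J K)}" using D(2)[OF KD] unfolding J_def cd by auto
  qed
  have U: "(\<Union>x\<in>J ` D. {fst x..snd x}) = \<Union>D" using K(1) by auto
  show ?thesis
  proof (rule that[of "J ` D"])
    fix F assume F: "F \<subseteq> J ` D" "finite F"
    show "F \<in> var_family a b"
    proof (rule var_familyI[OF F(2)])
      fix x assume "x \<in> F"
      then obtain X where X: "X \<in> D" "x = J X" using F(1) by blast
      show "a \<le> fst x \<and> fst x < snd x \<and> snd x \<le> b" using K[OF X(1)] X(2) by simp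
      fix y assume "y \<in> F" and ne: "x \<noteq> y"
      then obtain Y where Y: "Y \<in> D" "y = J Y" using F(1) by blast
      have "interior X \<inter> interior Y = {}" using pairwiseD[OF D(3) X(1) Y(1)] X(2) Y(2) ne by blast
      then show "{fst x<..<snd x} \<inter> {fst y<..<snd y} = {}" using K(5)[OF X(1)] K(5)[OF Y(1)] X(2) Y(2) by simp
    qed
  qed (use D U in simp_all)
qed

text \<open>The Stieltjes measure of \<open>G\<close> is absolutely continuous: a null set is
  covered by intervals of small total length, on which \<open>G\<close> grows little. Its
  Radon-Nikodym derivative is the density.\<close>

lemma mono_AC_density:
  fixes G :: "real \<Rightarrow> real"
  assumes ab: "a < b" and mono: "\<And>s t. a \<le> s \<Longrightarrow> s \<le> t \<Longrightarrow> t \<le> b \<Longrightarrow> G s \<le> G t"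
    and ac: "\<And>e. 0 < e \<Longrightarrow> \<exists>d>0. \<forall>P\<in>var_family a b. (\<Sum>(p,q)\<in>P. q - p) < d \<longrightarrow> (\<Sum>(p,q)\<in>P. G q - G p) \<le> e"
  shows "\<exists>h. set_integrable lebesgue {a..b} h \<and> (\<forall>t\<in>{a..b}. G t - G a = (LINT s:{a..t}|lebesgue. h s))"
proof -
  have cG: "continuous_on {a..b} G"
    unfolding continuous_on_iff
  proof (intro ballI allI impI)
    fix x e assume x: "x \<in> {a..b}" and e: "0 < (e::real)"
    obtain d where d: "d > 0" "\<And>P. P \<in> var_family a b \<Longrightarrow> (\<Sum>(p,q)\<in>P. q - p) < d \<Longrightarrow> (\<Sum>(p,q)\<in>P. G q - G p) \<le> e/2"
      using ac[of "e/2"] e by auto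
    have s: "G t - G s \<le> e/2" if "a \<le> s" "s < t" "t \<le> b" "t - s < d" for s t
      using d(2)[of "{(s,t)}"] that by (simp add: var_family_def disjoint_family_on_def)
    show "\<exists>d>0. \<forall>y\<in>{a..b}. dist y x < d \<longrightarrow> dist (G y) (G x) < e"
    proof (intro exI[of _ d] conjI ballI impI d)
      fix y assume y: "y \<in> {a..b}" "dist y x < d"
      show "dist (G y) (G x) < e"
        using s[of x y] s[of y x] x y e mono[of x y] mono[of y x]
        by (cases x y rule: linorder_cases) (auto simp: dist_real_def abs_if)
    qed
  qed
  \<comment> \<open>\<open>interval_measure\<close> expects a monotone right-continuous function on
    the whole line; clamping the argument extends \<open>G\<close> by constants.\<close>
  define G' where "G' t = G (max a (min b t))" for t
  have G'[simp]: "G' t = G t" if "a \<le> t" "t \<le> b" for t using that by (simp add: G'_def)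
  have mG': "\<And>x y. x \<le> y \<Longrightarrow> G' x \<le> G' y" unfolding G'_def using ab by (intro mono) auto
  have cG': "continuous_on UNIV G'"
    unfolding G'_def using ab by (intro continuous_on_compose2[OF cG] continuous_intros) auto
  have rG': "\<And>a. continuous (at_right a) G'"
    using cG' by (simp add: continuous_on_eq_continuous_at continuous_at_imp_continuous_at_within)
  define m where "m = interval_measure G'"
  \<comment> \<open>Restriction to \<open>{a<..b}\<close> leaves only null sets inside the interval
    to be tested, where \<open>interval_cover\<close> applies.\<close>
  define n where "n = density m (indicator {a<..b})"
  have sm[simp]: "sets m = sets borel" by (simp add: m_def)
  have sn[simp]: "sets n = sets borel" by (simp add: n_def)
  have nE: "emeasure n X = emeasure m (X \<inter> {a<..b})" if "X \<in> sets borel" for X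
  proof -
    have "emeasure n X = (\<integral>\<^sup>+ x. indicator {a<..b} x * indicator X x \<partial>m)"
      unfolding n_def by (intro emeasure_density borel_measurable_indicator) (use that in simp_all)
    also have "\<dots> = (\<integral>\<^sup>+ x. indicator (X \<inter> {a<..b}) x \<partial>m)"
      by (intro nn_integral_cong) (auto split: split_indicator)
    also have "\<dots> = emeasure m (X \<inter> {a<..b})" using that by (intro nn_integral_indicator) auto
    finally show ?thesis .
  qed
  have Icc: "emeasure m {c..d} = ennreal (G d - G c)" if "a \<le> c" "c \<le> d" "d \<le> b" for c d
    using emeasure_interval_measure_Icc[OF that(2) mG' cG'] that by (simp add: m_def)
  have "absolutely_continuous lborel n"
    unfolding absolutely_continuous_def
  proof
    fix N assume N: "N \<in> null_sets (lborel :: real measure)"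
    then have Nb: "N \<in> sets borel" by auto
    define S where "S = N \<inter> {a<..b}"
    have "S \<in> null_sets lborel" using N unfolding S_def by (intro null_set_Int2) auto
    then have "S \<in> null_sets lebesgue" by (rule null_sets_completionI)
    then have S: "S \<in> lmeasurable" "measure lebesgue S = 0" 
      by (auto simp: null_sets_def fmeasurable_def measure_def)
    have "emeasure m S \<le> 0 + ennreal e" if e: "0 < e" for e
    proof -
      obtain d where d: "d > 0" "\<And>P. P \<in> var_family a b \<Longrightarrow> (\<Sum>(p,q)\<in>P. q - p) < d \<Longrightarrow> (\<Sum>(p,q)\<in>P. G q - G p) \<le> e"
        using ac[OF e] by auto
      obtain D where D: "countable D" "\<And>F. F \<subseteq> D \<Longrightarrow> finite F \<Longrightarrow> F \<in> var_family a b"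
        "S \<subseteq> (\<Union>x\<in>D. {fst x..snd x})" "(\<Union>x\<in>D. {fst x..snd x}) \<in> lmeasurable"
        "measure lebesgue (\<Union>x\<in>D. {fst x..snd x}) \<le> measure lebesgue S + d/2"
        by (rule interval_cover[OF S(1) _ ab, of "d/2"]) (use d in \<open>auto simp: S_def\<close>)
      have Dx: "a \<le> fst x" "fst x < snd x" "snd x \<le> b" if "x \<in> D" for x
        using var_familyD[OF D(2)[of "{x}"], of x] that by auto
      have mx: "emeasure m {fst x..snd x} = ennreal (G (snd x) - G (fst x))" if "x \<in> D" for x
        using Icc[of "fst x" "snd x"] Dx[OF that] by simp
      have fm: "{fst x..snd x} \<in> fmeasurable m" if "x \<in> D" for x
        using mx[OF that] by (auto simp: fmeasurable_def)
      have bd: "measure m (\<Union>x\<in>F. {fst x..snd x}) \<le> e" if F: "F \<subseteq> D" "finite F" for F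
      proof -
        note P = D(2)[OF F]
        have "(\<Sum>(p,q)\<in>F. q - p) \<le> measure lebesgue (\<Union>x\<in>D. {fst x..snd x})"
          unfolding var_family_length_eq[OF P] using F D(4)
          by (intro measure_mono_fmeasurable UN_mono) auto
        then have l: "(\<Sum>(p,q)\<in>F. q - p) < d" using D(5) S d(1) by simp
        have "measure m (\<Union>x\<in>F. {fst x..snd x}) \<le> (\<Sum>x\<in>F. measure m {fst x..snd x})"
          using F by (intro measure_UNION_le) auto
        also have "\<dots> = (\<Sum>x\<in>F. G (snd x) - G (fst x))"
        proof (rule sum.cong)
          fix x assume "x \<in> F"
          then have x: "x \<in> D" using F(1) by blast
          show "measure m {fst x..snd x} = G (snd x) - G (fst x)"
            unfolding measure_def mx[OF x] using mono[of "fst x" "snd x"] Dx[OF x] by simp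
        qed simp
        also have "\<dots> \<le> e" using d(2)[OF P l] by (simp add: case_prod_unfold)
        finally show ?thesis .
      qed
      let ?U = "\<Union>x\<in>D. {fst x..snd x}"
      have "?U \<in> fmeasurable m" "measure m ?U \<le> e"
        using fmeasurable_UN_bound[OF D(1) fm bd] measure_UN_bound[OF D(1) fm bd] by auto
      then have UD: "emeasure m ?U \<le> ennreal e" "?U \<in> sets m"
        by (auto simp: emeasure_eq_measure2 ennreal_leI)
      have "emeasure m S \<le> emeasure m ?U"
        using D(3) UD(2) by (rule emeasure_mono)
      then show ?thesis using UD(1) by simp
    qed
    then have "emeasure m S \<le> 0" by (rule ennreal_le_epsilon) 
    then show "N \<in> null_sets n" using nE[OF Nb] Nb by (auto simp: null_sets_def S_def)
  qed
  then obtain h where h: "h \<in> borel_measurable lborel" "density lborel h = n"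
    using sigma_finite_measure.Radon_Nikodym[OF sigma_finite_lborel] by (metis sn sets_lborel)
  define h0 where "h0 = (\<lambda>x. enn2real (h x))"
  have h0m: "h0 \<in> borel_measurable lborel" unfolding h0_def using h(1) by measurable
  have I: "(\<integral>\<^sup>+ x. h x * indicator {a..t} x \<partial>lborel) = ennreal (G t - G a)" if t: "t \<in> {a..b}" for t
  proof -
    have "(\<integral>\<^sup>+ x. h x * indicator {a..t} x \<partial>lborel) = emeasure n {a..t}"
      unfolding h(2)[symmetric] using h(1) by (intro emeasure_density[symmetric]) auto
    also have "\<dots> = emeasure m ({a..t} \<inter> {a<..b})" by (rule nE) simp
    also have "{a..t} \<inter> {a<..b} = {a<..t}" using t by auto
    also have "emeasure m {a<..t} = ennreal (G t - G a)"
      using emeasure_interval_measure_Ioc[OF _ mG' rG', of a t] t by (simp add: m_def)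
    finally show ?thesis .
  qed
  \<comment> \<open>The density is finite almost everywhere on \<open>{a..b}\<close>, since its
    integral there is \<open>G b - G a\<close>; hence \<open>enn2real\<close> changes nothing
    essential.\<close>
  have "AE x in lborel. h x * indicator {a..b} x \<noteq> \<infinity>"
    by (rule nn_integral_PInf_AE) (use I[of b] ab h(1) in auto)
  then have fin: "AE x in lborel. x \<in> {a..b} \<longrightarrow> h x \<noteq> \<infinity>"
    by eventually_elim (auto split: split_indicator_asm)
  have B: "has_bochner_integral lborel (\<lambda>x. indicator {a..t} x * h0 x) (G t - G a)" if t: "t \<in> {a..b}" for t
  proof (rule has_bochner_integral_nn_integral)
    have "(\<integral>\<^sup>+ x. ennreal (indicator {a..t} x * h0 x) \<partial>lborel) = (\<integral>\<^sup>+ x. h x * indicator {a..t} x \<partial>lborel)"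
      by (rule nn_integral_cong_AE, use fin in eventually_elim)
        (use t in \<open>auto simp: h0_def less_top split: split_indicator\<close>)
    then show "(\<integral>\<^sup>+ x. ennreal (indicator {a..t} x * h0 x) \<partial>lborel) = ennreal (G t - G a)" using I[OF t] by simp
    show "0 \<le> G t - G a" using mono[of a t] t by simp
  qed (use h0m in \<open>auto simp: h0_def\<close>)
  have bm: "(\<lambda>x. indicator {a..t} x * h0 x) \<in> borel_measurable lborel" for t using h0m by auto
  show ?thesis
  proof (intro exI[of _ h0] conjI ballI)
    show "set_integrable lebesgue {a..b} h0"
      using B[of b] ab integrable_completion[OF bm[of b]] by (simp add: set_integrable_def has_bochner_integral_iff)
    fix t assume t: "t \<in> {a..b}"
    show "G t - G a = (LINT s:{a..t}|lebesgue. h0 s)"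
      using B[OF t] integral_completion[OF bm[of t]] by (simp add: set_lebesgue_integral_def has_bochner_integral_iff)
  qed
qed

text \<open>Jordan decomposition: the variation function \<open>F\<close> and the sum
  \<open>F + f\<close> are both increasing and absolutely continuous, so the difference of their
  densities is a density of \<open>f\<close>.\<close>

lemma abs_continuous_real_density:
  fixes f :: "real \<Rightarrow> real"
  assumes ab: "a < b" and f: "abs_continuous_on {a..b} f"
  shows "\<exists>h. set_integrable lebesgue {a..b} h \<and> (\<forall>t\<in>{a..b}. f t - f a = (LINT s:{a..t}|lebesgue. h s))"
proof -
  define F where "F t = enn2real (variation f a t)" for t
  have fin: "variation f s t < \<infinity>" if "a \<le> s" "s \<le> t" "t \<le> b" for s t
  proof -
    have "variation f a b = variation f a s + (variation f s t + variation f t b)"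
      using variation_split[of a s b f] variation_split[of s t b f] that by simp
    then have "variation f s t \<le> variation f a b"
      by (simp add: add_increasing add_increasing2)
    then show ?thesis using variation_finite[OF f] ab by (meson le_less_trans less_imp_le)
  qed
  have dF: "F t - F s = enn2real (variation f s t)" if "a \<le> s" "s \<le> t" "t \<le> b" for s t
  proof -
    have "F t = F s + enn2real (variation f s t)"
      unfolding F_def variation_split[OF that(1,2), of f]
      using fin[of a s] fin[of s t] that by (intro enn2real_plus) auto
    then show ?thesis by simp
  qed
  have le: "\<bar>f t - f s\<bar> \<le> F t - F s" if "a \<le> s" "s < t" "t \<le> b" for s t
  proof -
    have "{(s,t)} \<in> var_family s t" using that by (simp add: var_family_def disjoint_family_on_def)
    then have "ennreal (var_sum f {(s,t)}) \<le> variation f s t" unfolding variation_def by (rule SUP_upper)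
    then have "ennreal \<bar>f t - f s\<bar> \<le> variation f s t" by (simp add: var_sum_def)
    then have "enn2real (ennreal \<bar>f t - f s\<bar>) \<le> enn2real (variation f s t)"
      using fin[of s t] that by (intro enn2real_mono) auto
    then show ?thesis using dF[of s t] that by simp
  qed
  have le0: "\<bar>f t - f s\<bar> \<le> F t - F s" if "a \<le> s" "s \<le> t" "t \<le> b" for s t
    using le[of s t] that by (cases "s = t") auto
  have acF: "\<exists>d>0. \<forall>P\<in>var_family a b. (\<Sum>(p,q)\<in>P. q - p) < d \<longrightarrow> (\<Sum>(p,q)\<in>P. F q - F p) \<le> e" if e: "0 < e" for e
  proof -
    obtain d where d: "0 < d" "\<And>P. P \<in> var_family a b \<Longrightarrow> (\<Sum>(p,q)\<in>P. q - p) < d \<Longrightarrow> (\<Sum>(p,q)\<in>P. variation f p q) \<le> ennreal e"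
      using variation_AC[OF f e] by blast
    show ?thesis
    proof (intro exI[of _ d] conjI ballI impI d(1))
      fix P assume P: "P \<in> var_family a b" and l: "(\<Sum>(p,q)\<in>P. q - p) < d"
      have dx: "ennreal (F (snd x) - F (fst x)) = variation f (fst x) (snd x)" if "x \<in> P" for x
        using dF[of "fst x" "snd x"] fin[of "fst x" "snd x"] var_familyD[OF P that] by simp
      have nn: "0 \<le> F (snd x) - F (fst x)" if "x \<in> P" for x
        using dF[of "fst x" "snd x"] var_familyD[OF P that] by simp
      have "ennreal (\<Sum>x\<in>P. F (snd x) - F (fst x)) = (\<Sum>x\<in>P. ennreal (F (snd x) - F (fst x)))"
        by (rule sum_ennreal[symmetric]) (rule nn)
      also have "\<dots> = (\<Sum>x\<in>P. variation f (fst x) (snd x))" by (rule sum.cong) (auto simp: dx)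
      also have "\<dots> \<le> ennreal e" using d(2)[OF P l] by (simp add: case_prod_unfold)
      finally show "(\<Sum>(p,q)\<in>P. F q - F p) \<le> e" using e by (simp add: case_prod_unfold)
    qed
  qed
  have F: "\<exists>h. set_integrable lebesgue {a..b} h \<and> (\<forall>t\<in>{a..b}. F t - F a = (LINT s:{a..t}|lebesgue. h s))"
  proof (rule mono_AC_density[OF ab _ acF])
    fix s t assume "a \<le> s" "s \<le> t" "t \<le> b"
    then show "F s \<le> F t" using le0[of s t] by simp
  qed
  have G: "\<exists>h. set_integrable lebesgue {a..b} h \<and> (\<forall>t\<in>{a..b}. (F t + f t) - (F a + f a) = (LINT s:{a..t}|lebesgue. h s))"
  proof (rule mono_AC_density[OF ab])
    fix s t assume "a \<le> s" "s \<le> t" "t \<le> b"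
    then show "F s + f s \<le> F t + f t" using le0[of s t] by linarith
  next
    fix e :: real assume "0 < e"
    \<comment> \<open>The increments of \<open>F + f\<close> are at most twice those of
      \<open>F\<close>, hence \<open>e/2\<close>.\<close>
    then obtain d where d: "d > 0" "\<And>P. P\<in>var_family a b \<Longrightarrow> (\<Sum>(p,q)\<in>P. q - p) < d \<Longrightarrow> (\<Sum>(p,q)\<in>P. F q - F p) \<le> e/2"
      using acF[of "e/2"] by auto
    show "\<exists>d>0. \<forall>P\<in>var_family a b. (\<Sum>(p,q)\<in>P. q - p) < d \<longrightarrow> (\<Sum>(p,q)\<in>P. F q + f q - (F p + f p)) \<le> e"
    proof (intro exI[of _ d] conjI ballI impI d(1))
      fix P assume P: "P \<in> var_family a b" and l: "(\<Sum>(p,q)\<in>P. q - p) < d"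
      have "(\<Sum>x\<in>P. F (snd x) + f (snd x) - (F (fst x) + f (fst x))) \<le> (\<Sum>x\<in>P. 2 * (F (snd x) - F (fst x)))"
      proof (rule sum_mono)
        fix x assume x: "x \<in> P"
        show "F (snd x) + f (snd x) - (F (fst x) + f (fst x)) \<le> 2 * (F (snd x) - F (fst x))"
        proof -
          have "\<bar>f (snd x) - f (fst x)\<bar> \<le> F (snd x) - F (fst x)" using var_familyD[OF P x] by (intro le) auto
          then show ?thesis using abs_le_D1 by (fastforce simp: algebra_simps)
        qed
      qed
      also have "\<dots> = 2 * (\<Sum>x\<in>P. F (snd x) - F (fst x))" by (rule sum_distrib_left[symmetric])
      also have "\<dots> \<le> e" using d(2)[OF P l] by (simp add: case_prod_unfold)
      finally show "(\<Sum>(p,q)\<in>P. F q + f q - (F p + f p)) \<le> e" by (simp add: case_prod_unfold)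
    qed
  qed
  obtain h1 where h1: "set_integrable lebesgue {a..b} h1" "\<forall>t\<in>{a..b}. F t - F a = (LINT s:{a..t}|lebesgue. h1 s)"
    using F by blast
  obtain h2 where h2: "set_integrable lebesgue {a..b} h2" "\<forall>t\<in>{a..b}. (F t + f t) - (F a + f a) = (LINT s:{a..t}|lebesgue. h2 s)"
    using G by blast
  show ?thesis
  proof (intro exI[of _ "\<lambda>s. h2 s - h1 s"] conjI ballI)
    show "set_integrable lebesgue {a..b} (\<lambda>s. h2 s - h1 s)" using h2(1) h1(1) by (rule set_integral_diff(1))
    fix t assume t: "t \<in> {a..b}"
    have "set_integrable lebesgue {a..t} h1" "set_integrable lebesgue {a..t} h2"
      using h1(1) h2(1) t by (auto intro: set_integrable_subset)
    then have "(LINT s:{a..t}|lebesgue. h2 s - h1 s) = (LINT s:{a..t}|lebesgue. h2 s) - (LINT s:{a..t}|lebesgue. h1 s)"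
      by (intro set_integral_diff(2))
    then show "f t - f a = (LINT s:{a..t}|lebesgue. h2 s - h1 s)" using h1(2)[rule_format, OF t] h2(2)[rule_format, OF t] by linarith
  qed
qed

lemma abs_continuous_on_inner:
  assumes f: "abs_continuous_on J f" and i: "i \<in> Basis"
  shows "abs_continuous_on J (\<lambda>t. f t \<bullet> i)"
  unfolding abs_continuous_on_def
proof (intro allI impI)
  fix e :: real assume "0 < e"
  then obtain d where d: "d > 0" and dd: "\<forall>P. finite P \<and> (\<forall>(p, q)\<in>P. p \<le> q \<and> {p..q} \<subseteq> J) \<and>
     disjoint_family_on (\<lambda>(a, b). {a<..<b}) P \<and> (\<Sum>(a, b)\<in>P. b - a) < d
     \<longrightarrow> (\<Sum>(a, b)\<in>P. norm (f b - f a)) < e"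
    using f[unfolded abs_continuous_on_def] by blast
  show "\<exists>\<delta>>0. \<forall>P. finite P \<and> (\<forall>(p, q)\<in>P. p \<le> q \<and> {p..q} \<subseteq> J) \<and>
     disjoint_family_on (\<lambda>(a, b). {a<..<b}) P \<and> (\<Sum>(a, b)\<in>P. b - a) < \<delta>
     \<longrightarrow> (\<Sum>(a, b)\<in>P. norm (f b \<bullet> i - f a \<bullet> i)) < e"
  proof (intro exI[of _ d] conjI allI impI d)
    fix P :: "(real \<times> real) set" assume P: "finite P \<and> (\<forall>(p, q)\<in>P. p \<le> q \<and> {p..q} \<subseteq> J) \<and>
     disjoint_family_on (\<lambda>(a, b). {a<..<b}) P \<and> (\<Sum>(a, b)\<in>P. b - a) < d"
    have "(\<Sum>(a, b)\<in>P. norm (f b \<bullet> i - f a \<bullet> i)) \<le> (\<Sum>(a, b)\<in>P. norm (f b - f a))"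
      unfolding case_prod_unfold by (rule sum_mono) (simp add: inner_diff_left[symmetric] Basis_le_norm[OF i])
    also have "\<dots> < e" using dd P by blast
    finally show "(\<Sum>(a, b)\<in>P. norm (f b \<bullet> i - f a \<bullet> i)) < e" .
  qed
qed

text \<open>The fundamental theorem of calculus for absolutely continuous curves, obtained
  coordinate by coordinate. The same \<open>h\<close> is the density of the increments and the
  derivative almost everywhere; this turns pointwise bounds on velocities into bounds on
  increments.\<close>

proposition abs_continuous_density:
  fixes f :: "real \<Rightarrow> 'b::euclidean_space"
  assumes ab: "a < b" and f: "abs_continuous_on {a..b} f"
  obtains h where "set_integrable lebesgue {a..b} h"
    "\<And>t. t \<in> {a..b} \<Longrightarrow> f t - f a = (LINT s:{a..t}|lebesgue. h s)"
    "negligible {t\<in>{a<..<b}. \<not> (f has_vector_derivative h t) (at t)}"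
proof -
  have "\<forall>i\<in>Basis. \<exists>h. set_integrable lebesgue {a..b} h \<and> (\<forall>t\<in>{a..b}. f t \<bullet> i - f a \<bullet> i = (LINT s:{a..t}|lebesgue. h s))"
    using abs_continuous_real_density[OF ab abs_continuous_on_inner[OF f]] by blast
  then obtain H where H: "\<And>i. i \<in> Basis \<Longrightarrow> set_integrable lebesgue {a..b} (H i)"
    "\<And>i t. i \<in> Basis \<Longrightarrow> t \<in> {a..b} \<Longrightarrow> f t \<bullet> i - f a \<bullet> i = (LINT s:{a..t}|lebesgue. H i s)"
    by metis
  define h where "h t = (\<Sum>i\<in>Basis. H i t *\<^sub>R i)" for t
  have Hi: "set_integrable lebesgue {a..t} (\<lambda>s. H i s *\<^sub>R i)" if "i \<in> Basis" "t \<in> {a..b}" for i t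
  proof -
    have "set_integrable lebesgue {a..t} (H i)" 
      by (rule set_integrable_subset[OF H(1)[OF that(1)]]) (use that in auto)
    then have "integrable lebesgue (\<lambda>x. (indicat_real {a..t} x * H i x) *\<^sub>R i)"
      unfolding set_integrable_def by (intro integrable_scaleR_left) simp
    then show ?thesis unfolding set_integrable_def by simp
  qed
  show ?thesis
  proof (rule that[of h])
    show "set_integrable lebesgue {a..b} h"
      using Hi[of _ b] ab unfolding h_def set_integrable_def scaleR_sum_right 
      by (intro Bochner_Integration.integrable_sum) auto
    fix t assume t: "t \<in> {a..b}"
    have "(LINT s:{a..t}|lebesgue. h s) = (\<Sum>i\<in>Basis. LINT s:{a..t}|lebesgue. H i s *\<^sub>R i)"
      unfolding set_lebesgue_integral_def h_def scaleR_sum_right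
      by (rule Bochner_Integration.integral_sum) (use Hi[OF _ t] in \<open>simp add: set_integrable_def\<close>)
    also have "\<dots> = (\<Sum>i\<in>Basis. ((f t - f a) \<bullet> i) *\<^sub>R i)"
    proof (rule sum.cong)
      fix i :: 'b assume i: "i \<in> Basis"
      have "set_integrable lebesgue {a..t} (H i)" by (rule set_integrable_subset[OF H(1)[OF i]]) (use t in auto)
      then have "(LINT s:{a..t}|lebesgue. H i s *\<^sub>R i) = (LINT s:{a..t}|lebesgue. H i s) *\<^sub>R i"
        unfolding set_lebesgue_integral_def set_integrable_def
        using integral_scaleR_left[of i lebesgue "\<lambda>x. indicat_real {a..t} x * H i x"] by simp
      then show "(LINT s:{a..t}|lebesgue. H i s *\<^sub>R i) = ((f t - f a) \<bullet> i) *\<^sub>R i"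
        using H(2)[OF i t] by (simp add: inner_diff_left)
    qed simp
    also have "\<dots> = f t - f a" by (rule euclidean_representation)
    finally show "f t - f a = (LINT s:{a..t}|lebesgue. h s)" by simp
  next
    let ?N = "\<lambda>i. {t\<in>{a<..<b}. \<not> ((\<lambda>x. LINT s:{a..x}|lebesgue. H i s) has_real_derivative H i t) (at t)}"
    have "negligible (\<Union>i\<in>Basis. ?N i)"
    proof (rule negligible_Union)
      show "negligible T" if "T \<in> ?N ` Basis" for T
        using that lebesgue_differentiation_real[OF H(1)] by blast
    qed simp
    moreover have "{t\<in>{a<..<b}. \<not> (f has_vector_derivative h t) (at t)} \<subseteq> (\<Union>i\<in>Basis. ?N i)"
    proof (rule subsetI, rule ccontr)
      fix t assume t: "t \<in> {t\<in>{a<..<b}. \<not> (f has_vector_derivative h t) (at t)}" and n: "t \<notin> (\<Union>i\<in>Basis. ?N i)"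
      have "((\<lambda>x. f x \<bullet> i) has_vector_derivative H i t) (at t)" if i: "i \<in> Basis" for i
      proof -
        have "((\<lambda>x. LINT s:{a..x}|lebesgue. H i s) has_real_derivative H i t) (at t)"
          using n i t by auto
        then have "((\<lambda>x. f a \<bullet> i + (LINT s:{a..x}|lebesgue. H i s)) has_real_derivative H i t) (at t)"
          by (auto intro!: derivative_eq_intros)
        then have "((\<lambda>x. f x \<bullet> i) has_real_derivative H i t) (at t)"
        proof (rule has_field_derivative_transform_within_open[of _ _ _ "{a<..<b}"])
          fix x assume "x \<in> {a<..<b}"
          then show "f a \<bullet> i + (LINT s:{a..x}|lebesgue. H i s) = f x \<bullet> i" using H(2)[OF i, of x] by simp
        qed (use t in auto)
        then show ?thesis by (simp add: has_real_derivative_iff_has_vector_derivative)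
      qed
      then have "((\<lambda>x. \<Sum>i\<in>Basis. (f x \<bullet> i) *\<^sub>R i) has_vector_derivative (\<Sum>i\<in>Basis. H i t *\<^sub>R i)) (at t)"
        by (intro has_vector_derivative_sum bounded_linear.has_vector_derivative[OF bounded_linear_scaleR_left])
      then show False using t by (simp add: euclidean_representation h_def)
    qed
    ultimately show "negligible {t\<in>{a<..<b}. \<not> (f has_vector_derivative h t) (at t)}"
      by (rule negligible_subset)
  qed
qed

text \<open>A cover of \<open>E\<close> by intervals that exceeds \<open>E\<close> by little measure
  carries a small integral of \<open>h\<close>, because \<open>E\<close> itself carries none; the
  images of these intervals have a total length bounded by that integral. The set \<open>E\<close>
  may have positive measure when \<open>h\<close> vanishes on it.\<close>

lemma negligible_image_indefinite_integral:
  fixes h :: "real \<Rightarrow> real"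
  assumes h: "set_integrable lebesgue {a..b} h" "\<And>x. 0 \<le> h x"
    and g: "\<And>s t. a \<le> s \<Longrightarrow> s \<le> t \<Longrightarrow> t \<le> b \<Longrightarrow> g t - g s = (LINT x:{s..t}|lebesgue. h x)"
    and E: "E \<in> sets lebesgue" "E \<subseteq> {a..b}" "(LINT x:E|lebesgue. h x) = 0" and ab: "a < b"
  shows "negligible (g ` E)"
  unfolding negligible_outer_le
proof (intro allI impI)
  fix e :: real assume e: "0 < e"
  define k where "k = (\<lambda>x. indicator {a..b} x * h x)"
  have k: "integrable lebesgue k" "\<And>x. 0 \<le> k x" using h by (auto simp: k_def set_integrable_def)
  have hk: "(LINT x:X|lebesgue. h x) = (LINT x:X|lebesgue. k x)" if "X \<subseteq> {a..b}" for X
    unfolding set_lebesgue_integral_def k_def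
    by (rule Bochner_Integration.integral_cong) (use that in \<open>auto split: split_indicator\<close>)
  obtain d where d: "d > 0" "\<And>X. X \<in> lmeasurable \<Longrightarrow> measure lebesgue X < d \<Longrightarrow> (LINT x:X|lebesgue. k x) < e"
    using integral_small_measure[OF k e] by auto
  have Eab: "E \<in> lmeasurable" by (rule bounded_set_imp_lmeasurable[OF _ E(1)]) (use E(2) bounded_subset bounded_closed_interval in blast)
  have d2: "0 < d/2" using d by simp
  obtain D where D: "countable D" "\<And>F. F \<subseteq> D \<Longrightarrow> finite F \<Longrightarrow> F \<in> var_family a b"
    "E \<subseteq> (\<Union>x\<in>D. {fst x..snd x})" "(\<Union>x\<in>D. {fst x..snd x}) \<in> lmeasurable"
    "measure lebesgue (\<Union>x\<in>D. {fst x..snd x}) \<le> measure lebesgue E + d/2"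
    by (rule interval_cover[OF Eab E(2) ab d2], rule that)
  let ?U = "\<Union>x\<in>D. {fst x..snd x}"
  have Dx: "a \<le> fst x" "fst x < snd x" "snd x \<le> b" if "x \<in> D" for x
    using var_familyD[OF D(2)[of "{x}"], of x] that by auto
  have kD: "(LINT x:?U|lebesgue. k x) \<le> e"
  proof -
    have si: "set_integrable lebesgue X k" if "X \<in> sets lebesgue" for X
      unfolding set_integrable_def by (rule integrable_mult_indicator[OF that k(1)])
    have Xm: "?U - E \<in> lmeasurable" using D(4) Eab by (rule fmeasurable.Diff)
    have "measure lebesgue (?U - E) = measure lebesgue ?U - measure lebesgue E"
      by (rule measurable_measure_Diff[OF D(4) E(1) D(3)])
    then have "(LINT x:?U - E|lebesgue. k x) < e" using d(2)[OF Xm] D(5) d(1) by simp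
    moreover have "(LINT x:(?U - E) \<union> E|lebesgue. k x) = (LINT x:?U - E|lebesgue. k x) + (LINT x:E|lebesgue. k x)"
      by (rule set_integral_Un[OF _ si si]) (use fmeasurableD[OF Xm] E(1) in auto)
    moreover have "(?U - E) \<union> E = ?U" using D(3) by auto
    ultimately show ?thesis using E(3) hk[OF E(2)] by simp
  qed
  have gm: "g s \<le> g t" if "a \<le> s" "s \<le> t" "t \<le> b" for s t
  proof -
    have "0 \<le> (LINT x:{s..t}|lebesgue. h x)" unfolding set_lebesgue_integral_def
      by (rule Bochner_Integration.integral_nonneg) (use h(2) in auto)
    then show ?thesis using g[OF that] by simp
  qed
  define J where "J x = {g (fst x)..g (snd x)}" for x
  have bd: "measure lebesgue (\<Union>x\<in>F. J x) \<le> e" if F: "F \<subseteq> D" "finite F" for F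
  proof -
    have "measure lebesgue (\<Union>x\<in>F. J x) \<le> (\<Sum>x\<in>F. measure lebesgue (J x))"
      using F(2) by (intro measure_UNION_le) (auto simp: J_def)
    \<comment> \<open>Open intervals, since neighbours in the system may share an end point.\<close>
    also have "\<dots> = (\<Sum>x\<in>F. LINT y:{fst x<..<snd x}|lebesgue. k y)"
    proof (rule sum.cong)
      fix x assume "x \<in> F"
      then have l: "a \<le> fst x" "fst x \<le> snd x" "snd x \<le> b" using Dx[of x] F(1) by auto
      have "measure lebesgue (J x) = g (snd x) - g (fst x)" using gm[OF l] by (simp add: J_def)
      also have "\<dots> = (LINT y:{fst x..snd x}|lebesgue. h y)" by (rule g[OF l])
      also have "\<dots> = (LINT y:{fst x..snd x}|lebesgue. k y)" by (rule hk) (use l in auto)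
      also have "\<dots> = (LINT y:{fst x<..<snd x}|lebesgue. k y)"
        unfolding set_lebesgue_integral_def
      proof (rule integral_cong_AE)
        show "AE y in lebesgue. indicat_real {fst x..snd x} y *\<^sub>R k y = indicat_real {fst x<..<snd x} y *\<^sub>R k y"
          by (rule AE_I'[of "{fst x, snd x}"]) (auto split: split_indicator simp: negligible_iff_null_sets[symmetric])
        show "(\<lambda>y. indicat_real {fst x..snd x} y *\<^sub>R k y) \<in> borel_measurable lebesgue"
          "(\<lambda>y. indicat_real {fst x<..<snd x} y *\<^sub>R k y) \<in> borel_measurable lebesgue"
          using k(1) by (intro borel_measurable_integrable integrable_mult_indicator; simp)+
      qed
      finally show "measure lebesgue (J x) = (LINT y:{fst x<..<snd x}|lebesgue. k y)" .
    qed simp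
    also have "\<dots> \<le> (LINT x:?U|lebesgue. k x)"
    proof (rule sum_integral_disjoint_le[OF F(2) k])
      show "{fst i<..<snd i} \<subseteq> ?U" if "i \<in> F" for i
        using that F(1) greaterThanLessThan_subseteq_atLeastAtMost_iff[of "fst i" "snd i" "fst i" "snd i"] by blast
      show "?U \<in> sets lebesgue" using D(4) by auto
      show "{fst i<..<snd i} \<inter> {fst j<..<snd j} = {}" if "i \<in> F" "j \<in> F" "i \<noteq> j" for i j
        by (rule var_family_disjoint[OF D(2)[OF F] that])
    qed auto
    also have "\<dots> \<le> e" by (rule kD)
    finally show ?thesis .
  qed
  have Jm: "J x \<in> lmeasurable" for x by (simp add: J_def)
  show "\<exists>T. g ` E \<subseteq> T \<and> T \<in> lmeasurable \<and> measure lebesgue T \<le> e"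
  proof (intro exI[of _ "\<Union>x\<in>D. J x"] conjI)
    show "g ` E \<subseteq> (\<Union>x\<in>D. J x)"
    proof (rule image_subsetI)
      fix y assume "y \<in> E"
      then obtain x where x: "x \<in> D" "fst x \<le> y" "y \<le> snd x" using D(3) by auto
      then have "g y \<in> J x" using gm[of "fst x" y] gm[of y "snd x"] Dx[OF x(1)] by (auto simp: J_def)
      then show "g y \<in> (\<Union>x\<in>D. J x)" using x(1) by blast
    qed
    show "(\<Union>x\<in>D. J x) \<in> lmeasurable" by (rule fmeasurable_UN_bound[OF D(1) Jm bd])
    show "measure lebesgue (\<Union>x\<in>D. J x) \<le> e" by (rule measure_UN_bound[OF D(1) Jm bd])
  qed
qed

lemma lipschitz_abs_continuous_on:
  assumes "\<And>s t. a \<le> s \<Longrightarrow> s \<le> t \<Longrightarrow> t \<le> b \<Longrightarrow> norm (f t - f s) \<le> C * (t - s)"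
  shows "abs_continuous_on {a..b} f"
  unfolding abs_continuous_on_def
proof (intro allI impI)
  fix e :: real assume e: "0 < e"
  show "\<exists>\<delta>>0. \<forall>P. finite P \<and> (\<forall>(p, q)\<in>P. p \<le> q \<and> {p..q} \<subseteq> {a..b}) \<and>
     disjoint_family_on (\<lambda>(a, b). {a<..<b}) P \<and> (\<Sum>(a, b)\<in>P. b - a) < \<delta>
     \<longrightarrow> (\<Sum>(a, b)\<in>P. norm (f b - f a)) < e"
  \<comment> \<open>\<open>\<bar>C\<bar> + 1\<close> is positive and at least \<open>C\<close>,
    whatever the sign of \<open>C\<close>.\<close>
  proof (intro exI[of _ "e / (\<bar>C\<bar> + 1)"] conjI allI impI)
    show "0 < e / (\<bar>C\<bar> + 1)" using e by simp
    fix P :: "(real \<times> real) set" assume P: "finite P \<and> (\<forall>(p, q)\<in>P. p \<le> q \<and> {p..q} \<subseteq> {a..b}) \<and>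
     disjoint_family_on (\<lambda>(a, b). {a<..<b}) P \<and> (\<Sum>(a, b)\<in>P. b - a) < e / (\<bar>C\<bar> + 1)"
    have "(\<Sum>(p, q)\<in>P. norm (f q - f p)) \<le> (\<Sum>(p, q)\<in>P. (\<bar>C\<bar> + 1) * (q - p))"
    proof (rule sum_mono)
      fix x assume x: "x \<in> P"
      obtain p q where pq: "x = (p, q)" by (cases x)
      have le: "p \<le> q" "{p..q} \<subseteq> {a..b}" using P x pq by auto
      then have "norm (f q - f p) \<le> C * (q - p)" by (intro assms) auto
      also have "\<dots> \<le> (\<bar>C\<bar> + 1) * (q - p)" using le(1) by (intro mult_right_mono) auto
      finally show "(case x of (p, q) \<Rightarrow> norm (f q - f p)) \<le> (case x of (p, q) \<Rightarrow> (\<bar>C\<bar> + 1) * (q - p))"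
        using pq by simp
    qed
    also have "\<dots> = (\<bar>C\<bar> + 1) * (\<Sum>(p, q)\<in>P. q - p)" by (simp add: sum_distrib_left case_prod_unfold)
    also have "\<dots> < e" using P e by (simp add: field_simps)
    finally show "(\<Sum>(p, q)\<in>P. norm (f q - f p)) < e" .
  qed
qed

section \<open>Tangent vectors and holomorphic discs\<close>

lemma norm_vector_scalar: "norm (c *s (x :: complex ^ 'n::finite)) = cmod c * norm x"
proof -
  have "norm (c *s x) = L2_set (\<lambda>i. cmod c * norm (x $ i)) UNIV"
    by (simp add: norm_vec_def norm_mult)
  also have "\<dots> = cmod c * norm x" by (simp add: norm_vec_def L2_set_right_distrib)
  finally show ?thesis .
qed

lemma vector_scalar_of_real: "complex_of_real r *s (x :: complex ^ 'n::finite) = r *\<^sub>R x"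
  by (simp add: vec_eq_iff scaleR_conv_of_real[where 'a = complex])

lemma bounded_linear_vector_scalar: "bounded_linear (\<lambda>\<zeta>. \<zeta> *s (x :: complex ^ 'n::finite))"
  by (rule bounded_linear_intro[of _ "norm x"])
    (simp_all add: vec_eq_iff distrib_right norm_vector_scalar)

lemma mult_right_eq_mult: "(\<lambda>\<zeta>. \<zeta> * w) = (*) (w :: 'b::comm_semiring_0)"
  by (simp add: fun_eq_iff mult.commute)

text \<open>For maps into \<open>complex ^ 'n\<close> complex differentiability is written as a real
  Frechet derivative of the form \<open>\<zeta> *s w\<close>; this lemma and the next one translate
  to and from the scalar components.\<close>

lemma vector_has_derivative_component:
  assumes "(g has_derivative (\<lambda>\<zeta>. \<zeta> *s (w :: complex ^ 'n::finite))) (at \<zeta>0)"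
  shows "((\<lambda>\<zeta>. g \<zeta> $ i) has_field_derivative w $ i) (at \<zeta>0)"
  using bounded_linear.has_derivative[OF bounded_linear_vec_nth assms, of i]
  by (simp add: has_field_derivative_def mult_right_eq_mult)

lemma vector_has_derivativeI:
  assumes "\<And>i. ((\<lambda>\<zeta>. g \<zeta> $ i) has_field_derivative (w :: complex ^ 'n::finite) $ i) (at \<zeta>0)"
  shows "(g has_derivative (\<lambda>\<zeta>. \<zeta> *s w)) (at \<zeta>0)"
proof -
  have "((\<lambda>\<zeta>. (g \<zeta> $ i)) has_derivative (\<lambda>\<zeta>. \<zeta> * w $ i)) (at \<zeta>0)" for i
    using assms[of i] by (simp add: has_field_derivative_def mult_right_eq_mult)
  then have c: "((\<lambda>y. ((g y $ i - g \<zeta>0 $ i) - (y - \<zeta>0) * w $ i) /\<^sub>R cmod (y - \<zeta>0)) \<longlongrightarrow> 0) (at \<zeta>0)" for i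
    by (simp add: has_derivative_at_within)
  have "((\<lambda>y. (g y - g \<zeta>0 - (y - \<zeta>0) *s w) /\<^sub>R cmod (y - \<zeta>0)) \<longlongrightarrow> 0) (at \<zeta>0)"
    by (rule vec_tendstoI) (use c in \<open>simp add: left_diff_distrib\<close>)
  then show ?thesis
    by (simp add: has_derivative_at_within bounded_linear_vector_scalar)
qed

text \<open>The components are those in \<open>kobayashi_metric\<close>, so that its condition on
  \<open>v\<close> becomes an equation of vectors.\<close>

definition centre_deriv :: "('a, 'n::finite) chart \<Rightarrow> (complex \<Rightarrow> 'a) \<Rightarrow> complex ^ 'n" where
  "centre_deriv c f = (\<chi> i. deriv (\<lambda>\<zeta>. snd c (f \<zeta>) $ i) 0)"

definition chart_inv :: "('a, 'n::finite) chart \<Rightarrow> complex ^ 'n \<Rightarrow> 'a" where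
  "chart_inv c = inv_into (fst c) (snd c)"

definition transition_deriv :: "('a, 'n::finite) chart \<Rightarrow> ('a, 'n) chart \<Rightarrow> 'a \<Rightarrow> complex ^ 'n \<Rightarrow> complex ^ 'n" where
  "transition_deriv c d x = frechet_derivative (transition c d) (at (snd c x))"

lemma transition_eq: "transition c d z = snd d (chart_inv c z)"
  by (simp add: transition_def chart_inv_def case_prod_unfold)

section \<open>Charts and tangent vectors\<close>

locale complex_mfd =
  fixes M :: "'a::{t2_space, second_countable_topology} set"
    and A :: "('a, 'n::finite) chart set"
  assumes cm: "complex_manifold M A"
begin

lemma chart: 
  assumes "c \<in> A"
  shows chart_openin: "openin (top_of_set M) (fst c)" and chart_open: "open (snd c ` fst c)"
    and chart_homeo: "homeomorphism (fst c) (snd c ` fst c) (snd c) (chart_inv c)"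
    and chart_sub: "fst c \<subseteq> M"
proof -
  have "chart_on M c" using cm assms by (auto simp: complex_manifold_def)
  then show "openin (top_of_set M) (fst c)" "open (snd c ` fst c)" 
    "homeomorphism (fst c) (snd c ` fst c) (snd c) (chart_inv c)" 
    by (auto simp: chart_on_def case_prod_unfold chart_inv_def)
  then show "fst c \<subseteq> M" using openin_imp_subset by blast
qed

lemma chart_ex: "x \<in> M \<Longrightarrow> \<exists>c\<in>A. x \<in> fst c"
  using cm by (auto simp: complex_manifold_def)

lemma chart_inv_left: "c \<in> A \<Longrightarrow> x \<in> fst c \<Longrightarrow> chart_inv c (snd c x) = x"
  using chart_homeo by (simp add: homeomorphism_def)

lemma chart_inv_right: "c \<in> A \<Longrightarrow> z \<in> snd c ` fst c \<Longrightarrow> snd c (chart_inv c z) = z"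
  by (auto simp: chart_inv_left)

lemma chart_inv_in: "c \<in> A \<Longrightarrow> z \<in> snd c ` fst c \<Longrightarrow> chart_inv c z \<in> fst c"
  by (auto simp: chart_inv_left)

lemma chart_cont: "c \<in> A \<Longrightarrow> continuous_on (fst c) (snd c)"
  using chart_homeo by (simp add: homeomorphism_def)

lemma chart_inv_cont: "c \<in> A \<Longrightarrow> continuous_on (snd c ` fst c) (chart_inv c)"
  using chart_homeo by (simp add: homeomorphism_def)

lemma overlap_open: 
  assumes c: "c \<in> A" and S: "openin (top_of_set M) S"
  shows "open (snd c ` (fst c \<inter> S))"
proof -
  have "openin (top_of_set (fst c)) (fst c \<inter> S)"
    using S chart_sub[OF c] by (auto simp: openin_open)
  then have "openin (top_of_set (snd c ` fst c)) (snd c ` (fst c \<inter> S))"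
    using homeomorphism_imp_open_map[OF chart_homeo[OF c]] by blast
  then show ?thesis using chart_open[OF c] openin_open_eq by blast
qed

lemma transition_has_derivative:
  assumes "c \<in> A" "d \<in> A" "x \<in> fst c" "x \<in> fst d"
  shows "(transition c d has_derivative transition_deriv c d x) (at (snd c x))"
    and "Vector_Spaces.linear (*s) (*s) (transition_deriv c d x)"
proof -
  have "compatible c d" using cm assms by (auto simp: complex_manifold_def)
  then obtain D where D: "Vector_Spaces.linear (*s) (*s) D" "(transition c d has_derivative D) (at (snd c x))"
    using assms by (auto simp: compatible_def holomorphic_map_on_def)
  then have "D = transition_deriv c d x" unfolding transition_deriv_def by (intro frechet_derivative_at)
  with D show "(transition c d has_derivative transition_deriv c d x) (at (snd c x))" "Vector_Spaces.linear (*s) (*s) (transition_deriv c d x)"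
    by auto
qed

lemma transition_deriv_scale: 
  assumes "c \<in> A" "d \<in> A" "x \<in> fst c" "x \<in> fst d"
  shows "transition_deriv c d x (\<zeta> *s w) = \<zeta> *s transition_deriv c d x w" "transition_deriv c d x (r *\<^sub>R w) = r *\<^sub>R transition_deriv c d x w"
  using transition_has_derivative(2)[OF assms] by (simp_all add: Vector_Spaces.linear_iff flip: vector_scalar_of_real)

lemma transition_deriv_id: 
  assumes c: "c \<in> A" "x \<in> fst c"
  shows "transition_deriv c c x = (\<lambda>w. w)"
proof -
  have "(transition c c has_derivative (\<lambda>w. w)) (at (snd c x))"
  proof (rule has_derivative_transform_within_open[OF has_derivative_ident chart_open[OF c(1)]])
    show "snd c x \<in> snd c ` fst c" using c by simp
  qed (simp add: transition_eq chart_inv_right c)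
  then show ?thesis unfolding transition_deriv_def by (intro frechet_derivative_at[symmetric])
qed

lemma transition_deriv_comp:
  assumes "c \<in> A" "d \<in> A" "e \<in> A" "x \<in> fst c" "x \<in> fst d" "x \<in> fst e"
  shows "transition_deriv d e x (transition_deriv c d x w) = transition_deriv c e x w"
proof -
  have x: "transition c d (snd c x) = snd d x" using assms by (simp add: transition_eq chart_inv_left)
  have "(transition d e \<circ> transition c d has_derivative transition_deriv d e x \<circ> transition_deriv c d x) (at (snd c x))"
    by (rule diff_chain_at[OF transition_has_derivative(1)]) (use x transition_has_derivative(1)[of d e x] assms in auto)
  then have "(transition c e has_derivative transition_deriv d e x \<circ> transition_deriv c d x) (at (snd c x))"
  proof (rule has_derivative_transform_within_open)
    show "open (snd c ` (fst c \<inter> fst d))" using overlap_open assms(1) chart_openin[OF assms(2)] .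
    show "snd c x \<in> snd c ` (fst c \<inter> fst d)" using assms by blast
    fix z assume "z \<in> snd c ` (fst c \<inter> fst d)"
    then obtain y where "y \<in> fst c" "y \<in> fst d" "z = snd c y" by blast
    then show "(transition d e \<circ> transition c d) z = transition c e z"
      using assms by (simp add: transition_eq chart_inv_left)
  qed
  then have "transition_deriv d e x \<circ> transition_deriv c d x = transition_deriv c e x" unfolding transition_deriv_def by (rule frechet_derivative_at)
  then show ?thesis by (metis comp_apply)
qed

text \<open>For a chart \<open>c\<close> around \<open>x\<close> this inverts reading off the
  coordinate vector in \<open>c\<close>: it is the only tangent vector at \<open>x\<close> with
  coordinates \<open>w\<close> there. The value 0 elsewhere is the convention of
  \<open>tangent_space\<close>.\<close>

definition tangent_of :: "('a, 'n) chart \<Rightarrow> 'a \<Rightarrow> complex ^ 'n \<Rightarrow> ('a, 'n) chart \<Rightarrow> complex ^ 'n" where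
  "tangent_of c x w = (\<lambda>d. if d \<in> A \<and> x \<in> fst d then transition_deriv c d x w else 0)"

lemma tangent_of_self: "c \<in> A \<Longrightarrow> x \<in> fst c \<Longrightarrow> tangent_of c x w c = w"
  by (simp add: tangent_of_def transition_deriv_id)

lemma tangent_space_alt: "v \<in> tangent_space A x \<longleftrightarrow> 
   (\<forall>c\<in>A. \<forall>d\<in>A. x \<in> fst c \<and> x \<in> fst d \<longrightarrow> v d = transition_deriv c d x (v c)) \<and>
   (\<forall>c. \<not> (c \<in> A \<and> x \<in> fst c) \<longrightarrow> v c = 0)"
  by (simp add: tangent_space_def transition_deriv_def)

lemma tangent_of_tangent: "c \<in> A \<Longrightarrow> x \<in> fst c \<Longrightarrow> tangent_of c x w \<in> tangent_space A x"
  unfolding tangent_space_alt by (simp add: tangent_of_def transition_deriv_comp)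

lemma tangent_eq_tangent_of: 
  assumes "v \<in> tangent_space A x" "c \<in> A" "x \<in> fst c"
  shows "v = tangent_of c x (v c)"
proof
  fix d show "v d = tangent_of c x (v c) d"
  proof (cases "d \<in> A \<and> x \<in> fst d")
    case True
    then have "v d = transition_deriv c d x (v c)" using assms unfolding tangent_space_alt by blast
    then show ?thesis using True by (simp add: tangent_of_def)
  next
    case False
    then have "v d = 0" using assms(1) unfolding tangent_space_alt by blast
    then show ?thesis using False by (auto simp: tangent_of_def)
  qed
qed

lemma tangent_zero: "x \<in> M \<Longrightarrow> (\<lambda>_. 0) \<in> tangent_space A x"
  unfolding tangent_space_alt
proof (intro conjI ballI impI allI)
  fix c d assume "c \<in> A" "d \<in> A" "x \<in> fst c \<and> x \<in> fst d"
  then show "0 = transition_deriv c d x 0" using transition_deriv_scale(2)[of c d x 0 0] by simp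
qed simp

lemma tangent_scale: 
  assumes "v \<in> tangent_space A x"
  shows "(\<lambda>c. r *\<^sub>R v c) \<in> tangent_space A x"
  unfolding tangent_space_alt
proof (intro conjI ballI impI allI)
  fix c d assume "c \<in> A" "d \<in> A" "x \<in> fst c \<and> x \<in> fst d"
  moreover from this have "v d = transition_deriv c d x (v c)" using assms unfolding tangent_space_alt by blast
  ultimately show "r *\<^sub>R v d = transition_deriv c d x (r *\<^sub>R v c)" by (simp add: transition_deriv_scale(2))
next
  fix c assume "\<not> (c \<in> A \<and> x \<in> fst c)"
  then have "v c = 0" using assms unfolding tangent_space_alt by blast
  then show "r *\<^sub>R v c = 0" by simp
qed

section \<open>Holomorphic discs and their derivative at the centre\<close>

abbreviation disc :: "(complex \<Rightarrow> 'a) \<Rightarrow> bool" where "disc \<equiv> holomorphic_disc M A"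

lemma discI:
  assumes "continuous_on (ball 0 1) f" "\<And>\<zeta>. \<zeta> \<in> ball 0 1 \<Longrightarrow> f \<zeta> \<in> M"
    and "\<And>c i \<zeta>. c \<in> A \<Longrightarrow> \<zeta> \<in> ball 0 1 \<Longrightarrow> f \<zeta> \<in> fst c \<Longrightarrow> \<exists>D. ((\<lambda>\<zeta>. snd c (f \<zeta>) $ i) has_field_derivative D) (at \<zeta>)"
  shows "disc f"
  unfolding holomorphic_disc_def case_prod_unfold holomorphic_on_def
proof (intro conjI ballI allI)
  fix c i \<zeta> assume "c \<in> A" "\<zeta> \<in> {\<zeta> \<in> ball 0 1. f \<zeta> \<in> fst c}"
  then have "(\<lambda>\<zeta>. snd c (f \<zeta>) $ i) field_differentiable at \<zeta>"
    using assms(3)[of c \<zeta> i] by (auto simp: field_differentiable_def)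
  then show "(\<lambda>\<zeta>. snd c (f \<zeta>) $ i) field_differentiable at \<zeta> within {\<zeta> \<in> ball 0 1. f \<zeta> \<in> fst c}"
    by (rule field_differentiable_at_within)
qed (use assms(1,2) in auto)

lemma disc_cont: "disc f \<Longrightarrow> continuous_on (ball 0 1) f"
  and disc_in: "disc f \<Longrightarrow> cmod \<zeta> < 1 \<Longrightarrow> f \<zeta> \<in> M"
  by (auto simp: holomorphic_disc_def)

lemma disc_open: 
  assumes "disc f" "openin (top_of_set M) S"
  shows "open {\<zeta> \<in> ball 0 1. f \<zeta> \<in> S}"
proof -
  obtain T where T: "open T" "S = M \<inter> T" using assms(2) by (auto simp: openin_open)
  have "open (ball 0 1 \<inter> f -` T)" 
    by (rule continuous_open_preimage[OF disc_cont[OF assms(1)] open_ball T(1)])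
  moreover have "ball 0 1 \<inter> f -` T = {\<zeta> \<in> ball 0 1. f \<zeta> \<in> S}"
    using T disc_in[OF assms(1)] by auto
  ultimately show ?thesis by simp
qed

lemma disc_holo:
  assumes "disc f" "c \<in> A" 
  shows "(\<lambda>\<zeta>. snd c (f \<zeta>) $ i) holomorphic_on {\<zeta> \<in> ball 0 1. f \<zeta> \<in> fst c}"
  using assms unfolding holomorphic_disc_def by (auto simp: case_prod_unfold)

lemma disc_deriv:
  assumes "disc f" "c \<in> A" "cmod \<zeta> < 1" "f \<zeta> \<in> fst c"
  shows "\<exists>w. ((\<lambda>\<zeta>. snd c (f \<zeta>)) has_derivative (\<lambda>\<eta>. \<eta> *s w)) (at \<zeta>)"
proof -
  have "((\<lambda>\<zeta>. snd c (f \<zeta>) $ i) has_field_derivative deriv (\<lambda>\<zeta>. snd c (f \<zeta>) $ i) \<zeta>) (at \<zeta>)" for i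
    by (rule holomorphic_derivI[OF disc_holo[OF assms(1,2)] disc_open[OF assms(1) chart_openin[OF assms(2)]]])
      (use assms in auto)
  then have "((\<lambda>\<zeta>. snd c (f \<zeta>)) has_derivative (\<lambda>\<eta>. \<eta> *s (\<chi> i. deriv (\<lambda>\<zeta>. snd c (f \<zeta>) $ i) \<zeta>))) (at \<zeta>)"
    by (intro vector_has_derivativeI) simp
  then show ?thesis by blast
qed

lemma centre_deriv_eq:
  assumes "((\<lambda>\<zeta>. snd c (f \<zeta>)) has_derivative (\<lambda>\<eta>. \<eta> *s w)) (at 0)"
  shows "centre_deriv c f = w"
  unfolding centre_deriv_def vec_eq_iff
  using DERIV_imp_deriv[OF vector_has_derivative_component[OF assms]] by simp

lemma disc_centre_deriv:
  assumes "disc f" "c \<in> A" "f 0 \<in> fst c"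
  shows "((\<lambda>\<zeta>. snd c (f \<zeta>)) has_derivative (\<lambda>\<eta>. \<eta> *s centre_deriv c f)) (at 0)"
  using disc_deriv[OF assms(1,2) _ assms(3)] centre_deriv_eq by fastforce

lemma centre_deriv_change:
  assumes f: "disc f" and c: "c \<in> A" "f 0 \<in> fst c" and d: "d \<in> A" "f 0 \<in> fst d"
  shows "centre_deriv d f = transition_deriv c d (f 0) (centre_deriv c f)"
proof (rule centre_deriv_eq)
  have "(transition c d \<circ> (\<lambda>\<zeta>. snd c (f \<zeta>)) has_derivative transition_deriv c d (f 0) \<circ> (\<lambda>\<eta>. \<eta> *s centre_deriv c f)) (at 0)"
    by (rule diff_chain_at[OF disc_centre_deriv[OF f c] transition_has_derivative(1)[OF c(1) d(1) c(2) d(2)]])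
  then have "((\<lambda>\<zeta>. snd d (f \<zeta>)) has_derivative transition_deriv c d (f 0) \<circ> (\<lambda>\<eta>. \<eta> *s centre_deriv c f)) (at 0)"
  proof (rule has_derivative_transform_within_open)
    show "open {\<zeta> \<in> ball 0 1. f \<zeta> \<in> fst c}" by (rule disc_open[OF f chart_openin[OF c(1)]])
  qed (use c in \<open>auto simp: transition_eq chart_inv_left\<close>)
  then show "((\<lambda>\<zeta>. snd d (f \<zeta>)) has_derivative (\<lambda>\<eta>. \<eta> *s transition_deriv c d (f 0) (centre_deriv c f))) (at 0)"
    by (simp add: o_def transition_deriv_scale(1)[OF c(1) d(1) c(2) d(2)])
qed

text \<open>The competitors in the infimum that defines the metric, seen in one chart only.\<close>

definition kr_scales :: "('a, 'n) chart \<Rightarrow> 'a \<Rightarrow> complex ^ 'n \<Rightarrow> real set" where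
  "kr_scales c x w = {\<alpha>. \<alpha> > 0 \<and> (\<exists>f. disc f \<and> f 0 = x \<and> w = \<alpha> *\<^sub>R centre_deriv c f)}"

text \<open>A tangent vector and the derivative of a disc change charts by the same linear maps, so
  their proportionality in one chart implies it in all.\<close>

lemma kobayashi_metric_chart:
  assumes v: "v \<in> tangent_space A x" and c: "c \<in> A" "x \<in> fst c"
  shows "kobayashi_metric M A x v = Inf (kr_scales c x (v c))"
proof -
  have eq: "(\<forall>(U, \<phi>)\<in>A. x \<in> U \<longrightarrow> v (U, \<phi>) = \<alpha> *\<^sub>R (\<chi> i. deriv (\<lambda>\<zeta>. \<phi> (f \<zeta>) $ i) 0)) \<longleftrightarrow> v c = \<alpha> *\<^sub>R centre_deriv c f"
    if f: "disc f" "f 0 = x" for f \<alpha>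
  proof
    assume "\<forall>(U, \<phi>)\<in>A. x \<in> U \<longrightarrow> v (U, \<phi>) = \<alpha> *\<^sub>R (\<chi> i. deriv (\<lambda>\<zeta>. \<phi> (f \<zeta>) $ i) 0)"
    then show "v c = \<alpha> *\<^sub>R centre_deriv c f" using c by (auto simp: centre_deriv_def case_prod_unfold)
  next
    assume e: "v c = \<alpha> *\<^sub>R centre_deriv c f"
    have "v d = \<alpha> *\<^sub>R centre_deriv d f" if d: "d \<in> A" "x \<in> fst d" for d
    proof -
      have "v d = transition_deriv c d x (v c)" using v c d unfolding tangent_space_alt by blast
      also have "\<dots> = \<alpha> *\<^sub>R transition_deriv c d x (centre_deriv c f)" unfolding e using c d by (intro transition_deriv_scale(2))
      also have "transition_deriv c d x (centre_deriv c f) = centre_deriv d f" using centre_deriv_change[OF f(1), of c d] c d f by simp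
      finally show ?thesis .
    qed
    then show "\<forall>(U, \<phi>)\<in>A. x \<in> U \<longrightarrow> v (U, \<phi>) = \<alpha> *\<^sub>R (\<chi> i. deriv (\<lambda>\<zeta>. \<phi> (f \<zeta>) $ i) 0)"
      by (auto simp: centre_deriv_def)
  qed
  have "{\<alpha>. \<alpha> > 0 \<and> (\<exists>f. disc f \<and> f 0 = x \<and>
     (\<forall>(U, \<phi>)\<in>A. x \<in> U \<longrightarrow> v (U, \<phi>) = \<alpha> *\<^sub>R (\<chi> i. deriv (\<lambda>\<zeta>. \<phi> (f \<zeta>) $ i) 0)))} = kr_scales c x (v c)"
    unfolding kr_scales_def by (intro Collect_cong conj_cong refl ex_cong1 eq)
  then show ?thesis unfolding kobayashi_metric_def by simp
qed

text \<open>Affine discs in a coordinate ball are the explicit competitors behind the upper bounds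
  on the metric and on the Kobayashi distance. The case \<open>norm u = r\<close> is admissible
  because parameters have modulus below 1.\<close>

lemma chart_disc:
  assumes c: "c \<in> A" and b: "ball z r \<subseteq> snd c ` fst c" and u: "norm u \<le> r" and r: "0 < r"
  shows "disc (\<lambda>\<zeta>. chart_inv c (z + \<zeta> *s u))" (is "disc ?f")
    and "centre_deriv c (\<lambda>\<zeta>. chart_inv c (z + \<zeta> *s u)) = u"
proof -
  have inb: "z + \<zeta> *s u \<in> snd c ` fst c" if "cmod \<zeta> < 1" for \<zeta>
  proof -
    have "norm (\<zeta> *s u) < r"
    proof (cases "u = 0")
      case False
      then have "cmod \<zeta> * norm u < 1 * norm u" using that by (intro mult_strict_right_mono) auto
      then show ?thesis using u by (simp add: norm_vector_scalar)
    qed (use r in simp)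
    then show ?thesis using b by (auto simp: dist_norm intro!: subsetD[OF b])
  qed
  show "disc ?f"
  proof -
    have d: "((\<lambda>\<zeta>. z + \<zeta> *s u) has_derivative (\<lambda>\<eta>. \<eta> *s u)) (at \<zeta>)" for \<zeta>
      using bounded_linear_imp_has_derivative[OF bounded_linear_vector_scalar[of u], of "at \<zeta>"]
      by (auto intro!: derivative_eq_intros)
    show ?thesis
    proof (rule discI)
      have "continuous_on (ball 0 1) (\<lambda>\<zeta>. z + \<zeta> *s u)"
        by (intro continuous_at_imp_continuous_on ballI has_derivative_continuous[OF d])
      then show "continuous_on (ball 0 1) ?f"
        by (rule continuous_on_compose2[OF chart_inv_cont[OF c]]) (use inb in auto)
      show "?f \<zeta> \<in> M" if "\<zeta> \<in> ball 0 1" for \<zeta>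
        using chart_inv_in[OF c inb] chart_sub[OF c] that by auto
      fix e i \<zeta> assume e: "e \<in> A" and z: "\<zeta> \<in> ball (0::complex) 1" "?f \<zeta> \<in> fst e"
      have z': "?f \<zeta> \<in> fst c" "snd c (?f \<zeta>) = z + \<zeta> *s u"
        using chart_inv_in[OF c inb] chart_inv_right[OF c inb] z by auto
      have "(transition c e \<circ> (\<lambda>\<zeta>. z + \<zeta> *s u) has_derivative transition_deriv c e (?f \<zeta>) \<circ> (\<lambda>\<eta>. \<eta> *s u)) (at \<zeta>)"
        by (rule diff_chain_at[OF d]) (use transition_has_derivative(1)[OF c e z'(1) z(2)] z'(2) in simp)
      then have "((\<lambda>\<zeta>. snd e (?f \<zeta>)) has_derivative (\<lambda>\<eta>. \<eta> *s transition_deriv c e (?f \<zeta>) u)) (at \<zeta>)"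
        by (simp add: o_def transition_deriv_scale(1)[OF c e z'(1) z(2)] transition_eq)
      from vector_has_derivative_component[OF this]
      show "\<exists>D. ((\<lambda>\<zeta>. snd e (?f \<zeta>) $ i) has_field_derivative D) (at \<zeta>)" by blast
    qed
  qed
  show "centre_deriv c ?f = u"
  proof (rule centre_deriv_eq)
    have "((\<lambda>\<zeta>. z + \<zeta> *s u) has_derivative (\<lambda>\<eta>. \<eta> *s u)) (at 0)"
      using bounded_linear_imp_has_derivative[OF bounded_linear_vector_scalar[of u], of "at 0"]
      by (auto intro!: derivative_eq_intros)
    then show "((\<lambda>\<zeta>. snd c (?f \<zeta>)) has_derivative (\<lambda>\<eta>. \<eta> *s u)) (at 0)"
      by (rule has_derivative_transform_within_open[of _ _ _ _ "ball 0 1"])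
        (use inb r in \<open>auto simp: chart_inv_right c\<close>)
  qed
qed

text \<open>Serves both for shrinking a disc (\<open>a = 0\<close>) and for recentring it at
  \<open>a\<close>. Equality \<open>cmod a + s = 1\<close> is allowed since \<open>\<zeta>\<close>
  ranges over the open disc; for \<open>s = 0\<close> that argument breaks down, hence the extra
  condition.\<close>

lemma disc_affine:
  assumes f: "disc f" and s: "0 \<le> s" "cmod a + s \<le> 1" "s = 0 \<longrightarrow> cmod a < 1"
  shows "disc (\<lambda>\<zeta>. f (a + of_real s * \<zeta>))"
proof (rule discI)
  have inb: "cmod (a + of_real s * \<zeta>) < 1" if "cmod \<zeta> < 1" for \<zeta>
  proof (cases "s = 0")
    case False
    then have "s * cmod \<zeta> < s * 1" using s that by (intro mult_strict_left_mono) auto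
    then show ?thesis using norm_triangle_ineq[of a "of_real s * \<zeta>"] s by (simp add: norm_mult)
  qed (use s in simp)
  show "continuous_on (ball 0 1) (\<lambda>\<zeta>. f (a + of_real s * \<zeta>))"
    by (rule continuous_on_compose2[OF disc_cont[OF f]]) (use inb in \<open>auto intro!: continuous_intros\<close>)
  show "f (a + of_real s * \<zeta>) \<in> M" if "\<zeta> \<in> ball 0 1" for \<zeta>
    using disc_in[OF f inb] that by simp
  fix c i \<zeta> assume c: "c \<in> A" and z: "\<zeta> \<in> ball (0::complex) 1" "f (a + of_real s * \<zeta>) \<in> fst c"
  obtain w where w: "((\<lambda>\<zeta>. snd c (f \<zeta>)) has_derivative (\<lambda>\<eta>. \<eta> *s w)) (at (a + of_real s * \<zeta>))"
    using disc_deriv[OF f c inb z(2)] z by auto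
  show "\<exists>D. ((\<lambda>\<zeta>. snd c (f (a + of_real s * \<zeta>)) $ i) has_field_derivative D) (at \<zeta>)"
  proof
    have "((\<lambda>\<zeta>. a + of_real s * \<zeta>) has_field_derivative of_real s) (at \<zeta>)"
      by (auto intro!: derivative_eq_intros)
    with vector_has_derivative_component[OF w, of i]
    show "((\<lambda>\<zeta>. snd c (f (a + of_real s * \<zeta>)) $ i) has_field_derivative w $ i * of_real s) (at \<zeta>)"
      by (rule DERIV_chain2[where g = "\<lambda>\<zeta>. a + of_real s * \<zeta>"])
  qed
qed

lemma centre_deriv_affine:
  assumes f: "disc f" and c: "c \<in> A" "f 0 \<in> fst c"
  shows "centre_deriv c (\<lambda>\<zeta>. f (of_real s * \<zeta>)) = s *\<^sub>R centre_deriv c f"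
proof (rule centre_deriv_eq)
  have "((\<lambda>\<zeta>. of_real s * \<zeta>) has_derivative (\<lambda>\<eta>. of_real s * \<eta>)) (at (0::complex))"
    by (auto intro!: derivative_eq_intros)
  from diff_chain_at[OF this, of "\<lambda>\<zeta>. snd c (f \<zeta>)"] disc_centre_deriv[OF f c]
  have "((\<lambda>\<zeta>. snd c (f (of_real s * \<zeta>))) has_derivative (\<lambda>\<eta>. (of_real s * \<eta>) *s centre_deriv c f)) (at 0)"
    by (simp add: o_def)
  then show "((\<lambda>\<zeta>. snd c (f (of_real s * \<zeta>))) has_derivative (\<lambda>\<eta>. \<eta> *s (s *\<^sub>R centre_deriv c f))) (at 0)"
    by (simp add: vector_scalar_of_real[symmetric] vector_smult_assoc mult.commute)
qed

end

section \<open>Local comparison with the Euclidean norm\<close>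

context complex_mfd
begin

lemma chart_inv_open_image:
  assumes c: "c \<in> A" and W: "open W" "W \<subseteq> snd c ` fst c"
  shows "openin (top_of_set M) (chart_inv c ` W)"
proof -
  have "openin (top_of_set (snd c ` fst c)) W" using W chart_open[OF c] by (simp add: openin_open_eq)
  then have "openin (top_of_set (fst c)) (chart_inv c ` W)"
    by (rule homeomorphism_imp_open_map[OF homeomorphism_symD[OF chart_homeo[OF c]]])
  then show ?thesis using chart_openin[OF c] by (rule openin_trans)
qed

lemma chart_inv_compact_image:
  assumes c: "c \<in> A" and W: "compact W" "W \<subseteq> snd c ` fst c"
  shows "compact (chart_inv c ` W)" "closed (chart_inv c ` W)" "chart_inv c ` W \<subseteq> fst c"
proof -
  show "compact (chart_inv c ` W)"
    by (rule compact_continuous_image[OF continuous_on_subset[OF chart_inv_cont[OF c] W(2)] W(1)])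
  then show "closed (chart_inv c ` W)" by (rule compact_imp_closed)
  show "chart_inv c ` W \<subseteq> fst c" using chart_inv_in[OF c] W(2) by blast
qed

lemma chart_ball:
  assumes "c \<in> A" "p \<in> fst c"
  obtains R where "0 < R" "cball (snd c p) R \<subseteq> snd c ` fst c"
  using open_contains_cball[of "snd c ` fst c"] chart_open[OF assms(1)] assms(2) by blast

lemma in_chart_inv_image:
  assumes c: "c \<in> A" and W: "W \<subseteq> snd c ` fst c"
  shows "x \<in> chart_inv c ` W \<longleftrightarrow> x \<in> fst c \<and> snd c x \<in> W"
proof
  assume "x \<in> chart_inv c ` W"
  then obtain w where w: "w \<in> W" "x = chart_inv c w" by blast
  then have "w \<in> snd c ` fst c" using W by blast
  then show "x \<in> fst c \<and> snd c x \<in> W" using chart_inv_in[OF c] chart_inv_right[OF c] w by simp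
next
  assume "x \<in> fst c \<and> snd c x \<in> W"
  then show "x \<in> chart_inv c ` W" using chart_inv_left[OF c, of x] by (metis image_eqI)
qed

lemma kr_scales_bdd: "bdd_below (kr_scales c x w)"
  by (rule bdd_belowI[of _ 0]) (auto simp: kr_scales_def)

lemma kr_scales_upper:
  assumes c: "c \<in> A" and b: "ball z r \<subseteq> snd c ` fst c" and r: "0 < r" and a: "norm w / r \<le> \<alpha>" "0 < \<alpha>"
  shows "\<alpha> \<in> kr_scales c (chart_inv c z) w"
proof -
  let ?u = "(1 / \<alpha>) *\<^sub>R w"
  have u: "norm ?u \<le> r" using a r by (simp add: field_simps)
  show ?thesis unfolding kr_scales_def
    using chart_disc[OF c b u r] a(2) by (auto intro!: exI[of _ "\<lambda>\<zeta>. chart_inv c (z + \<zeta> *s ?u)"])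
qed

lemma kr_scales_nonempty:
  assumes c: "c \<in> A" and x: "x \<in> fst c"
  shows "kr_scales c x w \<noteq> {}"
proof -
  obtain R where R: "0 < R" "cball (snd c x) R \<subseteq> snd c ` fst c" using chart_ball[OF c x] .
  then have b: "ball (snd c x) R \<subseteq> snd c ` fst c" by (meson ball_subset_cball order_trans)
  have "norm w / R + 1 \<in> kr_scales c (chart_inv c (snd c x)) w"
    by (rule kr_scales_upper[OF c b R(1)]) (use R in \<open>auto intro: add_nonneg_pos\<close>)
  then show ?thesis using chart_inv_left[OF c x] by auto
qed

lemma kr_scales_Inf_nonneg: "c \<in> A \<Longrightarrow> x \<in> fst c \<Longrightarrow> 0 \<le> Inf (kr_scales c x w)"
  by (rule cInf_greatest[OF kr_scales_nonempty]) (auto simp: kr_scales_def)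

lemma kobayashi_metric_nonneg: "x \<in> M \<Longrightarrow> v \<in> tangent_space A x \<Longrightarrow> 0 \<le> kobayashi_metric M A x v"
  using chart_ex[of x] kr_scales_Inf_nonneg kobayashi_metric_chart by metis

lemma kr_scales_Inf_upper:
  assumes c: "c \<in> A" and b: "ball z r \<subseteq> snd c ` fst c" and r: "0 < r"
  shows "Inf (kr_scales c (chart_inv c z) w) \<le> norm w / r"
\<comment> \<open>For \<open>w = 0\<close> the bound is 0, which is not a positive scale; it is
  therefore approached from above.\<close>
proof (rule field_le_epsilon)
  fix e :: real assume "0 < e"
  then have "norm w / r + e \<in> kr_scales c (chart_inv c z) w"
    by (intro kr_scales_upper[OF c b r]) (use r in \<open>auto intro: add_nonneg_pos\<close>)
  then show "Inf (kr_scales c (chart_inv c z) w) \<le> norm w / r + e" by (rule cInf_lower[OF _ kr_scales_bdd])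
qed

lemma kr_scales_Inf_scale_le:
  assumes c: "c \<in> A" "x \<in> fst c" and r: "0 < r"
  shows "Inf (kr_scales c x (r *\<^sub>R w)) \<le> r * Inf (kr_scales c x w)"
proof -
  have "Inf (kr_scales c x (r *\<^sub>R w)) / r \<le> Inf (kr_scales c x w)"
  proof (rule cInf_greatest[OF kr_scales_nonempty[OF c]])
    fix \<alpha> assume "\<alpha> \<in> kr_scales c x w"
    then have "r * \<alpha> \<in> kr_scales c x (r *\<^sub>R w)" using r unfolding kr_scales_def by auto
    then have "Inf (kr_scales c x (r *\<^sub>R w)) \<le> r * \<alpha>" by (rule cInf_lower[OF _ kr_scales_bdd])
    then show "Inf (kr_scales c x (r *\<^sub>R w)) / r \<le> \<alpha>" using r by (simp add: field_simps)
  qed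
  then show ?thesis using r by (simp add: field_simps)
qed

text \<open>One inequality for \<open>r\<close>, used a second time for \<open>1 / r\<close>, gives
  equality.\<close>

lemma kobayashi_metric_scale:
  assumes x: "x \<in> M" and v: "v \<in> tangent_space A x" and r: "0 < r"
  shows "kobayashi_metric M A x (\<lambda>c. r *\<^sub>R v c) = r * kobayashi_metric M A x v"
proof -
  obtain c where c: "c \<in> A" "x \<in> fst c" using chart_ex[OF x] by blast
  have 1: "Inf (kr_scales c x (r *\<^sub>R v c)) \<le> r * Inf (kr_scales c x (v c))" by (rule kr_scales_Inf_scale_le[OF c r])
  have "Inf (kr_scales c x ((1/r) *\<^sub>R (r *\<^sub>R v c))) \<le> (1/r) * Inf (kr_scales c x (r *\<^sub>R v c))"
    by (rule kr_scales_Inf_scale_le[OF c]) (use r in simp)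
  then have "r * Inf (kr_scales c x (v c)) \<le> Inf (kr_scales c x (r *\<^sub>R v c))" using r by (simp add: field_simps)
  with 1 show ?thesis
    using kobayashi_metric_chart[OF v c] kobayashi_metric_chart[OF tangent_scale[OF v] c] by simp
qed

text \<open>Passage from local constants to one constant on a compact subset of a chart.
  Monotonicity in \<open>C\<close> allows the maximum over a finite subcover; the abstract
  \<open>P\<close> lets the lemma serve upper and lower bounds alike.\<close>

lemma chart_compact_bound:
  assumes c: "c \<in> A" and Q: "compact Q" "Q \<subseteq> fst c"
    and loc: "\<And>p. p \<in> fst c \<Longrightarrow> \<exists>C s. 0 < s \<and> (\<forall>x\<in>fst c. snd c x \<in> ball (snd c p) s \<longrightarrow> P (C::real) x)"
    and mono: "\<And>C C' x. x \<in> fst c \<Longrightarrow> P C x \<Longrightarrow> C \<le> C' \<Longrightarrow> P C' x"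
  shows "\<exists>C. \<forall>x\<in>Q. P C x"
proof -
  obtain C s where Cs: "\<And>p. p \<in> fst c \<Longrightarrow> 0 < s p" 
    "\<And>p x. p \<in> fst c \<Longrightarrow> x \<in> fst c \<Longrightarrow> snd c x \<in> ball (snd c p) (s p) \<Longrightarrow> P (C p) x"
    using loc by metis
  have cQ: "compact (snd c ` Q)"
    by (rule compact_continuous_image[OF continuous_on_subset[OF chart_cont[OF c] Q(2)] Q(1)])
  have cov: "snd c ` Q \<subseteq> (\<Union>p\<in>Q. ball (snd c p) (s p))" using Cs(1) Q(2) by force
  have op: "\<And>p. p \<in> Q \<Longrightarrow> open (ball (snd c p) (s p))" by simp
  obtain F where F: "F \<subseteq> Q" "finite F" "snd c ` Q \<subseteq> (\<Union>p\<in>F. ball (snd c p) (s p))"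
    by (rule compactE_image[OF cQ op cov])
  show ?thesis
  \<comment> \<open>0 is inserted so that the maximum exists also for empty
    \<open>F\<close>.\<close>
  proof (intro exI[of _ "Max (insert 0 (C ` F))"] ballI)
    fix x assume x: "x \<in> Q"
    then obtain p where p: "p \<in> F" "snd c x \<in> ball (snd c p) (s p)" using F(3) by blast
    have "P (C p) x" using Cs(2)[of p x] p x F(1) Q(2) by blast
    moreover have "C p \<le> Max (insert 0 (C ` F))" using p F(2) by (intro Max_ge) auto
    ultimately show "P (Max (insert 0 (C ` F))) x" using mono x Q(2) by blast
  qed
qed

lemma kobayashi_metric_upper:
  assumes c: "c \<in> A" and Q: "compact Q" "Q \<subseteq> fst c"
  shows "\<exists>C. \<forall>x\<in>Q. \<forall>v\<in>tangent_space A x. kobayashi_metric M A x v \<le> C * norm (v c)"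
proof (rule chart_compact_bound[OF c Q])
  fix p assume p: "p \<in> fst c"
  obtain R where R: "0 < R" "cball (snd c p) R \<subseteq> snd c ` fst c" using chart_ball[OF c p] .
  show "\<exists>C s. 0 < s \<and> (\<forall>x\<in>fst c. snd c x \<in> ball (snd c p) s \<longrightarrow> (\<forall>v\<in>tangent_space A x. kobayashi_metric M A x v \<le> C * norm (v c)))"
  proof (intro exI conjI ballI impI)
    \<comment> \<open>Around a point within \<open>R/2\<close> of the centre a coordinate ball of
      radius \<open>R/2\<close> still fits, so affine discs give the constant
      \<open>2/R\<close>.\<close>
    show "0 < R/2" using R by simp
    fix x v assume x: "x \<in> fst c" "snd c x \<in> ball (snd c p) (R/2)" and v: "v \<in> tangent_space A x"
    have "ball (snd c x) (R/2) \<subseteq> snd c ` fst c"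
    proof
      fix y assume "y \<in> ball (snd c x) (R/2)"
      then have "dist (snd c p) y \<le> R" using x(2) dist_triangle[of "snd c p" y "snd c x"] by simp
      then show "y \<in> snd c ` fst c" using R(2) by auto
    qed
    then have "Inf (kr_scales c (chart_inv c (snd c x)) (v c)) \<le> norm (v c) / (R/2)"
      by (rule kr_scales_Inf_upper[OF c]) (use R in simp)
    then show "kobayashi_metric M A x v \<le> (2/R) * norm (v c)"
      using kobayashi_metric_chart[OF v c x(1)] chart_inv_left[OF c x(1)] by (simp add: field_simps)
  qed
next
  fix C C' x assume H: "\<forall>v\<in>tangent_space A x. kobayashi_metric M A x v \<le> C * norm (v c)" and le: "C \<le> C'"
  show "\<forall>v\<in>tangent_space A x. kobayashi_metric M A x v \<le> C' * norm (v c)"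
  proof
    fix v assume "v \<in> tangent_space A x"
    then have "kobayashi_metric M A x v \<le> C * norm (v c)" using H by blast
    also have "\<dots> \<le> C' * norm (v c)" using le by (intro mult_right_mono) auto
    finally show "kobayashi_metric M A x v \<le> C' * norm (v c)" .
  qed
qed

text \<open>Scales are positive by definition, so 0 occurs as an infimum only; the upper bound at a
  single point gives it.\<close>

lemma kobayashi_metric_zero:
  assumes x: "x \<in> M"
  shows "kobayashi_metric M A x (\<lambda>_. 0) = 0"
proof -
  obtain c where c: "c \<in> A" "x \<in> fst c" using chart_ex[OF x] by blast
  obtain C where "kobayashi_metric M A x (\<lambda>_. 0) \<le> C * norm (0 :: complex ^ 'n)"
    using kobayashi_metric_upper[OF c(1), of "{x}"] tangent_zero[OF x] c(2) by fastforce
  then show ?thesis using kobayashi_metric_nonneg[OF x tangent_zero[OF x]] by simp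
qed

lemma kobayashi_pdist_disc:
  assumes "disc f" "cmod a < 1" "cmod b < 1"
  shows "kobayashi_pdist M A (f a) (f b) \<le> ennreal (poincare_dist a b)"
  unfolding kobayashi_pdist_def
proof (rule Inf_lower, rule CollectI, intro exI conjI)
  show "ennreal (poincare_dist a b) = (\<Sum>i<(1::nat). ennreal (poincare_dist ((\<lambda>_. a) i) ((\<lambda>_. b) i)))" by simp
  show "(\<lambda>i. if i = 0 then f a else f b) (0::nat) = f a" "(\<lambda>i. if i = 0 then f a else f b) (1::nat) = f b" by simp_all
  show "\<forall>i<(1::nat). disc ((\<lambda>_. f) i) \<and> (\<lambda>_. a) i \<in> ball 0 1 \<and> (\<lambda>_. b) i \<in> ball 0 1 \<and>
     (\<lambda>_. f) i ((\<lambda>_. a) i) = (\<lambda>i. if i = 0 then f a else f b) i \<and> (\<lambda>_. f) i ((\<lambda>_. b) i) = (\<lambda>i. if i = 0 then f a else f b) (Suc i)"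
    using assms by simp
qed

end

section \<open>The lower bound from hyperbolicity\<close>

lemma artanh_small:
  assumes "0 < (e::real)"
  obtains d where "0 < d" "d < 1" "\<And>x. 0 \<le> x \<Longrightarrow> x < d \<Longrightarrow> artanh x < e"
proof -
  have "isCont artanh (0::real)" by (rule isCont_artanh) auto
  then obtain d where d: "d > 0" "\<And>x. dist x 0 < d \<Longrightarrow> dist (artanh x) (artanh (0::real)) < e"
    using assms unfolding continuous_at_eps_delta by blast
  show ?thesis
  proof (rule that[of "min d (1/2)"])
    show "artanh x < e" if "0 \<le> x" "x < min d (1/2)" for x
      using d(2)[of x] that by (simp add: dist_real_def)
  qed (use d in auto)
qed

locale hyperbolic_mfd = complex_mfd M A
  for M :: "'a::{t2_space, second_countable_topology} set" and A :: "('a, 'n::finite) chart set" +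
  assumes hyp: "kobayashi_hyperbolic M A"
begin

text \<open>\<open>enn2real\<close> loses nothing, as hyperbolicity includes finiteness of the
  pseudodistance; real values make the facts about metric spaces available.\<close>

definition kob_dist :: "'a \<Rightarrow> 'a \<Rightarrow> real" where
  "kob_dist p q = enn2real (kobayashi_pdist M A p q)"

sublocale kob_dist: Metric_space M kob_dist
  using hyp by (simp add: kobayashi_hyperbolic_def kob_dist_def[abs_def])

lemma kob_dist_disc: 
  assumes f: "disc f" and b: "cmod b < 1"
  shows "kob_dist (f 0) (f b) \<le> artanh (cmod b)"
proof -
  have "0 \<le> artanh (cmod b)" unfolding artanh_def using b by (simp add: field_simps)
  moreover have "kobayashi_pdist M A (f 0) (f b) \<le> ennreal (artanh (cmod b))"
    using kobayashi_pdist_disc[OF f _ b, of 0] by (simp add: poincare_dist_def)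
  ultimately show ?thesis unfolding kob_dist_def by (rule enn2real_leI)
qed

text \<open>An affine disc of radius \<open>r\<close> centred at \<open>z\<close> passes through
  \<open>w\<close> at a parameter of modulus \<open>norm (w - z) / r\<close>, so nearby coordinates
  are close in Kobayashi distance.\<close>

lemma kob_dist_chart_cont:
  assumes c: "c \<in> A" and z: "z \<in> snd c ` fst c" and e: "0 < e"
  obtains s where "0 < s" "ball z s \<subseteq> snd c ` fst c" "\<And>w. w \<in> ball z s \<Longrightarrow> kob_dist (chart_inv c z) (chart_inv c w) < e"
proof -
  obtain r where r: "r > 0" "ball z r \<subseteq> snd c ` fst c" using chart_open[OF c] z openE by blast
  obtain d where d: "0 < d" "d < 1" "\<And>x. 0 \<le> x \<Longrightarrow> x < d \<Longrightarrow> artanh x < e" by (rule artanh_small[OF e]) blast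
  have sr: "r * d \<le> r" using r d by simp
  show ?thesis
  proof (rule that[of "r * d"])
    show "0 < r * d" using r d by simp
    show "ball z (r * d) \<subseteq> snd c ` fst c" using r(2) sr by (meson subset_ball order_trans)
    fix w assume w: "w \<in> ball z (r * d)"
    show "kob_dist (chart_inv c z) (chart_inv c w) < e"
    proof (cases "w = z")
      case True
      then show ?thesis using e kob_dist.zero[of "chart_inv c z" "chart_inv c z"] chart_inv_in[OF c z] chart_sub[OF c] by auto
    next
      case False
      define n where "n = norm (w - z)"
      have n: "0 < n" "n < r * d" using False w by (auto simp: n_def dist_norm norm_minus_commute)
      define u where "u = (r / n) *\<^sub>R (w - z)"
      have u: "norm u \<le> r" using n r by (simp add: u_def n_def)
      define b where "b = complex_of_real (n / r)"
      have b: "cmod b = n / r" "n / r < d" using n r by (auto simp: b_def field_simps norm_divide)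
      have "b *s u = w - z" unfolding b_def u_def vector_scalar_of_real using n r by simp
      then have "kob_dist (chart_inv c z) (chart_inv c w) \<le> artanh (cmod b)"
        using kob_dist_disc[OF chart_disc(1)[OF c r(2) u r(1)], of b] b d by simp
      also have "\<dots> < e" unfolding b(1) by (rule d(3)) (use b n r in auto)
      finally show ?thesis .
    qed
  qed
qed

text \<open>
  Every point of the sphere has positive Kobayashi distance from \<open>p\<close>, hence a disc
  centred near \<open>p\<close> needs a definite Poincare radius before it can leave the ball.
\<close>

lemma disc_stays_in_chart:
  assumes c: "c \<in> A" and p: "p \<in> fst c" and R: "0 < R" "cball (snd c p) R \<subseteq> snd c ` fst c"
  obtains \<delta> s where "0 < \<delta>" "\<delta> < 1" "0 < s" "s \<le> R"
    "\<And>f \<zeta>. disc f \<Longrightarrow> f 0 \<in> fst c \<Longrightarrow> snd c (f 0) \<in> ball (snd c p) s \<Longrightarrow> cmod \<zeta> < \<delta> \<Longrightarrow>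
       f \<zeta> \<in> fst c \<and> snd c (f \<zeta>) \<in> ball (snd c p) R"
proof -
  define z0 where "z0 = snd c p"
  have z0: "z0 \<in> snd c ` fst c" "chart_inv c z0 = p" using p chart_inv_left[OF c p] by (auto simp: z0_def)
  have pM: "p \<in> M" using p chart_sub[OF c] by auto
  have sub: "sphere z0 R \<subseteq> snd c ` fst c" "ball z0 R \<subseteq> snd c ` fst c" "cball z0 R \<subseteq> snd c ` fst c"
    using R(2) by (auto simp: z0_def)
  have inM: "chart_inv c w \<in> M" if "w \<in> snd c ` fst c" for w using chart_inv_in[OF c that] chart_sub[OF c] by auto
  have cont: "continuous_on (snd c ` fst c) (\<lambda>w. kob_dist p (chart_inv c w))"
    unfolding continuous_on_iff
  proof (intro ballI allI impI)
    fix w e assume w: "w \<in> snd c ` fst c" and e: "0 < (e::real)"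
    obtain s where s: "0 < s" "ball w s \<subseteq> snd c ` fst c" "\<And>w'. w' \<in> ball w s \<Longrightarrow> kob_dist (chart_inv c w) (chart_inv c w') < e"
      by (rule kob_dist_chart_cont[OF c w e]) blast
    show "\<exists>d>0. \<forall>w'\<in>snd c ` fst c. dist w' w < d \<longrightarrow> dist (kob_dist p (chart_inv c w')) (kob_dist p (chart_inv c w)) < e"
    proof (intro exI[of _ s] conjI ballI impI s)
      fix w' assume w': "w' \<in> snd c ` fst c" "dist w' w < s"
      have "kob_dist (chart_inv c w) (chart_inv c w') < e" using s(3)[of w'] w' by (simp add: dist_commute)
      moreover have "kob_dist p (chart_inv c w) \<le> kob_dist p (chart_inv c w') + kob_dist (chart_inv c w') (chart_inv c w)"
        by (rule kob_dist.triangle[OF pM inM[OF w'(1)] inM[OF w]])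
      moreover have "kob_dist p (chart_inv c w') \<le> kob_dist p (chart_inv c w) + kob_dist (chart_inv c w) (chart_inv c w')"
        by (rule kob_dist.triangle[OF pM inM[OF w] inM[OF w'(1)]])
      moreover have "kob_dist (chart_inv c w') (chart_inv c w) = kob_dist (chart_inv c w) (chart_inv c w')" by (rule kob_dist.commute)
      ultimately show "dist (kob_dist p (chart_inv c w')) (kob_dist p (chart_inv c w)) < e" unfolding dist_real_def by linarith
    qed
  qed
  \<comment> \<open>Separation of points by \<open>kob_dist\<close> enters here: on the compact
    sphere the distance from \<open>p\<close> has a positive lower bound.\<close>
  obtain m where m: "0 < m" "\<And>w. w \<in> sphere z0 R \<Longrightarrow> m \<le> kob_dist p (chart_inv c w)"
  proof (cases "sphere z0 R = {}")
    case True then show ?thesis using that[of 1] by simp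
  next
    case False
    have "\<exists>w\<in>sphere z0 R. \<forall>y\<in>sphere z0 R. kob_dist p (chart_inv c w) \<le> kob_dist p (chart_inv c y)"
      by (rule continuous_attains_inf[OF compact_sphere False continuous_on_subset[OF cont sub(1)]])
    then obtain w where w: "w \<in> sphere z0 R" "\<forall>y\<in>sphere z0 R. kob_dist p (chart_inv c w) \<le> kob_dist p (chart_inv c y)" by blast
    have wi: "w \<in> snd c ` fst c" using w sub by blast
    have "chart_inv c w \<noteq> p" using chart_inv_right[OF c wi] w R(1) by (auto simp: z0_def)
    then have "kob_dist p (chart_inv c w) \<noteq> 0" using kob_dist.zero[OF pM inM[OF wi]] by auto
    then have "0 < kob_dist p (chart_inv c w)" using kob_dist.nonneg[of p "chart_inv c w"] by linarith
    with w(2) that show ?thesis by blast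
  qed
  have m2: "0 < m/2" using m by simp
  \<comment> \<open>Half of \<open>m\<close> pays for the way from \<open>p\<close> to
    \<open>f 0\<close>, the other half for the way from \<open>f 0\<close> along the disc.\<close>
  obtain s where s: "0 < s" "\<And>w. w \<in> ball z0 s \<Longrightarrow> kob_dist p (chart_inv c w) < m/2"
    using kob_dist_chart_cont[OF c z0(1) m2] unfolding z0(2) by metis
  obtain d where d: "0 < d" "d < 1" "\<And>x. 0 \<le> x \<Longrightarrow> x < d \<Longrightarrow> artanh x < m/2" by (rule artanh_small[OF m2]) blast
  show ?thesis
  proof (rule that[of d "min s R"])
    fix f \<zeta> assume f: "disc f" "f 0 \<in> fst c" "snd c (f 0) \<in> ball (snd c p) (min s R)" and \<zeta>: "cmod \<zeta> < d"
    define Seg where "Seg = closed_segment 0 \<zeta>"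
    have Seg: "cmod \<eta> < d" if "\<eta> \<in> Seg" for \<eta>
      using segment_bound(1)[of \<eta> 0 \<zeta>] that \<zeta> by (simp add: Seg_def)
    have nS: "f \<eta> \<notin> chart_inv c ` sphere z0 R" if \<eta>: "\<eta> \<in> Seg" for \<eta>
    proof
      assume "f \<eta> \<in> chart_inv c ` sphere z0 R"
      then obtain w where w: "w \<in> sphere z0 R" "f \<eta> = chart_inv c w" by blast
      have 1: "cmod \<eta> < 1" using Seg[OF \<eta>] d by simp
      have "m \<le> kob_dist p (f \<eta>)" using m(2)[OF w(1)] w(2) by simp
      also have "\<dots> \<le> kob_dist p (f 0) + kob_dist (f 0) (f \<eta>)"
        by (rule kob_dist.triangle[OF pM disc_in[OF f(1)] disc_in[OF f(1)]]) (use 1 in auto)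
      also have "kob_dist p (f 0) < m/2" using s(2)[of "snd c (f 0)"] f(3) chart_inv_left[OF c f(2)] by (simp add: z0_def)
      also have "kob_dist (f 0) (f \<eta>) \<le> artanh (cmod \<eta>)" by (rule kob_dist_disc[OF f(1) 1])
      also have "artanh (cmod \<eta>) < m/2" by (rule d(3)) (use Seg[OF \<eta>] in auto)
      finally show False by simp
    qed
    define E1 where "E1 = {\<eta>\<in>ball 0 1. f \<eta> \<in> chart_inv c ` ball z0 R}"
    \<comment> \<open>\<open>E2\<close> includes the parameters at which \<open>f\<close> has left
      the chart domain. It is open since a compact coordinate ball is closed in a Hausdorff space.
      The image of the segment misses the sphere, so connectedness keeps the segment in
      \<open>E1\<close>.\<close>
    define E2 where "E2 = {\<eta>\<in>ball 0 1. f \<eta> \<in> M - chart_inv c ` cball z0 R}"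
    have o1: "open E1" unfolding E1_def
      by (rule disc_open[OF f(1) chart_inv_open_image[OF c _ sub(2)]]) simp
    have "openin (top_of_set M) (M - chart_inv c ` cball z0 R)"
      using chart_inv_compact_image(2)[OF c _ sub(3)] by (metis Diff_eq compact_cball open_Compl openin_open_Int)
    then have o2: "open E2" unfolding E2_def by (rule disc_open[OF f(1)])
    have dj: "E1 \<inter> E2 \<inter> Seg = {}" unfolding E1_def E2_def using ball_subset_cball by blast
    have cov: "Seg \<subseteq> E1 \<union> E2"
    proof
      fix \<eta> assume \<eta>: "\<eta> \<in> Seg"
      have 1: "cmod \<eta> < 1" using Seg[OF \<eta>] d by simp
      have "cball z0 R = ball z0 R \<union> sphere z0 R" by auto
      then have "chart_inv c ` cball z0 R = chart_inv c ` ball z0 R \<union> chart_inv c ` sphere z0 R" by blast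
      then show "\<eta> \<in> E1 \<union> E2" using nS[OF \<eta>] disc_in[OF f(1) 1] 1 unfolding E1_def E2_def by auto
    qed
    have "connected Seg" by (simp add: Seg_def)
    from connectedD[OF this o1 o2 dj cov] have "E1 \<inter> Seg = {} \<or> E2 \<inter> Seg = {}" .
    moreover have "0 \<in> E1 \<inter> Seg"
      using f in_chart_inv_image[OF c sub(2), of "f 0"] by (simp add: E1_def Seg_def z0_def)
    ultimately have "\<zeta> \<in> E1" using cov by (auto simp: Seg_def)
    then show "f \<zeta> \<in> fst c \<and> snd c (f \<zeta>) \<in> ball (snd c p) R"
      using in_chart_inv_image[OF c sub(2), of "f \<zeta>"] by (simp add: E1_def z0_def)
  qed (use d s R in auto)
qed

text \<open>Cauchy's estimate on the circle of radius \<open>\<delta>/2\<close>, which together with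
  its inside lies where the coordinates are bounded. The factor \<open>CARD('n)\<close> comes from
  estimating the norm by the sum of the components.\<close>

lemma centre_deriv_bound:
  assumes c: "c \<in> A" and f: "disc f" and \<delta>: "0 < \<delta>" "\<delta> < 1"
    and b: "\<And>\<zeta>. cmod \<zeta> < \<delta> \<Longrightarrow> f \<zeta> \<in> fst c \<and> snd c (f \<zeta>) \<in> ball z0 R"
  shows "norm (centre_deriv c f) \<le> real CARD('n) * ((norm z0 + R) * 2 / \<delta>)"
proof -
  have comp: "norm (centre_deriv c f $ i) \<le> (norm z0 + R) * 2 / \<delta>" for i
  proof -
    let ?u = "\<lambda>\<zeta>. snd c (f \<zeta>) $ i"
    have hol: "?u holomorphic_on ball 0 \<delta>"
      by (rule holomorphic_on_subset[OF disc_holo[OF f c]]) (use b \<delta> in auto)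
    have "norm ((deriv ^^ 1) ?u 0) \<le> fact 1 * (norm z0 + R) / (\<delta>/2) ^ 1"
    proof (rule Cauchy_inequality)
      show "?u holomorphic_on ball 0 (\<delta>/2)" by (rule holomorphic_on_subset[OF hol]) (use \<delta> in auto)
      show "continuous_on (cball 0 (\<delta>/2)) ?u"
        by (rule continuous_on_subset[OF holomorphic_on_imp_continuous_on[OF hol]]) (use \<delta> in auto)
      fix x assume "cmod (0 - x) = \<delta>/2"
      then have "snd c (f x) \<in> ball z0 R" using b[of x] \<delta> by simp
      then have "norm (snd c (f x)) \<le> norm z0 + R"
        using norm_triangle_ineq[of z0 "snd c (f x) - z0"] by (simp add: dist_norm norm_minus_commute)
      then show "cmod (?u x) \<le> norm z0 + R" using Finite_Cartesian_Product.norm_nth_le[of "snd c (f x)" i] order_trans by blast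
    qed (use \<delta> in auto)
    then show ?thesis by (simp add: centre_deriv_def)
  qed
  have "(\<Sum>i\<in>UNIV. norm (centre_deriv c f $ i)) \<le> (\<Sum>i\<in>(UNIV::'n set). (norm z0 + R) * 2 / \<delta>)"
    by (intro sum_mono comp)
  moreover have "norm (centre_deriv c f) \<le> (\<Sum>i\<in>UNIV. norm (centre_deriv c f $ i))"
    unfolding norm_vec_def by (rule L2_set_le_sum) simp
  ultimately show ?thesis by simp
qed

text \<open>All discs centred near \<open>p\<close> have centre derivatives bounded by one constant
  \<open>C\<close>, so every scale for a coordinate vector \<open>w\<close> is at least
  \<open>norm w / C\<close>.\<close>

lemma kobayashi_metric_lower:
  assumes c: "c \<in> A" and Q: "compact Q" "Q \<subseteq> fst c"
  shows "\<exists>C. \<forall>x\<in>Q. \<forall>v\<in>tangent_space A x. norm (v c) \<le> C * kobayashi_metric M A x v"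
proof (rule chart_compact_bound[OF c Q])
  fix p assume p: "p \<in> fst c"
  obtain R where R: "0 < R" "cball (snd c p) R \<subseteq> snd c ` fst c" using chart_ball[OF c p] .
  obtain \<delta> s where ds: "0 < \<delta>" "\<delta> < 1" "0 < s" "s \<le> R"
    "\<And>f \<zeta>. disc f \<Longrightarrow> f 0 \<in> fst c \<Longrightarrow> snd c (f 0) \<in> ball (snd c p) s \<Longrightarrow> cmod \<zeta> < \<delta> \<Longrightarrow>
       f \<zeta> \<in> fst c \<and> snd c (f \<zeta>) \<in> ball (snd c p) R"
    using disc_stays_in_chart[OF c p R] by metis
  define C where "C = real CARD('n) * ((norm (snd c p) + R) * 2 / \<delta>)"
  have C: "0 < C" unfolding C_def using R ds
    by (intro mult_pos_pos divide_pos_pos add_nonneg_pos) (auto simp: card_gt_0_iff)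
  show "\<exists>C s. 0 < s \<and> (\<forall>x\<in>fst c. snd c x \<in> ball (snd c p) s \<longrightarrow> (\<forall>v\<in>tangent_space A x. norm (v c) \<le> C * kobayashi_metric M A x v))"
  proof (intro exI conjI ballI impI)
    show "0 < s" by (rule ds)
    fix x v assume x: "x \<in> fst c" "snd c x \<in> ball (snd c p) s" and v: "v \<in> tangent_space A x"
    have "norm (v c) / C \<le> Inf (kr_scales c x (v c))"
    proof (rule cInf_greatest[OF kr_scales_nonempty[OF c x(1)]])
      fix \<alpha> assume "\<alpha> \<in> kr_scales c x (v c)"
      then obtain f where f: "0 < \<alpha>" "disc f" "f 0 = x" "v c = \<alpha> *\<^sub>R centre_deriv c f" by (auto simp: kr_scales_def)
      have "norm (centre_deriv c f) \<le> C" unfolding C_def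
        by (rule centre_deriv_bound[OF c f(2) ds(1,2)]) (use ds(5)[OF f(2)] f(3) x in simp)
      then have "norm (v c) \<le> \<alpha> * C" using f by simp
      then show "norm (v c) / C \<le> \<alpha>" using C by (simp add: field_simps)
    qed
    then show "norm (v c) \<le> C * kobayashi_metric M A x v"
      using C kobayashi_metric_chart[OF v c x(1)] by (simp add: field_simps)
  qed
next
  fix C C' x assume x: "x \<in> fst c" and H: "\<forall>v\<in>tangent_space A x. norm (v c) \<le> C * kobayashi_metric M A x v" and le: "C \<le> C'"
  show "\<forall>v\<in>tangent_space A x. norm (v c) \<le> C' * kobayashi_metric M A x v"
  proof
      fix v assume v: "v \<in> tangent_space A x"
      then have "norm (v c) \<le> C * kobayashi_metric M A x v" using H by blast
      also have "\<dots> \<le> C' * kobayashi_metric M A x v"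
        using le kobayashi_metric_nonneg[OF _ v] x chart_sub[OF c] by (intro mult_right_mono) auto
      finally show "norm (v c) \<le> C' * kobayashi_metric M A x v" .
  qed
qed

end

section \<open>Compact families of discs and measurability\<close>

text \<open>Second-order Taylor remainder. Circles of radius \<open>r/4\<close> about points of
  \<open>ball a (r/2)\<close> stay in \<open>ball a r\<close>, so Cauchy's estimate bounds the
  second derivative on the smaller ball.\<close>

lemma holomorphic_quadratic_bound:
  fixes u :: "complex \<Rightarrow> complex"
  assumes h: "u holomorphic_on ball a r" and r: "0 < r" and N: "\<And>z. z \<in> ball a r \<Longrightarrow> cmod (u z) \<le> N"
    and z: "z \<in> ball a (r/2)"
  shows "cmod (u z - u a - deriv u a * (z - a)) \<le> (2 * N / (r/4)^2) * cmod (z - a)^2"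
proof -
  let ?f = "\<lambda>i. (deriv ^^ i) u"
  have sub: "ball a (r/2) \<subseteq> ball a r" using r by (intro subset_ball) auto
  have "cmod (?f 0 z - (\<Sum>i\<le>1. ?f i a * (z-a) ^ i / (fact i))) \<le> (2 * N / (r/4)^2) * cmod(z - a)^(Suc 1) / fact 1"
  proof (rule complex_Taylor[of "ball a (r/2)"])
    fix i x assume x: "x \<in> ball a (r/2)"
    then have "x \<in> ball a r" using sub by blast
    then have "((deriv ^^ i) u has_field_derivative (deriv ^^ Suc i) u x) (at x)"
      using has_field_derivative_higher_deriv[OF h open_ball] by auto
    then show "((deriv ^^ i) u has_field_derivative (deriv ^^ Suc i) u x) (at x within ball a (r/2))"
      by (rule has_field_derivative_at_within)
  next
    fix x assume x: "x \<in> ball a (r/2)"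
    have c: "cball x (r/4) \<subseteq> ball a r"
    proof
      fix y assume "y \<in> cball x (r/4)"
      then show "y \<in> ball a r" using x dist_triangle[of a y x] r by simp
    qed
    have "norm ((deriv ^^ 2) u x) \<le> fact 2 * N / (r/4) ^ 2"
    proof (rule Cauchy_inequality)
      show "u holomorphic_on ball x (r/4)"
        by (rule holomorphic_on_subset[OF h]) (use c ball_subset_cball in blast)
      show "continuous_on (cball x (r/4)) u"
        by (rule continuous_on_subset[OF holomorphic_on_imp_continuous_on[OF h] c])
      show "cmod (u y) \<le> N" if "cmod (x - y) = r/4" for y
      proof (rule N)
        show "y \<in> ball a r" using c that by (auto simp: dist_norm)
      qed
    qed (use r in auto)
    then show "cmod ((deriv ^^ Suc 1) u x) \<le> 2 * N / (r/4)^2" by (simp add: numeral_2_eq_2)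
  qed (use r z in auto)
  then show ?thesis by (simp add: power2_eq_square diff_diff_eq)
qed

text \<open>
  The Taylor bound makes the difference quotients uniformly Cauchy, so that convergence along an
  arbitrary filter suffices. This lets Tychonoff's theorem take the place of Montel's below.
\<close>

lemma holomorphic_pointwise_limit:
  fixes u :: "'x \<Rightarrow> complex \<Rightarrow> complex"
  assumes G: "G \<noteq> bot" and r: "0 < r"
    and ev: "\<forall>\<^sub>F h in G. u h holomorphic_on ball a r \<and> (\<forall>z\<in>ball a r. cmod (u h z) \<le> N)"
    and lim: "\<And>z. z \<in> ball a r \<Longrightarrow> ((\<lambda>h. u h z) \<longlongrightarrow> g z) G"
  shows "\<exists>w. (g has_field_derivative w) (at a) \<and> ((\<lambda>h. deriv (u h) a) \<longlongrightarrow> w) G"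
proof -
  define C where "C = \<bar>2 * N / (r/4)^2\<bar>"
  have C0: "0 \<le> C" by (simp add: C_def)
  \<comment> \<open>Difference quotients at \<open>a\<close>; the Taylor bound puts them within
    \<open>C * cmod (z - a)\<close> of the derivative, with \<open>C\<close> independent of
    \<open>h\<close>.\<close>
  define q where "q v z = (v z - v a) / (z - a)" for v :: "complex \<Rightarrow> complex" and z
  have evq: "\<forall>\<^sub>F h in G. \<forall>z\<in>ball a (r/2) - {a}. cmod (q (u h) z - deriv (u h) a) \<le> C * cmod (z - a)"
    using ev
  proof eventually_elim
    case (elim h)
    show ?case
    proof
      fix z assume z: "z \<in> ball a (r/2) - {a}"
      have "cmod (u h z - u h a - deriv (u h) a * (z - a)) \<le> (2 * N / (r/4)^2) * cmod (z - a)^2"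
        by (rule holomorphic_quadratic_bound[where r = r]) (use elim r z in auto)
      also have "\<dots> \<le> C * cmod (z - a)^2" unfolding C_def by (intro mult_right_mono abs_ge_self) auto
      finally have 1: "cmod (u h z - u h a - deriv (u h) a * (z - a)) \<le> C * cmod (z - a)^2" .
      have za: "cmod (z - a) > 0" using z by simp
      have "q (u h) z - deriv (u h) a = (u h z - u h a - deriv (u h) a * (z - a)) / (z - a)"
        using z by (simp add: q_def field_simps)
      then have "cmod (q (u h) z - deriv (u h) a) = cmod (u h z - u h a - deriv (u h) a * (z - a)) / cmod (z - a)"
        by (simp add: norm_divide)
      also have "\<dots> \<le> C * cmod (z - a)^2 / cmod (z - a)" using 1 za by (intro divide_right_mono) auto
      also have "\<dots> = C * cmod (z - a)" using za by (simp add: power2_eq_square)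
      finally show "cmod (q (u h) z - deriv (u h) a) \<le> C * cmod (z - a)" .
    qed
  qed
  have limq: "((\<lambda>h. q (u h) z) \<longlongrightarrow> q g z) G" if "z \<in> ball a (r/2) - {a}" for z
    unfolding q_def by (intro tendsto_divide tendsto_diff lim tendsto_const) (use that r in auto)
  \<comment> \<open>Two quotients of the same \<open>u h\<close> are compared through its
    derivative, and the bound survives the limit along \<open>G\<close>.\<close>
  have cau: "cmod (q g z - q g z') \<le> C * (cmod (z - a) + cmod (z' - a))"
    if z: "z \<in> ball a (r/2) - {a}" "z' \<in> ball a (r/2) - {a}" for z z'
  proof (rule tendsto_upperbound[OF tendsto_norm[OF tendsto_diff[OF limq[OF z(1)] limq[OF z(2)]]] _ G])
    show "\<forall>\<^sub>F h in G. cmod (q (u h) z - q (u h) z') \<le> C * (cmod (z - a) + cmod (z' - a))"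
      using evq
    proof eventually_elim
      case (elim h)
      have "cmod (q (u h) z - q (u h) z') \<le> cmod (q (u h) z - deriv (u h) a) + cmod (q (u h) z' - deriv (u h) a)"
        using norm_triangle_ineq4[of "q (u h) z - deriv (u h) a" "q (u h) z' - deriv (u h) a"] by simp
      then show ?case using elim[rule_format, OF z(1)] elim[rule_format, OF z(2)] by (simp add: distrib_left)
    qed
  qed
  \<comment> \<open>A concrete sequence tending to \<open>a\<close> produces the candidate
    \<open>w\<close>; \<open>n + 2\<close> keeps even its first member strictly inside
    \<open>ball a (r/2)\<close>.\<close>
  define zn where "zn n = a + of_real (r / (2 * (real n + 2)))" for n :: nat
  have zn: "zn n \<in> ball a (r/2) - {a}" "cmod (zn n - a) = r / (2 * (real n + 2))" for n
  proof -
    have t: "0 < r / (2 * (real n + 2))" using r by (intro divide_pos_pos) auto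
    have t2: "r / (2 * (real n + 2)) < r/2" using r by (intro divide_strict_left_mono) auto
    show c: "cmod (zn n - a) = r / (2 * (real n + 2))"
      unfolding zn_def add_diff_cancel_left' norm_of_real using t r by simp
    have "zn n \<noteq> a" using c t by auto
    moreover have "dist a (zn n) < r/2" using c t2 by (simp add: dist_norm norm_minus_commute)
    ultimately show "zn n \<in> ball a (r/2) - {a}" by simp
  qed
  have zn0: "(\<lambda>n. cmod (zn n - a)) \<longlonglongrightarrow> 0"
    unfolding zn(2) by real_asymp
  have Czn: "(\<lambda>n. C * cmod (zn n - a)) \<longlonglongrightarrow> 0" by (rule tendsto_mult_right_zero[OF zn0])
  have "Cauchy (\<lambda>n. q g (zn n))"
    unfolding Cauchy_altdef2
  proof (intro allI impI)
    fix e :: real assume e: "0 < e"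
    have "\<forall>\<^sub>F n in sequentially. C * (cmod (zn n - a)) < e/2"
      by (rule order_tendstoD(2)[OF Czn]) (use e in simp)
    then obtain m where m: "\<And>n. n \<ge> m \<Longrightarrow> C * (cmod (zn n - a)) < e/2" by (auto simp: eventually_sequentially)
    show "\<exists>m. \<forall>n\<ge>m. dist (q g (zn n)) (q g (zn m)) < e"
    proof (intro exI[of _ m] allI impI)
      fix n assume "m \<le> n"
      then show "dist (q g (zn n)) (q g (zn m)) < e"
        using cau[OF zn(1)[of n] zn(1)[of m]] m[of n] m[of m] by (simp add: dist_norm distrib_left)
    qed
  qed
  then obtain w where w: "(\<lambda>n. q g (zn n)) \<longlonglongrightarrow> w" using Cauchy_convergent convergent_def by blast
  have qw: "cmod (q g z - w) \<le> C * cmod (z - a)" if z: "z \<in> ball a (r/2) - {a}" for z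
  proof (rule tendsto_le[OF sequentially_bot])
    show "(\<lambda>n. cmod (q g z - q g (zn n))) \<longlonglongrightarrow> cmod (q g z - w)" by (intro tendsto_intros w)
    have "(\<lambda>n. C * (cmod (z - a) + cmod (zn n - a))) \<longlonglongrightarrow> C * (cmod (z - a) + 0)"
      by (intro tendsto_intros zn0)
    then show "(\<lambda>n. C * (cmod (z - a) + cmod (zn n - a))) \<longlonglongrightarrow> C * cmod (z - a)" by simp
    show "\<forall>\<^sub>F n in sequentially. cmod (q g z - q g (zn n)) \<le> C * (cmod (z - a) + cmod (zn n - a))"
      by (intro always_eventually allI cau z zn)
  qed
  have "((\<lambda>z. q g z - w) \<longlongrightarrow> 0) (at a)"
  proof (rule Lim_null_comparison)
    have "\<forall>\<^sub>F z in at a. z \<in> ball a (r/2)" using r by (intro eventually_at_in_open') auto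
    moreover have "\<forall>\<^sub>F z in at a. z \<noteq> a" by (simp add: eventually_at_filter)
    ultimately show "\<forall>\<^sub>F z in at a. norm (q g z - w) \<le> C * cmod (z - a)"
      by eventually_elim (use qw in auto)
    have "((\<lambda>z. C * cmod (z - a)) \<longlongrightarrow> C * cmod (a - a)) (at a)" by (intro tendsto_intros)
    then show "((\<lambda>z. C * cmod (z - a)) \<longlongrightarrow> 0) (at a)" by simp
  qed
  then have "(q g \<longlongrightarrow> w) (at a)" by (rule Lim_null[THEN iffD2])
  then have D: "(g has_field_derivative w) (at a)" by (simp add: has_field_derivative_iff q_def[abs_def])
  have "((\<lambda>h. deriv (u h) a) \<longlongrightarrow> w) G"
  proof (rule tendstoI)
    \<comment> \<open>A three-term estimate through the difference quotients of \<open>u h\<close>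
      and of \<open>g\<close> at one fixed \<open>zn n\<close>.\<close>
    fix e :: real assume e: "0 < e"
    have "\<forall>\<^sub>F n in sequentially. C * (cmod (zn n - a)) < e/3"
      by (rule order_tendstoD(2)[OF Czn]) (use e in simp)
    then obtain n where n: "C * (cmod (zn n - a)) < e/3" by (auto simp: eventually_sequentially)
    have "\<forall>\<^sub>F h in G. dist (q (u h) (zn n)) (q g (zn n)) < e/3"
      using limq[OF zn(1)] e by (intro tendstoD) auto
    then show "\<forall>\<^sub>F h in G. dist (deriv (u h) a) w < e"
      using evq
    proof eventually_elim
      case (elim h)
      have 1: "dist (q (u h) (zn n)) (deriv (u h) a) < e/3"
        using elim(2)[rule_format, OF zn(1), of n] n by (simp add: dist_norm)
      have 2: "dist (q g (zn n)) w < e/3" using qw[OF zn(1), of n] n by (simp add: dist_norm)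
      have "dist (deriv (u h) a) w \<le> dist (deriv (u h) a) (q (u h) (zn n)) + dist (q (u h) (zn n)) w"
        by (rule dist_triangle)
      also have "dist (q (u h) (zn n)) w \<le> dist (q (u h) (zn n)) (q g (zn n)) + dist (q g (zn n)) w"
        by (rule dist_triangle)
      finally show ?case using 1 2 elim(1) by (simp add: dist_commute)
    qed
  qed
  with D show ?thesis by blast
qed

context hyperbolic_mfd
begin

text \<open>Recentring at \<open>\<zeta>0\<close> makes \<open>disc_stays_in_chart\<close>, which is
  about disc centres, apply there: eventually all \<open>h\<close> map a common ball around
  \<open>\<zeta>0\<close> into the chart with bounded coordinates. Pointwise convergence then
  suffices for \<open>holomorphic_pointwise_limit\<close> in each component.\<close>

lemma disc_limit_local:
  assumes G: "G \<noteq> bot" and ev: "\<forall>\<^sub>F h in G. disc h"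
    and lim: "\<And>\<zeta>. cmod \<zeta> < 1 \<Longrightarrow> ((\<lambda>h. h \<zeta>) \<longlongrightarrow> f \<zeta>) G"
    and \<zeta>0: "cmod \<zeta>0 < 1" and c: "c \<in> A" "f \<zeta>0 \<in> fst c"
  shows "isCont f \<zeta>0"
    and "\<exists>w. ((\<lambda>\<zeta>. snd c (f \<zeta>)) has_derivative (\<lambda>\<eta>. \<eta> *s w)) (at \<zeta>0) \<and>
           ((\<lambda>h. \<chi> i. deriv (\<lambda>\<zeta>. snd c (h \<zeta>) $ i) \<zeta>0) \<longlongrightarrow> w) G"
proof -
  define z0 where "z0 = snd c (f \<zeta>0)"
  obtain R where R: "0 < R" "cball (snd c (f \<zeta>0)) R \<subseteq> snd c ` fst c" using chart_ball[OF c] .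
  obtain \<delta> s where ds: "0 < \<delta>" "\<delta> < 1" "0 < s" "s \<le> R"
    "\<And>h \<zeta>. disc h \<Longrightarrow> h 0 \<in> fst c \<Longrightarrow> snd c (h 0) \<in> ball z0 s \<Longrightarrow> cmod \<zeta> < \<delta> \<Longrightarrow>
       h \<zeta> \<in> fst c \<and> snd c (h \<zeta>) \<in> ball z0 R"
    using disc_stays_in_chart[OF c R] unfolding z0_def by metis
  have sub: "ball z0 s \<subseteq> snd c ` fst c" "cball z0 R \<subseteq> snd c ` fst c" 
    using R(2) ds(4) by (auto simp: z0_def)
  \<comment> \<open>The affine recentring has the factor \<open>1 - cmod \<zeta>0\<close>, which
    scales the radius \<open>\<delta>\<close>.\<close>
  define \<rho> where "\<rho> = \<delta> * (1 - cmod \<zeta>0)"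
  have \<rho>: "0 < \<rho>" "\<rho> \<le> 1 - cmod \<zeta>0" using ds \<zeta>0 by (auto simp: \<rho>_def)
  have in1: "cmod \<zeta> < 1" if "\<zeta> \<in> ball \<zeta>0 \<rho>" for \<zeta>
  proof -
    have "cmod (\<zeta> - \<zeta>0) < \<rho>" using that by (simp add: dist_norm norm_minus_commute)
    then show ?thesis using norm_triangle_ineq[of "\<zeta> - \<zeta>0" \<zeta>0] \<rho>(2) by simp
  qed
  obtain T where T: "open T" "chart_inv c ` ball z0 s = M \<inter> T"
    using chart_inv_open_image[OF c(1) open_ball sub(1)] by (auto simp: openin_open)
  have "f \<zeta>0 \<in> chart_inv c ` ball z0 s"
    unfolding in_chart_inv_image[OF c(1) sub(1)] using c ds(3) by (simp add: z0_def)
  then have "f \<zeta>0 \<in> T" using T by blast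
  then have "\<forall>\<^sub>F h in G. h \<zeta>0 \<in> T" by (rule topological_tendstoD[OF lim[OF \<zeta>0] T(1)])
  then have evb: "\<forall>\<^sub>F h in G. disc h \<and> (\<forall>\<zeta>\<in>ball \<zeta>0 \<rho>. h \<zeta> \<in> fst c \<and> snd c (h \<zeta>) \<in> ball z0 R)"
    using ev
  proof eventually_elim
    case (elim h)
    have "h \<zeta>0 \<in> chart_inv c ` ball z0 s" using T disc_in[OF elim(2) \<zeta>0] elim(1) by blast
    then have h0: "h \<zeta>0 \<in> fst c" "snd c (h \<zeta>0) \<in> ball z0 s" unfolding in_chart_inv_image[OF c(1) sub(1)] by auto
    let ?h = "\<lambda>\<zeta>. h (\<zeta>0 + of_real (1 - cmod \<zeta>0) * \<zeta>)"
    have d: "disc ?h" by (rule disc_affine[OF elim(2)]) (use \<zeta>0 in auto)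
    show ?case
    proof (intro conjI ballI elim(2))
      fix \<zeta> assume \<zeta>: "\<zeta> \<in> ball \<zeta>0 \<rho>"
      define \<eta> where "\<eta> = (\<zeta> - \<zeta>0) / of_real (1 - cmod \<zeta>0)"
      have n1: "cmod (of_real (1 - cmod \<zeta>0)) = 1 - cmod \<zeta>0" using \<zeta>0 by (metis norm_of_real abs_of_pos diff_gt_0_iff_gt)
      have "cmod \<eta> = cmod (\<zeta> - \<zeta>0) / (1 - cmod \<zeta>0)" unfolding \<eta>_def norm_divide n1 by simp
      also have "\<dots> < \<delta>" using \<zeta> \<zeta>0 by (simp add: \<rho>_def dist_norm norm_minus_commute field_simps)
      finally have "cmod \<eta> < \<delta>" .
      moreover have "of_real (1 - cmod \<zeta>0) \<noteq> (0::complex)" using n1 \<zeta>0 by (metis norm_zero diff_gt_0_iff_gt less_irrefl)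
      then have "?h \<eta> = h \<zeta>" by (simp add: \<eta>_def)
      ultimately have "h \<zeta> \<in> fst c \<and> snd c (h \<zeta>) \<in> ball z0 R"
        using ds(5)[OF d, of \<eta>] h0 by simp
      then show "h \<zeta> \<in> fst c" "snd c (h \<zeta>) \<in> ball z0 R" by auto
    qed
  qed
  \<comment> \<open>A limit of points in the open coordinate ball may lie on its boundary; the
    closed ball is still inside the chart.\<close>
  have fin: "f \<zeta> \<in> chart_inv c ` cball z0 R" if \<zeta>: "\<zeta> \<in> ball \<zeta>0 \<rho>" for \<zeta>
  proof (rule Lim_in_closed_set[OF chart_inv_compact_image(2)[OF c(1) compact_cball sub(2)] _ G lim[OF in1[OF \<zeta>]]])
    show "\<forall>\<^sub>F h in G. h \<zeta> \<in> chart_inv c ` cball z0 R"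
      using evb by eventually_elim (use \<zeta> in \<open>auto simp: in_chart_inv_image[OF c(1) sub(2)] dest!: bspec[of _ _ \<zeta>]\<close>)
  qed
  then have fc: "f \<zeta> \<in> fst c" if "\<zeta> \<in> ball \<zeta>0 \<rho>" for \<zeta>
    using that in_chart_inv_image[OF c(1) sub(2)] by blast
  have limc: "((\<lambda>h. snd c (h \<zeta>)) \<longlongrightarrow> snd c (f \<zeta>)) G" if \<zeta>: "\<zeta> \<in> ball \<zeta>0 \<rho>" for \<zeta>
  proof (rule continuous_on_tendsto_compose[OF chart_cont[OF c(1)] lim[OF in1[OF \<zeta>]] fc[OF \<zeta>]])
    show "\<forall>\<^sub>F h in G. h \<zeta> \<in> fst c" using evb by eventually_elim (use \<zeta> in blast)
  qed
  have "\<exists>w. ((\<lambda>\<zeta>. snd c (f \<zeta>) $ i) has_field_derivative w) (at \<zeta>0) \<and>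
      ((\<lambda>h. deriv (\<lambda>\<zeta>. snd c (h \<zeta>) $ i) \<zeta>0) \<longlongrightarrow> w) G" for i
  proof (rule holomorphic_pointwise_limit[OF G \<rho>(1)])
    show "\<forall>\<^sub>F h in G. (\<lambda>\<zeta>. snd c (h \<zeta>) $ i) holomorphic_on ball \<zeta>0 \<rho> \<and> 
        (\<forall>z\<in>ball \<zeta>0 \<rho>. cmod (snd c (h z) $ i) \<le> norm z0 + R)"
      using evb
    proof eventually_elim
      case (elim h)
      show ?case
      proof (intro conjI ballI)
        show "(\<lambda>\<zeta>. snd c (h \<zeta>) $ i) holomorphic_on ball \<zeta>0 \<rho>"
          by (rule holomorphic_on_subset[OF disc_holo[of h c i]]) (use elim c in1 in auto)
        fix z assume "z \<in> ball \<zeta>0 \<rho>"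
        then have "snd c (h z) \<in> ball z0 R" using elim by blast
        then have "norm (snd c (h z)) \<le> norm z0 + R"
          using norm_triangle_ineq[of z0 "snd c (h z) - z0"] by (simp add: dist_norm norm_minus_commute)
        then show "cmod (snd c (h z) $ i) \<le> norm z0 + R"
          using Finite_Cartesian_Product.norm_nth_le[of "snd c (h z)" i] order_trans by blast
      qed
    qed
    show "((\<lambda>h. snd c (h z) $ i) \<longlongrightarrow> snd c (f z) $ i) G" if "z \<in> ball \<zeta>0 \<rho>" for z
      by (rule tendsto_vec_nth[OF limc[OF that]])
  qed
  then obtain w where w: "\<And>i. ((\<lambda>\<zeta>. snd c (f \<zeta>) $ i) has_field_derivative w i) (at \<zeta>0)"
      "\<And>i. ((\<lambda>h. deriv (\<lambda>\<zeta>. snd c (h \<zeta>) $ i) \<zeta>0) \<longlongrightarrow> w i) G" by metis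
  have D: "((\<lambda>\<zeta>. snd c (f \<zeta>)) has_derivative (\<lambda>\<eta>. \<eta> *s (\<chi> i. w i))) (at \<zeta>0)"
    by (rule vector_has_derivativeI) (simp add: w(1))
  moreover have "((\<lambda>h. \<chi> i. deriv (\<lambda>\<zeta>. snd c (h \<zeta>) $ i) \<zeta>0) \<longlongrightarrow> (\<chi> i. w i)) G"
    by (rule tendsto_vec_lambda) (rule w(2))
  ultimately show "\<exists>w. ((\<lambda>\<zeta>. snd c (f \<zeta>)) has_derivative (\<lambda>\<eta>. \<eta> *s w)) (at \<zeta>0) \<and>
           ((\<lambda>h. \<chi> i. deriv (\<lambda>\<zeta>. snd c (h \<zeta>) $ i) \<zeta>0) \<longlongrightarrow> w) G" by blast
  \<comment> \<open>Continuity of \<open>f\<close> is recovered from its coordinates: near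
    \<open>\<zeta>0\<close> its values lie in the chart, where \<open>chart_inv c\<close> undoes
    \<open>snd c\<close>.\<close>
  have "isCont (\<lambda>\<zeta>. snd c (f \<zeta>)) \<zeta>0" using D by (rule has_derivative_continuous)
  moreover have "isCont (chart_inv c) (snd c (f \<zeta>0))"
    using chart_inv_cont[OF c(1)] chart_open[OF c(1)] c(2) by (simp add: continuous_on_eq_continuous_at)
  ultimately have "isCont (\<lambda>\<zeta>. chart_inv c (snd c (f \<zeta>))) \<zeta>0" by (rule isCont_o2)
  moreover have "\<forall>\<^sub>F \<zeta> in nhds \<zeta>0. \<zeta> \<in> ball \<zeta>0 \<rho>" using \<rho>(1) by (intro eventually_nhds_in_open) auto
  then have "\<forall>\<^sub>F \<zeta> in nhds \<zeta>0. chart_inv c (snd c (f \<zeta>)) = f \<zeta>"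
    by eventually_elim (use fc chart_inv_left[OF c(1)] in auto)
  ultimately show "isCont f \<zeta>0" using isCont_cong[of "\<lambda>\<zeta>. chart_inv c (snd c (f \<zeta>))" f \<zeta>0] by simp
qed

lemma disc_limit:
  assumes G: "G \<noteq> bot" and ev: "\<forall>\<^sub>F h in G. disc h"
    and lim: "\<And>\<zeta>. cmod \<zeta> < 1 \<Longrightarrow> ((\<lambda>h. h \<zeta>) \<longlongrightarrow> f \<zeta>) G"
    and M: "\<And>\<zeta>. cmod \<zeta> < 1 \<Longrightarrow> f \<zeta> \<in> M"
  shows "disc f"
    and "c \<in> A \<Longrightarrow> f 0 \<in> fst c \<Longrightarrow> (centre_deriv c \<longlongrightarrow> centre_deriv c f) G"
proof -
  show "disc f"
  proof (rule discI)
    show "continuous_on (ball 0 1) f"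
    proof (intro continuous_at_imp_continuous_on ballI)
      fix \<zeta> :: complex assume "\<zeta> \<in> ball 0 1"
      then have z: "cmod \<zeta> < 1" by simp
      obtain c where "c \<in> A" "f \<zeta> \<in> fst c" using chart_ex[OF M[OF z]] by blast
      then show "isCont f \<zeta>" using disc_limit_local(1)[OF G ev lim z] by blast
    qed
    show "f \<zeta> \<in> M" if "\<zeta> \<in> ball 0 1" for \<zeta> using M that by simp
    fix c i \<zeta> assume c: "c \<in> A" and z: "\<zeta> \<in> ball (0::complex) 1" and fc: "f \<zeta> \<in> fst c"
    have "cmod \<zeta> < 1" using z by simp
    from disc_limit_local(2)[OF G ev lim this c fc]
    obtain w where "((\<lambda>\<zeta>. snd c (f \<zeta>)) has_derivative (\<lambda>\<eta>. \<eta> *s w)) (at \<zeta>)" by blast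
    from vector_has_derivative_component[OF this]
    show "\<exists>D. ((\<lambda>\<zeta>. snd c (f \<zeta>) $ i) has_field_derivative D) (at \<zeta>)" by blast
  qed
  assume c: "c \<in> A" "f 0 \<in> fst c"
  obtain w where w: "((\<lambda>\<zeta>. snd c (f \<zeta>)) has_derivative (\<lambda>\<eta>. \<eta> *s w)) (at 0)"
     "((\<lambda>h. \<chi> i. deriv (\<lambda>\<zeta>. snd c (h \<zeta>) $ i) 0) \<longlongrightarrow> w) G"
    using disc_limit_local(2)[OF G ev lim _ c] by auto
  show "(centre_deriv c \<longlongrightarrow> centre_deriv c f) G" using w(2) centre_deriv_eq[OF w(1)] by (simp add: centre_deriv_def[abs_def])
qed

text \<open>Functions carry the product topology over all complex parameters. Fixing the value
  outside the unit disc places the set inside a compact product.\<close>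

definition discs_into :: "'a set \<Rightarrow> (complex \<Rightarrow> 'a) set" where
  "discs_into K = {h. disc h \<and> h ` ball 0 1 \<subseteq> K \<and> (\<forall>\<zeta>. \<zeta> \<notin> ball 0 1 \<longrightarrow> h \<zeta> = undefined)}"

lemma tendsto_eval: "((\<lambda>h. h \<zeta>) \<longlongrightarrow> f \<zeta>) (at f within S)" for f :: "'x \<Rightarrow> 'y::topological_space"
proof -
  have "((\<lambda>h :: 'x \<Rightarrow> 'y. h \<zeta>) \<longlongrightarrow> f \<zeta>) (at f within UNIV)"
    using continuous_on_product_coordinates[of \<zeta>, where 'b = 'y] unfolding continuous_on_def by blast
  then show ?thesis by (rule tendsto_within_subset) simp
qed

text \<open>Tychonoff's theorem gives a compact product, and the discs form a closed subset of it,
  since by \<open>disc_limit\<close> a pointwise limit of discs into \<open>K\<close> is again a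
  disc.\<close>

lemma compact_discs_into:
  assumes K: "compact K" "K \<subseteq> M"
  shows "compact (discs_into K)"
proof -
  let ?S = "\<lambda>\<zeta>::complex. if \<zeta> \<in> ball 0 1 then K else {undefined}"
  let ?P = "PiE UNIV ?S"
  have "compactin (product_topology (\<lambda>i. euclidean) UNIV) ?P"
    unfolding compactin_PiE using K(1) by simp
  then have P: "compact ?P" by (simp add: euclidean_product_topology)
  have sub: "discs_into K \<subseteq> ?P" by (auto simp: discs_into_def image_subset_iff)
  have cl: "closed (discs_into K)"
    unfolding closed_limpt
  proof (intro allI impI)
    fix f assume "f islimpt discs_into K"
    then have G: "at f within discs_into K \<noteq> bot" by (simp add: trivial_limit_within)
    have ev: "\<forall>\<^sub>F h in at f within discs_into K. h \<in> discs_into K" by (simp add: eventually_at_filter)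
    have fK: "f \<zeta> \<in> K" if "cmod \<zeta> < 1" for \<zeta>
      by (rule Lim_in_closed_set[OF compact_imp_closed[OF K(1)] _ G tendsto_eval])
        (rule eventually_mono[OF ev], use that in \<open>auto simp: discs_into_def\<close>)
    have fu: "f \<zeta> = undefined" if "\<zeta> \<notin> ball 0 1" for \<zeta>
    proof -
      have "f \<zeta> \<in> {undefined}"
        by (rule Lim_in_closed_set[OF closed_singleton _ G tendsto_eval])
          (rule eventually_mono[OF ev], use that in \<open>auto simp: discs_into_def\<close>)
      then show ?thesis by simp
    qed
    have "disc f"
    proof (rule disc_limit(1)[OF G _ tendsto_eval])
      show "\<forall>\<^sub>F h in at f within discs_into K. disc h"
        by (rule eventually_mono[OF ev]) (auto simp: discs_into_def)
      show "\<And>\<zeta>. cmod \<zeta> < 1 \<Longrightarrow> f \<zeta> \<in> M" using fK K(2) by blast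
    qed
    then show "f \<in> discs_into K" using fK fu by (auto simp: discs_into_def)
  qed
  have "discs_into K = ?P \<inter> discs_into K" using sub by blast
  then show ?thesis using compact_Int_closed[OF P cl] by simp
qed

text \<open>By \<open>disc_limit\<close> the centre derivative depends continuously on the disc
  already for pointwise convergence, so the data form a continuous image of a compact set.\<close>

lemma compact_disc_data:
  assumes K: "compact K" "K \<subseteq> M" and c: "c \<in> A" and B: "compact B" "B \<subseteq> snd c ` fst c"
  shows "compact ((\<lambda>h. (snd c (h 0), centre_deriv c h)) ` {h\<in>discs_into K. h 0 \<in> chart_inv c ` B})"
proof (rule compact_continuous_image)
  let ?F = "{h\<in>discs_into K. h 0 \<in> chart_inv c ` B}"
  have "closed ((\<lambda>h. h (0::complex)) -` (chart_inv c ` B))"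
    by (rule closed_vimage[OF chart_inv_compact_image(2)[OF c B]]) simp
  then have "compact (discs_into K \<inter> (\<lambda>h. h (0::complex)) -` (chart_inv c ` B))"
    by (rule compact_Int_closed[OF compact_discs_into[OF K]])
  moreover have "discs_into K \<inter> (\<lambda>h. h (0::complex)) -` (chart_inv c ` B) = ?F" by auto
  ultimately show "compact ?F" by simp
  show "continuous_on ?F (\<lambda>h. (snd c (h 0), centre_deriv c h))"
    unfolding continuous_on_def
  proof
    fix f assume f: "f \<in> ?F"
    let ?G = "at f within ?F"
    show "((\<lambda>h. (snd c (h 0), centre_deriv c h)) \<longlongrightarrow> (snd c (f 0), centre_deriv c f)) ?G"
    proof (cases "?G = bot")
      case False
      have evF: "\<forall>\<^sub>F h in ?G. h \<in> ?F" by (simp add: eventually_at_filter)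
      have fc: "f 0 \<in> fst c" using f chart_inv_compact_image(3)[OF c B] by auto
      have "(centre_deriv c \<longlongrightarrow> centre_deriv c f) ?G"
      proof (rule disc_limit(2)[OF False _ tendsto_eval _ c fc])
        show "\<forall>\<^sub>F h in ?G. disc h" by (rule eventually_mono[OF evF]) (auto simp: discs_into_def)
        show "\<And>\<zeta>. cmod \<zeta> < 1 \<Longrightarrow> f \<zeta> \<in> M" using f disc_in by (auto simp: discs_into_def)
      qed
      moreover have "((\<lambda>h. snd c (h 0)) \<longlongrightarrow> snd c (f 0)) ?G"
      proof (rule continuous_on_tendsto_compose[OF chart_cont[OF c], where g = "\<lambda>h. h 0" and l = "f 0"])
        show "((\<lambda>h. h 0) \<longlongrightarrow> f 0) ?G" by (rule tendsto_eval)
        show "f 0 \<in> fst c" by (rule fc)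
        show "\<forall>\<^sub>F h in ?G. h 0 \<in> fst c"
          by (rule eventually_mono[OF evF]) (use chart_inv_compact_image(3)[OF c B] in auto)
      qed
      ultimately show ?thesis by (intro tendsto_Pair)
    qed simp
  qed
qed

end

section \<open>Compact exhaustion and Borel sublevel sets\<close>

context complex_mfd
begin

lemma disc_cong:
  assumes f: "disc f" and eq: "\<And>\<zeta>. cmod \<zeta> < 1 \<Longrightarrow> f \<zeta> = g \<zeta>"
  shows "disc g"
proof (rule discI)
  show "continuous_on (ball 0 1) g"
    by (rule continuous_on_eq[OF disc_cont[OF f]]) (simp add: eq)
  show "g \<zeta> \<in> M" if "\<zeta> \<in> ball 0 1" for \<zeta> using disc_in[OF f, of \<zeta>] eq that by simp
  fix c i \<zeta> assume c: "c \<in> A" and z: "\<zeta> \<in> ball (0::complex) 1" "g \<zeta> \<in> fst c"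
  obtain w where "((\<lambda>\<zeta>. snd c (f \<zeta>)) has_derivative (\<lambda>\<eta>. \<eta> *s w)) (at \<zeta>)"
    using disc_deriv[OF f c, of \<zeta>] z eq by auto
  then have "((\<lambda>\<zeta>. snd c (g \<zeta>)) has_derivative (\<lambda>\<eta>. \<eta> *s w)) (at \<zeta>)"
    by (rule has_derivative_transform_within_open[OF _ open_ball z(1)]) (simp add: eq)
  from vector_has_derivative_component[OF this]
  show "\<exists>D. ((\<lambda>\<zeta>. snd c (g \<zeta>) $ i) has_field_derivative D) (at \<zeta>)" by blast
qed

lemma centre_deriv_cong:
  assumes f: "disc f" and c: "c \<in> A" "f 0 \<in> fst c" and eq: "\<And>\<zeta>. cmod \<zeta> < 1 \<Longrightarrow> f \<zeta> = g \<zeta>"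
  shows "centre_deriv c g = centre_deriv c f"
proof (rule centre_deriv_eq)
  show "((\<lambda>\<zeta>. snd c (g \<zeta>)) has_derivative (\<lambda>\<eta>. \<eta> *s centre_deriv c f)) (at 0)"
    by (rule has_derivative_transform_within_open[OF disc_centre_deriv[OF f c], of "ball 0 1"]) (auto simp: eq)
qed

text \<open>Second countability enters through Lindelof's theorem: countably many coordinate balls,
  each inside a compact subset of \<open>M\<close>, cover \<open>M\<close>, and the finite unions of
  these compact sets absorb every compact subset.\<close>

lemma compact_exhaustion:
  obtains \<K> where "countable \<K>" "\<And>K. K \<in> \<K> \<Longrightarrow> compact K \<and> K \<subseteq> M"
    "\<And>Q. compact Q \<Longrightarrow> Q \<subseteq> M \<Longrightarrow> \<exists>K\<in>\<K>. Q \<subseteq> K"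
proof -
  define \<O> where "\<O> = {chart_inv c ` ball z r | c z r. c \<in> A \<and> 0 < r \<and> cball z r \<subseteq> snd c ` fst c}"
  have op: "openin (top_of_set M) S" if "S \<in> \<O>" for S
  proof -
    obtain c z r where S: "S = chart_inv c ` ball z r" "c \<in> A" "cball z r \<subseteq> snd c ` fst c" using \<open>S \<in> \<O>\<close> unfolding \<O>_def by blast
    have "ball z r \<subseteq> snd c ` fst c" using S(3) ball_subset_cball by blast
    then show ?thesis unfolding S(1) using chart_inv_open_image[OF S(2) open_ball] by blast
  qed
  have cpt: "\<exists>K. compact K \<and> K \<subseteq> M \<and> S \<subseteq> K" if "S \<in> \<O>" for S
  proof -
    obtain c z r where S: "S = chart_inv c ` ball z r" "c \<in> A" "cball z r \<subseteq> snd c ` fst c" using \<open>S \<in> \<O>\<close> unfolding \<O>_def by blast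
    have "S \<subseteq> chart_inv c ` cball z r" unfolding S(1) using ball_subset_cball by (intro image_mono)
    then show ?thesis using chart_inv_compact_image[OF S(2) compact_cball S(3)] chart_sub[OF S(2)] by blast
  qed
  have cov: "M \<subseteq> \<Union>\<O>"
  proof
    fix x assume "x \<in> M"
    then obtain c where c: "c \<in> A" "x \<in> fst c" using chart_ex by blast
    obtain R where R: "0 < R" "cball (snd c x) R \<subseteq> snd c ` fst c" using chart_ball[OF c] .
    have "chart_inv c ` ball (snd c x) R \<in> \<O>" unfolding \<O>_def using R c by blast
    moreover have "chart_inv c (snd c x) \<in> chart_inv c ` ball (snd c x) R" using R by (intro imageI) simp
    ultimately show "x \<in> \<Union>\<O>" using chart_inv_left[OF c] by (intro UnionI) auto
  qed
  obtain \<O>' where O': "\<O>' \<subseteq> \<O>" "countable \<O>'" "\<Union>\<O>' = \<Union>\<O>"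
    using Lindelof_openin[of \<O> M] op by metis
  obtain \<kappa> where \<kappa>: "\<And>S. S \<in> \<O> \<Longrightarrow> compact (\<kappa> S) \<and> \<kappa> S \<subseteq> M \<and> S \<subseteq> \<kappa> S" using cpt by metis
  define \<K> where "\<K> = (\<lambda>F. \<Union>(\<kappa> ` F)) ` {F. finite F \<and> F \<subseteq> \<O>'}"
  show ?thesis
  proof (rule that[of \<K>])
    show "countable \<K>" unfolding \<K>_def using countable_Collect_finite_subset[OF O'(2)] by (rule countable_image)
    show "compact K \<and> K \<subseteq> M" if "K \<in> \<K>" for K
    proof -
      obtain F where F: "K = \<Union>(\<kappa> ` F)" "finite F" "F \<subseteq> \<O>'" using \<open>K \<in> \<K>\<close> by (auto simp: \<K>_def)
      have k: "compact (\<kappa> S) \<and> \<kappa> S \<subseteq> M" if "S \<in> F" for S using \<kappa>[of S] that F(3) O'(1) by blast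
      show ?thesis unfolding F(1) using k F(2) by (intro conjI compact_UN) auto
    qed
    fix Q assume Q: "compact Q" "Q \<subseteq> M"
    have "\<exists>T. open T \<and> S = M \<inter> T" if "S \<in> \<O>'" for S using op[of S] that O'(1) by (auto simp: openin_open)
    then obtain T where T: "\<And>S. S \<in> \<O>' \<Longrightarrow> open (T S)" "\<And>S. S \<in> \<O>' \<Longrightarrow> S = M \<inter> T S" by metis
    have QT: "Q \<subseteq> (\<Union>S\<in>\<O>'. T S)"
    proof
      fix x assume "x \<in> Q"
      then have "x \<in> \<Union>\<O>'" using Q(2) cov O'(3) by blast
      then obtain S where "S \<in> \<O>'" "x \<in> S" by blast
      then show "x \<in> (\<Union>S\<in>\<O>'. T S)" using T(2) by blast
    qed
    obtain F where F: "F \<subseteq> \<O>'" "finite F" "Q \<subseteq> (\<Union>S\<in>F. T S)" by (rule compactE_image[OF Q(1) T(1) QT])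
    have "Q \<subseteq> \<Union>(\<kappa> ` F)"
    proof
      fix x assume x: "x \<in> Q"
      then obtain S where S: "S \<in> F" "x \<in> T S" using F(3) by blast
      then have "x \<in> S" using T(2)[of S] F(1) x Q(2) by blast
      then show "x \<in> \<Union>(\<kappa> ` F)" using \<kappa>[of S] S(1) F(1) O'(1) by blast
    qed
    then show "\<exists>K\<in>\<K>. Q \<subseteq> K" using F by (auto simp: \<K>_def)
  qed
qed

end

context hyperbolic_mfd
begin

text \<open>
  Shrinking a disc slightly makes its image relatively compact, so each sublevel set of the
  Kobayashi--Royden metric over a compact coordinate set is a countable union of compact sets.
\<close>

lemma kr_scales_sublevel_borel:
  assumes c: "c \<in> A" and B: "compact B" "B \<subseteq> snd c ` fst c"
  shows "{(z, w). z \<in> B \<and> Inf (kr_scales c (chart_inv c z) w) < \<alpha>} \<in> sets borel"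
proof -
  obtain \<K> where K: "countable \<K>" "\<And>K. K \<in> \<K> \<Longrightarrow> compact K \<and> K \<subseteq> M"
    "\<And>Q. compact Q \<Longrightarrow> Q \<subseteq> M \<Longrightarrow> \<exists>K\<in>\<K>. Q \<subseteq> K" by (rule compact_exhaustion) blast
  define D where "D K = (\<lambda>h. (snd c (h 0), centre_deriv c h)) ` {h\<in>discs_into K. h 0 \<in> chart_inv c ` B}" for K
  define S where "S = (\<lambda>\<beta>::real. \<lambda>(z::complex^'n, u::complex^'n). (z, \<beta> *\<^sub>R u))"
  \<comment> \<open>Rational scales keep the union countable.\<close>
  let ?I = "\<rat> \<inter> {0<..<\<alpha>}"
  have "{(z, w). z \<in> B \<and> Inf (kr_scales c (chart_inv c z) w) < \<alpha>} = (\<Union>K\<in>\<K>. \<Union>\<beta>\<in>?I. S \<beta> ` D K)" (is "?L = ?R")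
  proof (intro set_eqI iffI)
    fix p assume "p \<in> ?L"
    then obtain z w where p: "p = (z, w)" "z \<in> B" "Inf (kr_scales c (chart_inv c z) w) < \<alpha>" by auto
    have zi: "z \<in> snd c ` fst c" using p(2) B(2) by blast
    obtain \<alpha>' where a': "\<alpha>' \<in> kr_scales c (chart_inv c z) w" "\<alpha>' < \<alpha>"
      using cInf_lessD[OF kr_scales_nonempty[OF c chart_inv_in[OF c zi]] p(3)] by blast
    then obtain f where f: "0 < \<alpha>'" "disc f" "f 0 = chart_inv c z" "w = \<alpha>' *\<^sub>R centre_deriv c f" by (auto simp: kr_scales_def)
    have f0: "f 0 \<in> fst c" using f(3) chart_inv_in[OF c zi] by simp
    obtain \<beta> where b: "\<beta> \<in> \<rat>" "\<alpha>' < \<beta>" "\<beta> < \<alpha>" using Rats_dense_in_real[OF a'(2)] by blast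
    \<comment> \<open>Shrinking by \<open>s\<close> brings the image into a compact set and
      multiplies the derivative by \<open>s\<close>, which raises the scale from
      \<open>\<alpha>'\<close> to the rational \<open>\<beta>\<close>.\<close>
    define s where "s = \<alpha>' / \<beta>"
    have s: "0 < s" "s < 1" "\<beta> * s = \<alpha>'" using f(1) b by (auto simp: s_def field_simps)
    define h where "h \<zeta> = (if \<zeta> \<in> ball 0 1 then f (of_real s * \<zeta>) else undefined)" for \<zeta>
    have fs: "disc (\<lambda>\<zeta>. f (of_real s * \<zeta>))" using disc_affine[OF f(2), of s 0] s by simp
    have dh: "disc h" by (rule disc_cong[OF fs]) (simp add: h_def)
    have "centre_deriv c h = centre_deriv c (\<lambda>\<zeta>. f (of_real s * \<zeta>))"
      by (rule centre_deriv_cong[OF fs c]) (use f0 in \<open>simp_all add: h_def\<close>)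
    also have "\<dots> = s *\<^sub>R centre_deriv c f" by (rule centre_deriv_affine[OF f(2) c f0])
    finally have dd: "centre_deriv c h = s *\<^sub>R centre_deriv c f" .
    have "compact (f ` cball 0 s)"
      by (rule compact_continuous_image[OF continuous_on_subset[OF disc_cont[OF f(2)]]]) (use s in auto)
    moreover have "f ` cball 0 s \<subseteq> M" using disc_in[OF f(2)] s by auto
    ultimately obtain K0 where K0: "K0 \<in> \<K>" "f ` cball 0 s \<subseteq> K0" using K(3) by blast
    have "h \<zeta> \<in> K0" if "\<zeta> \<in> ball 0 1" for \<zeta>
    proof -
      have "s * cmod \<zeta> \<le> s * 1" using that s by (intro mult_left_mono) auto
      then have "of_real s * \<zeta> \<in> cball 0 s" using s by (simp add: norm_mult)
      then show ?thesis using K0(2) that by (auto simp: h_def)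
    qed
    then have hK: "h \<in> discs_into K0" using dh by (auto simp: discs_into_def h_def)
    have h0: "h 0 = chart_inv c z" using f(3) by (simp add: h_def)
    have "(snd c (h 0), centre_deriv c h) \<in> D K0" unfolding D_def using hK h0 p(2) by (intro imageI) simp
    then have "S \<beta> (snd c (h 0), centre_deriv c h) \<in> S \<beta> ` D K0" by (rule imageI)
    moreover have "S \<beta> (snd c (h 0), centre_deriv c h) = p"
      unfolding S_def using p(1) h0 chart_inv_right[OF c zi] f(4) dd s(3) by simp
    ultimately have "p \<in> S \<beta> ` D K0" by simp
    moreover have "\<beta> \<in> ?I" using b f(1) by simp
    ultimately show "p \<in> ?R" using K0(1) by blast
  next
    fix p assume "p \<in> ?R"
    then obtain K0 \<beta> where K0: "\<beta> \<in> ?I" "p \<in> S \<beta> ` D K0" by blast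
    then obtain h where h: "h \<in> discs_into K0" "h 0 \<in> chart_inv c ` B" "p = (snd c (h 0), \<beta> *\<^sub>R centre_deriv c h)"
      unfolding D_def S_def by auto
    have h0: "h 0 \<in> fst c" "snd c (h 0) \<in> B" using h(2) in_chart_inv_image[OF c B(2)] by auto
    have "\<beta> \<in> kr_scales c (h 0) (\<beta> *\<^sub>R centre_deriv c h)" using h(1) K0(1) by (auto simp: kr_scales_def discs_into_def)
    then have "Inf (kr_scales c (h 0) (\<beta> *\<^sub>R centre_deriv c h)) \<le> \<beta>" by (rule cInf_lower[OF _ kr_scales_bdd])
    then show "p \<in> ?L" using h(3) h0 chart_inv_left[OF c h0(1)] K0(1) by auto
  qed
  also have "?R \<in> sets borel"
  proof (rule sets.countable_UN''[OF K(1)], rule sets.countable_UN'')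
    show "countable ?I" by (rule countable_subset[OF _ countable_rat]) auto
    fix K0 \<beta> assume K0: "K0 \<in> \<K>"
    have "continuous_on (D K0) (S \<beta>)"
      unfolding S_def case_prod_unfold by (intro continuous_intros)
    moreover have "compact (D K0)"
      unfolding D_def by (rule compact_disc_data[OF _ _ c B]) (use K(2)[OF K0] in auto)
    ultimately have "compact (S \<beta> ` D K0)" by (rule compact_continuous_image)
    then show "S \<beta> ` D K0 \<in> sets borel" by (intro borel_closed compact_imp_closed)
  qed
  finally show ?thesis .
qed

text \<open>Extension by 0 outside \<open>B\<close> gives a Borel function on the whole space, ready
  to be composed with Lebesgue measurable functions of time.\<close>

lemma kr_scales_borel_measurable:
  assumes c: "c \<in> A" and B: "compact B" "B \<subseteq> snd c ` fst c"
  shows "(\<lambda>p. if fst p \<in> B then Inf (kr_scales c (chart_inv c (fst p)) (snd p)) else 0) \<in> borel_measurable borel"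
  unfolding borel_measurable_iff_less
proof
  fix \<alpha> :: real
  have "{p \<in> space borel. (if fst p \<in> B then Inf (kr_scales c (chart_inv c (fst p)) (snd p)) else 0) < \<alpha>} =
    {(z, w). z \<in> B \<and> Inf (kr_scales c (chart_inv c z) w) < \<alpha>} \<union> (if 0 < \<alpha> then - (B \<times> UNIV) else {})"
    by auto
  also have "\<dots> \<in> sets borel"
  proof (rule sets.Un[OF kr_scales_sublevel_borel[OF c B]])
    have "closed (B \<times> (UNIV :: (complex^'n) set))" by (rule closed_Times[OF compact_imp_closed[OF B(1)] closed_UNIV])
    from borel_open[OF open_Compl[OF this]]
    show "(if 0 < \<alpha> then - (B \<times> (UNIV :: (complex^'n) set)) else {}) \<in> sets borel" by (cases "0 < \<alpha>") simp_all
  qed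
  finally show "{p \<in> space borel. (if fst p \<in> B then Inf (kr_scales c (chart_inv c (fst p)) (snd p)) else 0) < \<alpha>} \<in> sets borel" .
qed

end

section \<open>Length of a path and reparametrisation\<close>

context complex_mfd
begin

lemma has_velocity_alt:
  "has_velocity A I \<sigma> t v \<longleftrightarrow> v \<in> tangent_space A (\<sigma> t) \<and>
     (\<forall>c\<in>A. \<sigma> t \<in> fst c \<longrightarrow> ((\<lambda>s. snd c (\<sigma> s)) has_vector_derivative v c) (at t within I))"
  by (simp add: has_velocity_def case_prod_unfold o_def)

text \<open>Differentiability in one chart suffices. The chain rule through the transition map
  applies because, by continuity, \<open>\<sigma>\<close> stays in the first chart near
  \<open>t\<close>.\<close>

lemma has_velocity_chart:
  assumes \<sigma>: "continuous_on I \<sigma>" "\<sigma> ` I \<subseteq> M" and t: "t \<in> I" and c: "c \<in> A" "\<sigma> t \<in> fst c"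
    and D: "((\<lambda>s. snd c (\<sigma> s)) has_vector_derivative w) (at t within I)"
  shows "has_velocity A I \<sigma> t (tangent_of c (\<sigma> t) w)"
  unfolding has_velocity_alt
proof (intro conjI ballI impI)
  show "tangent_of c (\<sigma> t) w \<in> tangent_space A (\<sigma> t)" by (rule tangent_of_tangent[OF c])
  fix d assume d: "d \<in> A" "\<sigma> t \<in> fst d"
  have "(transition c d \<circ> (\<lambda>s. snd c (\<sigma> s)) has_derivative transition_deriv c d (\<sigma> t) \<circ> (\<lambda>x. x *\<^sub>R w)) (at t within I)"
    using D unfolding has_vector_derivative_def
    by (rule diff_chain_within) (rule has_derivative_at_withinI[OF transition_has_derivative(1)[OF c(1) d(1) c(2) d(2)]])
  then have 1: "((\<lambda>s. transition c d (snd c (\<sigma> s))) has_derivative (\<lambda>x. x *\<^sub>R transition_deriv c d (\<sigma> t) w)) (at t within I)"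
    by (simp add: o_def transition_deriv_scale(2)[OF c(1) d(1) c(2) d(2)])
  obtain T where T: "open T" "fst c = M \<inter> T" using chart_openin[OF c(1)] by (auto simp: openin_open)
  have "(\<sigma> \<longlongrightarrow> \<sigma> t) (at t within I)" using \<sigma>(1) t by (simp add: continuous_on_def)
  then have "\<forall>\<^sub>F s in at t within I. \<sigma> s \<in> T" by (rule topological_tendstoD[OF _ T(1)]) (use T c in blast)
  moreover have "\<forall>\<^sub>F s in at t within I. s \<in> I" by (simp add: eventually_at_filter)
  ultimately have ev: "\<forall>\<^sub>F s in at t within I. transition c d (snd c (\<sigma> s)) = snd d (\<sigma> s)"
  proof eventually_elim
    case (elim s)
    then have "\<sigma> s \<in> fst c" using T(2) \<sigma>(2) by blast
    then show ?case by (simp add: transition_eq chart_inv_left[OF c(1)])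
  qed
  have "((\<lambda>s. snd d (\<sigma> s)) has_derivative (\<lambda>x. x *\<^sub>R transition_deriv c d (\<sigma> t) w)) (at t within I)"
    by (rule has_derivative_transform_eventually[OF 1 ev _ t]) (simp add: transition_eq chart_inv_left[OF c])
  then show "((\<lambda>s. snd d (\<sigma> s)) has_vector_derivative tangent_of c (\<sigma> t) w d) (at t within I)"
    using d by (simp add: has_vector_derivative_def tangent_of_def)
qed

lemma has_velocity_unique:
  assumes v: "has_velocity A {a..b} \<sigma> t v" "has_velocity A {a..b} \<sigma> t v'"
    and t: "t \<in> {a..b}" "a < b" "\<sigma> t \<in> M"
  shows "v = v'"
proof -
  obtain c where c: "c \<in> A" "\<sigma> t \<in> fst c" using chart_ex[OF t(3)] by blast
  have "v c = v' c"
    by (rule vector_derivative_unique_within_closed_interval[of a b t "\<lambda>s. snd c (\<sigma> s)"])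
      (use v t c in \<open>auto simp: has_velocity_alt\<close>)
  then show ?thesis
    using tangent_eq_tangent_of[OF _ c, of v] tangent_eq_tangent_of[OF _ c, of v'] v by (simp add: has_velocity_alt)
qed

end

section \<open>The length function of a path\<close>

locale hyperbolic_path = hyperbolic_mfd M A
  for M :: "'a::{t2_space, second_countable_topology} set" and A :: "('a, 'n::finite) chart set" +
  fixes \<gamma> :: "real \<Rightarrow> 'a" and T :: real
  assumes ac: "abs_continuous_path M A {0..T} \<gamma>" and T: "0 < T"
begin

definition speed :: "real \<Rightarrow> real" where
  "speed t = kobayashi_metric M A (\<gamma> t) (velocity A {0..T} \<gamma> t)"

definition len :: "real \<Rightarrow> real" where "len = kobayashi_length M A T \<gamma>"

lemma path_cont: "continuous_on {0..T} \<gamma>" and path_in: "\<gamma> ` {0..T} \<subseteq> M"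
  using ac by (auto simp: abs_continuous_path_def locally_abs_continuous_path_def)

lemma path_mem: "t \<in> {0..T} \<Longrightarrow> \<gamma> t \<in> M"
  using path_in by blast

lemma path_chart_ac:
  assumes c: "c \<in> A" and ab: "0 \<le> a" "a \<le> b" "b \<le> T" "\<gamma> ` {a..b} \<subseteq> fst c"
  shows "abs_continuous_on {a..b} (\<lambda>s. snd c (\<gamma> s))"
proof -
  have *: "\<forall>t\<in>{0..T}. \<forall>d\<in>A. \<gamma> t \<in> fst d \<longrightarrow>
      (\<forall>a b. t \<in> {a..b} \<and> {a..b} \<subseteq> {t\<in>{0..T}. \<gamma> t \<in> fst d} \<longrightarrow> abs_continuous_on {a..b} (snd d \<circ> \<gamma>))"
    using ac unfolding abs_continuous_path_def locally_abs_continuous_path_def case_prod_unfold by blast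
  have "abs_continuous_on {a..b} (snd c \<circ> \<gamma>)" by (rule *[rule_format, of a]) (use c ab in auto)
  then show ?thesis by (simp add: o_def)
qed

lemma velocity_eq: 
  assumes "has_velocity A {0..T} \<gamma> t v" "t \<in> {0..T}"
  shows "velocity A {0..T} \<gamma> t = v"
  unfolding velocity_def
proof (rule the_equality)
  show "has_velocity A {0..T} \<gamma> t v" by (rule assms(1))
  fix v' assume "has_velocity A {0..T} \<gamma> t v'"
  then show "v' = v" using assms(1,2) T path_mem[OF assms(2)] by (rule has_velocity_unique)
qed

text \<open>Joins integration and geometry: the density \<open>h\<close> of the coordinates of the
  path represents its velocity almost everywhere.\<close>

lemma path_density:
  assumes c: "c \<in> A" and ab: "0 \<le> a" "a < b" "b \<le> T" "\<gamma> ` {a..b} \<subseteq> fst c"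
  obtains h where "set_integrable lebesgue {a..b} h"
    "\<And>s t. a \<le> s \<Longrightarrow> s \<le> t \<Longrightarrow> t \<le> b \<Longrightarrow> snd c (\<gamma> t) - snd c (\<gamma> s) = (LINT x:{s..t}|lebesgue. h x)"
    "negligible {t\<in>{a..b}. \<not> has_velocity A {0..T} \<gamma> t (tangent_of c (\<gamma> t) (h t))}"
proof -
  obtain h where h: "set_integrable lebesgue {a..b} h"
    "\<And>t. t \<in> {a..b} \<Longrightarrow> snd c (\<gamma> t) - snd c (\<gamma> a) = (LINT s:{a..t}|lebesgue. h s)"
    "negligible {t\<in>{a<..<b}. \<not> ((\<lambda>s. snd c (\<gamma> s)) has_vector_derivative h t) (at t)}"
    using abs_continuous_density[OF ab(2) path_chart_ac[OF c ab(1) less_imp_le[OF ab(2)] ab(3,4)]] by blast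
  show ?thesis
  proof (rule that[OF h(1)])
    fix s t assume st: "a \<le> s" "s \<le> t" "t \<le> b"
    have "set_integrable lebesgue {a..t} h" by (rule set_integrable_subset[OF h(1)]) (use st in auto)
    from set_integral_Icc_split[OF this st(1,2)]
    show "snd c (\<gamma> t) - snd c (\<gamma> s) = (LINT x:{s..t}|lebesgue. h x)"
      using h(2)[of s] h(2)[of t] st by (simp add: algebra_simps)
  next
    \<comment> \<open>\<open>abs_continuous_density\<close> speaks of interior points; the two end
      points are added as a null set.\<close>
    have nn: "negligible ({t\<in>{a<..<b}. \<not> ((\<lambda>s. snd c (\<gamma> s)) has_vector_derivative h t) (at t)} \<union> {a, b})"
      using h(3) by (intro negligible_Un) auto
    show "negligible {t\<in>{a..b}. \<not> has_velocity A {0..T} \<gamma> t (tangent_of c (\<gamma> t) (h t))}"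
    proof (rule negligible_subset[OF nn], rule subsetI, rule ccontr)
      fix t assume t: "t \<in> {t\<in>{a..b}. \<not> has_velocity A {0..T} \<gamma> t (tangent_of c (\<gamma> t) (h t))}"
        "t \<notin> {t\<in>{a<..<b}. \<not> ((\<lambda>s. snd c (\<gamma> s)) has_vector_derivative h t) (at t)} \<union> {a, b}"
      then have d: "((\<lambda>s. snd c (\<gamma> s)) has_vector_derivative h t) (at t)" and tab: "t \<in> {a..b}" by auto
      have "has_velocity A {0..T} \<gamma> t (tangent_of c (\<gamma> t) (h t))"
        by (rule has_velocity_chart[OF path_cont path_in _ c _ has_vector_derivative_at_within[OF d]]) (use tab ab in auto)
      with t show False by blast
    qed
  qed
qed

text \<open>Almost everywhere the speed is a Borel function of the coordinates of
  \<open>\<gamma>\<close> and their density \<open>h\<close>, and it is dominated by a multiple of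
  \<open>norm (h t)\<close>.\<close>

lemma piece_integrable:
  assumes c: "c \<in> A" and ab: "0 \<le> a" "a < b" "b \<le> T" "\<gamma> ` {a..b} \<subseteq> fst c"
  shows "set_integrable lebesgue {a..b} speed"
    and "negligible {t\<in>{a..b}. \<not> (\<exists>v. has_velocity A {0..T} \<gamma> t v)}"
proof -
  obtain h where h: "set_integrable lebesgue {a..b} h"
    "negligible {t\<in>{a..b}. \<not> has_velocity A {0..T} \<gamma> t (tangent_of c (\<gamma> t) (h t))}"
    by (rule path_density[OF c ab], rule that)
  show "negligible {t\<in>{a..b}. \<not> (\<exists>v. has_velocity A {0..T} \<gamma> t v)}"
    by (rule negligible_subset[OF h(2)]) auto
  have cont: "continuous_on {a..b} (\<lambda>s. snd c (\<gamma> s))"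
    by (rule continuous_on_compose2[OF chart_cont[OF c] continuous_on_subset[OF path_cont]]) (use ab in auto)
  define B where "B = (\<lambda>s. snd c (\<gamma> s)) ` {a..b}"
  have B: "compact B" "B \<subseteq> snd c ` fst c"
    unfolding B_def using compact_continuous_image[OF cont compact_Icc] ab(4) by auto
  \<comment> \<open>That \<open>k\<close> is Borel matters: \<open>h\<close> is only Lebesgue
    measurable, and composing Lebesgue measurable functions may destroy measurability.\<close>
  define k where "k p = (if fst p \<in> B then Inf (kr_scales c (chart_inv c (fst p)) (snd p)) else 0)" for p
  have km: "k \<in> borel_measurable borel" unfolding k_def[abs_def] by (rule kr_scales_borel_measurable[OF c B])
  let ?F1 = "\<lambda>t. indicat_real {a..b} t *\<^sub>R snd c (\<gamma> t)"
  let ?F2 = "\<lambda>t. indicat_real {a..b} t *\<^sub>R h t"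
  have "?F1 \<in> borel_measurable borel" by (rule borel_measurable_continuous_on_indicator[OF _ cont]) simp
  then have F1: "?F1 \<in> borel_measurable lebesgue" by (simp add: measurable_completion)
  have F2: "?F2 \<in> borel_measurable lebesgue" using h(1) unfolding set_integrable_def by (rule borel_measurable_integrable)
  have kF: "(\<lambda>t. k (?F1 t, ?F2 t)) \<in> borel_measurable lebesgue"
    by (rule measurable_compose[OF borel_measurable_Pair[OF F1 F2] km])
  have keq: "k (?F1 t, ?F2 t) = kobayashi_metric M A (\<gamma> t) (tangent_of c (\<gamma> t) (h t))" if t: "t \<in> {a..b}" for t
  proof -
    have g: "\<gamma> t \<in> fst c" using ab(4) t by blast
    have "snd c (\<gamma> t) \<in> B" using t by (auto simp: B_def)
    then have "k (?F1 t, ?F2 t) = Inf (kr_scales c (\<gamma> t) (h t))" using t chart_inv_left[OF c g] by (simp add: k_def)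
    also have "\<dots> = kobayashi_metric M A (\<gamma> t) (tangent_of c (\<gamma> t) (h t))"
      using kobayashi_metric_chart[OF tangent_of_tangent[OF c g] c g] tangent_of_self[OF c g] by simp
    finally show ?thesis .
  qed
  have "compact (\<gamma> ` {a..b})" by (rule compact_continuous_image[OF continuous_on_subset[OF path_cont]]) (use ab in auto)
  then obtain C where C: "\<And>x v. x \<in> \<gamma> ` {a..b} \<Longrightarrow> v \<in> tangent_space A x \<Longrightarrow> kobayashi_metric M A x v \<le> C * norm (v c)"
    using kobayashi_metric_upper[OF c _ ab(4)] by blast
  have "set_integrable lebesgue {a..b} (\<lambda>t. k (?F1 t, ?F2 t))"
  proof (rule set_integrable_bound)
    show "set_integrable lebesgue {a..b} (\<lambda>t. C * norm (h t))"
      by (rule set_integrable_mult_right) (rule set_integrable_norm[OF h(1)])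
    show "set_borel_measurable lebesgue {a..b} (\<lambda>t. k (?F1 t, ?F2 t))"
      unfolding set_borel_measurable_def using kF by (intro borel_measurable_scaleR borel_measurable_indicator) auto
    show "AE t in lebesgue. t \<in> {a..b} \<longrightarrow> norm (k (?F1 t, ?F2 t)) \<le> norm (C * norm (h t))"
    proof (intro always_eventually allI impI)
      fix t assume t: "t \<in> {a..b}"
      have g: "\<gamma> t \<in> fst c" using ab(4) t by blast
      have "0 \<le> k (?F1 t, ?F2 t)" unfolding keq[OF t]
        by (rule kobayashi_metric_nonneg[OF _ tangent_of_tangent[OF c g]]) (use g chart_sub[OF c] in blast)
      moreover have "k (?F1 t, ?F2 t) \<le> C * norm (h t)" unfolding keq[OF t]
        using C[OF _ tangent_of_tangent[OF c g], of "h t"] t tangent_of_self[OF c g] by simp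
      ultimately show "norm (k (?F1 t, ?F2 t)) \<le> norm (C * norm (h t))" by simp
    qed
  qed
  then show "set_integrable lebesgue {a..b} speed"
  proof (rule absolutely_integrable_spike[OF _ h(2)])
    fix t assume t: "t \<in> {a..b} - {t\<in>{a..b}. \<not> has_velocity A {0..T} \<gamma> t (tangent_of c (\<gamma> t) (h t))}"
    then have "velocity A {0..T} \<gamma> t = tangent_of c (\<gamma> t) (h t)" using ab by (intro velocity_eq) auto
    then show "speed t = k (?F1 t, ?F2 t)" using keq[of t] t by (simp add: speed_def)
  qed
qed

text \<open>Bisection in the form of \<open>Bolzano\<close>: a property that is additive over
  adjacent intervals need only be checked on intervals whose image lies in one chart.\<close>

lemma path_chart_induct:
  assumes st: "0 \<le> s" "s \<le> t" "t \<le> T"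
    and refl: "\<And>a. P a a"
    and trans: "\<And>a b c. a \<le> b \<Longrightarrow> b \<le> c \<Longrightarrow> P a b \<Longrightarrow> P b c \<Longrightarrow> P a c"
    and chart: "\<And>c a b. c \<in> A \<Longrightarrow> s \<le> a \<Longrightarrow> a < b \<Longrightarrow> b \<le> t \<Longrightarrow> \<gamma> ` {a..b} \<subseteq> fst c \<Longrightarrow> P a b"
  shows "P s t"
proof -
  let ?P = "\<lambda>p q. s \<le> p \<longrightarrow> p \<le> q \<longrightarrow> q \<le> t \<longrightarrow> P p q"
  have "?P s t"
  proof (rule Bolzano[where P = ?P and a = s and b = t])
    show "?P a c" if "?P a b" "?P b c" "a \<le> b" "b \<le> c" for a b c
      using that trans[of a b c] by auto
    fix x assume "s \<le> x" "x \<le> t"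
    then have x: "x \<in> {0..T}" using st by simp
    obtain c where c: "c \<in> A" "\<gamma> x \<in> fst c" using chart_ex[OF path_mem[OF x]] by blast
    obtain U where U: "open U" "fst c = M \<inter> U" using chart_openin[OF c(1)] by (auto simp: openin_open)
    have "(\<gamma> \<longlongrightarrow> \<gamma> x) (at x within {0..T})" using path_cont x by (simp add: continuous_on_def)
    then have "\<forall>\<^sub>F s in at x within {0..T}. \<gamma> s \<in> U" by (rule topological_tendstoD[OF _ U(1)]) (use U c in blast)
    then obtain d where d: "d > 0" "\<And>s. s \<in> {0..T} \<Longrightarrow> s \<noteq> x \<Longrightarrow> dist s x < d \<Longrightarrow> \<gamma> s \<in> U"
      by (auto simp: eventually_at)
    have dU: "\<gamma> s \<in> fst c" if "s \<in> {0..T}" "\<bar>s - x\<bar> < d" for s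
      using d(2)[of s] that c U path_mem[of s] by (cases "s = x") (auto simp: dist_real_def)
    show "\<exists>d>0. \<forall>p q. p \<le> x \<and> x \<le> q \<and> q - p < d \<longrightarrow> ?P p q"
    proof (intro exI[of _ d] conjI allI impI d(1))
      fix p q assume pq: "p \<le> x \<and> x \<le> q \<and> q - p < d" "s \<le> p" "p \<le> q" "q \<le> t"
      show "P p q"
      proof (cases "p = q")
        case False
        have "\<gamma> r \<in> fst c" if "r \<in> {p..q}" for r using dU[of r] that pq st by auto
        then have "\<gamma> ` {p..q} \<subseteq> fst c" by blast
        then show ?thesis using chart[OF c(1), of p q] False pq by simp
      qed (simp add: refl)
    qed
  qed (use st in simp)
  then show ?thesis using st by simp
qed

lemma speed_integrable: "set_integrable lebesgue {0..T} speed"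
proof (rule path_chart_induct[of 0 T "\<lambda>a b. set_integrable lebesgue {a..b} speed"])
  show "set_integrable lebesgue {a..a} speed" for a
    by (rule absolutely_integrable_spike[where f = "\<lambda>_. 0" and S = "{a}"]) (auto simp: set_integrable_def)
  show "set_integrable lebesgue {a..c} speed"
    if "a \<le> b" "b \<le> c" "set_integrable lebesgue {a..b} speed" "set_integrable lebesgue {b..c} speed" for a b c
    using set_integrable_Un[OF that(3,4)] that(1,2) by (simp add: ivl_disj_un)
  show "set_integrable lebesgue {a..b} speed" if "c \<in> A" "0 \<le> a" "a < b" "b \<le> T" "\<gamma> ` {a..b} \<subseteq> fst c" for c a b
    by (rule piece_integrable(1)[OF that])
qed (use T in auto)

lemma velocity_ae: "negligible {t\<in>{0..T}. \<not> (\<exists>v. has_velocity A {0..T} \<gamma> t v)}"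
proof (rule path_chart_induct[of 0 T "\<lambda>a b. negligible {t\<in>{a..b}. \<not> (\<exists>v. has_velocity A {0..T} \<gamma> t v)}"])
  show "negligible {t\<in>{a..a}. \<not> (\<exists>v. has_velocity A {0..T} \<gamma> t v)}" for a
    by (rule negligible_subset[of "{a}"]) auto
  show "negligible {t\<in>{a..c}. \<not> (\<exists>v. has_velocity A {0..T} \<gamma> t v)}"
    if "a \<le> b" "b \<le> c" "negligible {t\<in>{a..b}. \<not> (\<exists>v. has_velocity A {0..T} \<gamma> t v)}"
      "negligible {t\<in>{b..c}. \<not> (\<exists>v. has_velocity A {0..T} \<gamma> t v)}" for a b c
    by (rule negligible_subset[OF negligible_Un[OF that(3,4)]]) auto
  show "negligible {t\<in>{a..b}. \<not> (\<exists>v. has_velocity A {0..T} \<gamma> t v)}"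
    if "c \<in> A" "0 \<le> a" "a < b" "b \<le> T" "\<gamma> ` {a..b} \<subseteq> fst c" for c a b
    by (rule piece_integrable(2)[OF that])
qed (use T in auto)

lemma speed_nonneg: 
  assumes "t \<in> {0..T}" "has_velocity A {0..T} \<gamma> t v"
  shows "0 \<le> speed t"
  unfolding speed_def velocity_eq[OF assms(2,1)]
  by (rule kobayashi_metric_nonneg[OF path_mem[OF assms(1)]]) (use assms(2) in \<open>simp add: has_velocity_def\<close>)

lemma len_eq: "len t = (LINT s:{0..t}|lebesgue. speed s)"
  by (simp add: len_def kobayashi_length_def speed_def)

text \<open>Where the velocity is unspecified the speed may be negative; \<open>speed'\<close> avoids this.\<close>

definition speed' :: "real \<Rightarrow> real" where "speed' t = max 0 (speed t)"

lemma speed'_nonneg: "0 \<le> speed' t" by (simp add: speed'_def)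

lemma speed'_integrable: "set_integrable lebesgue {0..T} speed'"
proof -
  have "integrable lebesgue (\<lambda>x. max (indicat_real {0..T} x *\<^sub>R speed x) 0)"
    by (rule integrable_max) (use speed_integrable in \<open>simp_all add: set_integrable_def\<close>)
  moreover have "(\<lambda>x. max (indicat_real {0..T} x *\<^sub>R speed x) 0) = (\<lambda>x. indicat_real {0..T} x *\<^sub>R speed' x)"
    by (auto simp: speed'_def fun_eq_iff split: split_indicator)
  ultimately show ?thesis by (simp add: set_integrable_def)
qed

lemma len_diff: 
  assumes "0 \<le> s" "s \<le> t" "t \<le> T"
  shows "len t - len s = (LINT x:{s..t}|lebesgue. speed' x)"
proof -
  have e: "len t = (LINT x:{0..t}|lebesgue. speed' x)" if "t \<le> T" for t
    unfolding len_eq set_lebesgue_integral_def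
  proof (rule integral_cong_AE)
    have "AE x in lebesgue. x \<notin> {t\<in>{0..T}. \<not> (\<exists>v. has_velocity A {0..T} \<gamma> t v)}"
      using velocity_ae by (intro AE_not_in) (simp add: negligible_iff_null_sets)
    then show "AE x in lebesgue. indicat_real {0..t} x *\<^sub>R speed x = indicat_real {0..t} x *\<^sub>R speed' x"
    proof eventually_elim
      case (elim x)
      show ?case
      proof (cases "x \<in> {0..t}")
        case True
        then have x: "x \<in> {0..T}" using that by simp
        then have "speed x = speed' x" using elim speed_nonneg[OF x] by (auto simp: speed'_def)
        then show ?thesis by simp
      qed simp
    qed
    have "set_integrable lebesgue {0..t} speed" "set_integrable lebesgue {0..t} speed'"
      using that by (auto intro!: set_integrable_subset[OF speed_integrable] set_integrable_subset[OF speed'_integrable])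
    then show "(\<lambda>x. indicat_real {0..t} x *\<^sub>R speed x) \<in> borel_measurable lebesgue"
      "(\<lambda>x. indicat_real {0..t} x *\<^sub>R speed' x) \<in> borel_measurable lebesgue"
      unfolding set_integrable_def by (auto dest: borel_measurable_integrable)
  qed
  have "set_integrable lebesgue {0..t} speed'" by (rule set_integrable_subset[OF speed'_integrable]) (use assms in auto)
  from set_integral_Icc_split[OF this assms(1,2)] show ?thesis using e[of s] e[of t] assms by simp
qed

lemma len_mono: 
  assumes "0 \<le> s" "s \<le> t" "t \<le> T"
  shows "len s \<le> len t"
proof -
  have "0 \<le> (LINT x:{s..t}|lebesgue. speed' x)" unfolding set_lebesgue_integral_def
    by (rule Bochner_Integration.integral_nonneg) (use speed'_nonneg in auto)
  then show ?thesis using len_diff[OF assms] by simp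
qed

text \<open>The pointwise lower bound on \<open>k\<^sub>X\<close> is integrated along the path. The
  constant depends on the chart and on \<open>Q\<close> but not on the interval, which is what
  yields the Lipschitz bound for \<open>reparam\<close>.\<close>

lemma path_lipschitz:
  assumes c: "c \<in> A" and Q: "compact Q" "Q \<subseteq> fst c"
  shows "\<exists>C\<ge>0. \<forall>s t. 0 \<le> s \<longrightarrow> s \<le> t \<longrightarrow> t \<le> T \<longrightarrow> \<gamma> ` {s..t} \<subseteq> Q \<longrightarrow>
     norm (snd c (\<gamma> t) - snd c (\<gamma> s)) \<le> C * (len t - len s)"
proof -
  obtain C where C: "\<And>x v. x \<in> Q \<Longrightarrow> v \<in> tangent_space A x \<Longrightarrow> norm (v c) \<le> C * kobayashi_metric M A x v"
    using kobayashi_metric_lower[OF c Q] by blast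
  show ?thesis
  proof (intro exI[of _ "\<bar>C\<bar>"] conjI allI impI)
    fix s t assume st: "0 \<le> s" "s \<le> t" "t \<le> T" "\<gamma> ` {s..t} \<subseteq> Q"
    show "norm (snd c (\<gamma> t) - snd c (\<gamma> s)) \<le> \<bar>C\<bar> * (len t - len s)"
    proof (cases "s = t")
      case False
      then have s: "s < t" using st by simp
      have sub: "\<gamma> ` {s..t} \<subseteq> fst c" using st(4) Q(2) by blast
      obtain h where h: "set_integrable lebesgue {s..t} h"
        "\<And>s' t'. s \<le> s' \<Longrightarrow> s' \<le> t' \<Longrightarrow> t' \<le> t \<Longrightarrow> snd c (\<gamma> t') - snd c (\<gamma> s') = (LINT x:{s'..t'}|lebesgue. h x)"
        "negligible {x\<in>{s..t}. \<not> has_velocity A {0..T} \<gamma> x (tangent_of c (\<gamma> x) (h x))}"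
        by (rule path_density[OF c st(1) s st(3) sub], rule that)
      have si: "set_integrable lebesgue {s..t} speed'"
        using st by (auto intro!: set_integrable_subset[OF speed'_integrable])
      have "norm (snd c (\<gamma> t) - snd c (\<gamma> s)) = norm (LINT x:{s..t}|lebesgue. h x)" using h(2)[of s t] s by simp
      also have "\<dots> \<le> (LINT x:{s..t}|lebesgue. norm (h x))" by (rule set_integral_norm_bound[OF h(1)])
      also have "\<dots> \<le> (LINT x:{s..t}|lebesgue. \<bar>C\<bar> * speed' x)"
      proof (rule set_integral_mono_AE)
        show "set_integrable lebesgue {s..t} (\<lambda>x. norm (h x))" by (rule set_integrable_norm[OF h(1)])
        show "set_integrable lebesgue {s..t} (\<lambda>x. \<bar>C\<bar> * speed' x)" by (rule set_integrable_mult_right) (rule si)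
        have "AE x in lebesgue. x \<notin> {x\<in>{s..t}. \<not> has_velocity A {0..T} \<gamma> x (tangent_of c (\<gamma> x) (h x))}"
          using h(3) by (intro AE_not_in) (simp add: negligible_iff_null_sets)
        then show "AE x in lebesgue. x \<in> {s..t} \<longrightarrow> norm (h x) \<le> \<bar>C\<bar> * speed' x"
        proof eventually_elim
          case (elim x)
          show ?case
          proof
            assume x: "x \<in> {s..t}"
            then have v: "has_velocity A {0..T} \<gamma> x (tangent_of c (\<gamma> x) (h x))" using elim by blast
            have xT: "x \<in> {0..T}" using x st by simp
            have gQ: "\<gamma> x \<in> Q" using st(4) x by blast
            then have g: "\<gamma> x \<in> fst c" using Q(2) by blast
            have sp: "speed x = kobayashi_metric M A (\<gamma> x) (tangent_of c (\<gamma> x) (h x))"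
              by (simp add: speed_def velocity_eq[OF v xT])
            have "norm (h x) \<le> C * speed x"
              using C[OF gQ tangent_of_tangent[OF c g], of "h x"] sp tangent_of_self[OF c g] by simp
            also have "\<dots> \<le> \<bar>C\<bar> * speed' x"
              using speed_nonneg[OF xT v] by (simp add: speed'_def mult_right_mono)
            finally show "norm (h x) \<le> \<bar>C\<bar> * speed' x" .
          qed
        qed
      qed
      also have "\<dots> = \<bar>C\<bar> * (LINT x:{s..t}|lebesgue. speed' x)" by simp
      finally show ?thesis using len_diff[OF st(1-3)] by simp
    qed simp
  qed simp
qed

end

section \<open>The reparametrised path\<close>

context hyperbolic_path
begin

text \<open>Written as a gauge integral, the length falls under the continuity theorem for
  indefinite integrals.\<close>

lemma len_integral: "t \<le> T \<Longrightarrow> len t = integral {0..t} speed"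
  unfolding len_eq by (rule set_lebesgue_integral_eq_integral(2), rule set_integrable_subset[OF speed_integrable]) auto

lemma len_cont: "continuous_on {0..T} len"
proof -
  have "speed integrable_on {0..T}" using set_lebesgue_integral_eq_integral(1)[OF speed_integrable] .
  then have "continuous_on {0..T} (\<lambda>t. integral {0..t} speed)" by (rule indefinite_integral_continuous_1)
  then show ?thesis by (rule continuous_on_eq) (simp add: len_integral)
qed

lemma len_0: "len 0 = 0"
  using len_integral[of 0] T by simp

lemma len_image: "len ` {0..T} = {0..len T}"
proof
  show "len ` {0..T} \<subseteq> {0..len T}"
  proof
    fix u assume "u \<in> len ` {0..T}"
    then obtain t where t: "t \<in> {0..T}" "u = len t" by blast
    then show "u \<in> {0..len T}" using len_mono[of 0 t] len_mono[of t T] len_0 by simp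
  qed
  show "{0..len T} \<subseteq> len ` {0..T}"
  proof
    fix u assume "u \<in> {0..len T}"
    then have "\<exists>t\<ge>0. t \<le> T \<and> len t = u"
      using len_0 T by (intro IVT' len_cont) auto
    then show "u \<in> len ` {0..T}" by force
  qed
qed

text \<open>At zero length \<open>path_lipschitz\<close> allows no displacement in a chart, and
  charts are injective. The compact set in question is the image of the subinterval itself.\<close>

lemma len_const_imp:
  assumes st: "0 \<le> s" "s \<le> t" "t \<le> T" "len s = len t"
  shows "\<gamma> s = \<gamma> t"
proof (rule path_chart_induct[OF st(1-3), of "\<lambda>a b. \<gamma> a = \<gamma> b"])
  fix c p q assume c: "c \<in> A" and b: "s \<le> p" "p < q" "q \<le> t" and sub: "\<gamma> ` {p..q} \<subseteq> fst c"
  have "compact (\<gamma> ` {p..q})"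
    by (rule compact_continuous_image[OF continuous_on_subset[OF path_cont]]) (use b st in auto)
  then obtain C where C: "\<And>p' q'. 0 \<le> p' \<Longrightarrow> p' \<le> q' \<Longrightarrow> q' \<le> T \<Longrightarrow> \<gamma> ` {p'..q'} \<subseteq> \<gamma> ` {p..q} \<Longrightarrow>
      norm (snd c (\<gamma> q') - snd c (\<gamma> p')) \<le> C * (len q' - len p')"
    using path_lipschitz[OF c _ sub] by blast
  have "len s \<le> len p" "len p \<le> len q" "len q \<le> len t"
    using len_mono[of s p] len_mono[of p q] len_mono[of q t] b st by auto
  then have "len q - len p = 0" using st(4) by simp
  moreover have "norm (snd c (\<gamma> q) - snd c (\<gamma> p)) \<le> C * (len q - len p)"
    by (rule C) (use b st in auto)
  ultimately have e: "snd c (\<gamma> q) = snd c (\<gamma> p)" by simp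
  have "\<gamma> p \<in> fst c" "\<gamma> q \<in> fst c" using sub b by auto
  then show "\<gamma> p = \<gamma> q" using e chart_inv_left[OF c] by metis
qed auto

text \<open>
  The function \<open>len\<close> need not be injective; by \<open>len_const_imp\<close> the preimage chosen by
  \<open>inv_len\<close> does not influence \<open>reparam\<close>.
\<close>

definition inv_len :: "real \<Rightarrow> real" where "inv_len = inv_into {0..T} len"

definition reparam :: "real \<Rightarrow> 'a" where "reparam u = \<gamma> (inv_len u)"

lemma inv_len: 
  assumes "u \<in> {0..len T}"
  shows "inv_len u \<in> {0..T}" "len (inv_len u) = u"
  using assms unfolding len_image[symmetric] inv_len_def by (rule inv_into_into, rule f_inv_into_f)

lemma reparam_len: 
  assumes t: "t \<in> {0..T}"
  shows "reparam (len t) = \<gamma> t"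
proof -
  have "len t \<in> {0..len T}" using t len_image by blast
  note i = inv_len[OF this]
  show ?thesis
    unfolding reparam_def using len_const_imp[of "inv_len (len t)" t] len_const_imp[of t "inv_len (len t)"] i t
    by (cases "inv_len (len t) \<le> t") auto
qed

lemma inv_len_mono:
  assumes "u \<in> {0..len T}" "u' \<in> {0..len T}" "u < u'"
  shows "inv_len u < inv_len u'"
proof (rule ccontr)
  assume "\<not> inv_len u < inv_len u'"
  then have "len (inv_len u') \<le> len (inv_len u)"
    using inv_len[OF assms(1)] inv_len[OF assms(2)] by (intro len_mono) auto
  then show False using inv_len(2)[OF assms(1)] inv_len(2)[OF assms(2)] assms(3) by simp
qed

lemma reparam_image: "reparam ` {0..len T} = \<gamma> ` {0..T}"
  unfolding len_image[symmetric] image_image using reparam_len by (rule image_cong[OF refl])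

text \<open>\<open>inv_len\<close> may jump where \<open>len\<close> is constant, so continuity
  cannot come from composition. Instead the preimage of a closed set under \<open>reparam\<close> is
  the image under \<open>len\<close> of a compact set.\<close>

lemma reparam_cont: "continuous_on {0..len T} reparam"
  unfolding continuous_on_closed_vimage[OF closed_atLeastAtMost]
proof (intro allI impI)
  fix B :: "'a set" assume B: "closed B"
  have eq: "reparam -` B \<inter> {0..len T} = len ` ({0..T} \<inter> \<gamma> -` B)"
    unfolding len_image[symmetric] using reparam_len by auto
  have "closed (\<gamma> -` B \<inter> {0..T})"
    using path_cont B continuous_on_closed_vimage[OF closed_atLeastAtMost] by blast
  then have "compact ({0..T} \<inter> (\<gamma> -` B \<inter> {0..T}))" by (rule compact_Int_closed[OF compact_Icc])
  moreover have "{0..T} \<inter> (\<gamma> -` B \<inter> {0..T}) = {0..T} \<inter> \<gamma> -` B" by blast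
  ultimately have "compact (len ` ({0..T} \<inter> \<gamma> -` B))"
    by (intro compact_continuous_image continuous_on_subset[OF len_cont]) auto
  then show "closed (reparam -` B \<inter> {0..len T})" unfolding eq by (rule compact_imp_closed)
qed

text \<open>The length difference of the chosen parameters is exactly \<open>u' - u\<close>, so the
  bound of \<open>path_lipschitz\<close> is a Lipschitz bound in \<open>u\<close>.\<close>

lemma reparam_chart_ac:
  assumes c: "c \<in> A" and ab: "{a..b} \<subseteq> {0..len T}" "reparam ` {a..b} \<subseteq> fst c"
  shows "abs_continuous_on {a..b} (\<lambda>u. snd c (reparam u))"
proof -
  have "compact (reparam ` {a..b})"
    by (rule compact_continuous_image[OF continuous_on_subset[OF reparam_cont ab(1)] compact_Icc])
  then obtain C where C: "\<And>p q. 0 \<le> p \<Longrightarrow> p \<le> q \<Longrightarrow> q \<le> T \<Longrightarrow> \<gamma> ` {p..q} \<subseteq> reparam ` {a..b} \<Longrightarrow>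
        norm (snd c (\<gamma> q) - snd c (\<gamma> p)) \<le> C * (len q - len p)"
    using path_lipschitz[OF c _ ab(2)] by blast
  show ?thesis
  proof (rule lipschitz_abs_continuous_on[of _ _ _ C])
    fix u u' assume u: "a \<le> u" "u \<le> u'" "u' \<le> b"
    then have ui: "u \<in> {0..len T}" "u' \<in> {0..len T}" using ab(1) by auto
    let ?p = "inv_len u" and ?q = "inv_len u'"
    have pq: "?p \<le> ?q" using inv_len_mono[OF ui] u(2) by (cases "u = u'") auto
    \<comment> \<open>Between the chosen parameters \<open>\<gamma>\<close> takes only values of
      \<open>reparam\<close> on \<open>{a..b}\<close>, by monotonicity of \<open>len\<close>; so the
      compact set is not left.\<close>
    have "\<gamma> ` {?p..?q} \<subseteq> reparam ` {a..b}"
    proof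
      fix x assume "x \<in> \<gamma> ` {?p..?q}"
      then obtain r where r: "r \<in> {?p..?q}" "x = \<gamma> r" by blast
      have rT: "r \<in> {0..T}" using r(1) inv_len(1)[OF ui(1)] inv_len(1)[OF ui(2)] by auto
      have "len ?p \<le> len r" "len r \<le> len ?q"
        using r(1) inv_len(1)[OF ui(1)] inv_len(1)[OF ui(2)] by (auto intro!: len_mono)
      then have "len r \<in> {a..b}" using inv_len(2)[OF ui(1)] inv_len(2)[OF ui(2)] u by simp
      then have "reparam (len r) \<in> reparam ` {a..b}" by (rule imageI)
      then show "x \<in> reparam ` {a..b}" using reparam_len[OF rT] r(2) by simp
    qed
    then have "norm (snd c (\<gamma> ?q) - snd c (\<gamma> ?p)) \<le> C * (len ?q - len ?p)"
      using pq inv_len(1)[OF ui(1)] inv_len(1)[OF ui(2)] by (intro C) auto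
    then show "norm (snd c (reparam u') - snd c (reparam u)) \<le> C * (u' - u)"
      using inv_len(2)[OF ui(1)] inv_len(2)[OF ui(2)] by (simp add: reparam_def)
  qed
qed

lemma reparam_ac: "abs_continuous_path M A {0..len T} reparam"
  unfolding abs_continuous_path_def locally_abs_continuous_path_def case_prod_unfold
proof (intro conjI ballI impI allI)
  show "reparam ` {0..len T} \<subseteq> M" unfolding reparam_image by (rule path_in)
  fix t c a b assume c: "c \<in> A" and H: "t \<in> {a..b} \<and> {a..b} \<subseteq> {t \<in> {0..len T}. reparam t \<in> fst c}"
  have "{a..b} \<subseteq> {0..len T}" "reparam ` {a..b} \<subseteq> fst c" using H by blast+
  then have "abs_continuous_on {a..b} (\<lambda>u. snd c (reparam u))" by (rule reparam_chart_ac[OF c])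
  then show "abs_continuous_on {a..b} (snd c \<circ> reparam)" by (simp add: o_def)
qed (auto intro: reparam_cont is_interval_cc)

text \<open>A positive derivative makes \<open>len\<close> strictly monotone across
  \<open>t\<close>, although it may be constant elsewhere. Hence \<open>inv_len\<close> is
  continuous at \<open>len t\<close> with derivative \<open>1 / k\<close> there, and the chain rule
  in a chart gives the velocity.\<close>

lemma reparam_velocity:
  assumes t: "t \<in> {0<..<T}" and v: "has_velocity A {0..T} \<gamma> t v"
    and D: "(len has_real_derivative k) (at t)" and k: "0 < k"
  shows "has_velocity A {0..len T} reparam (len t) (\<lambda>c. (1 / k) *\<^sub>R v c)"
proof -
  let ?I = "{0..len T}" and ?u = "len t"
  have tT: "t \<in> {0..T}" using t by simp
  have uI: "?u \<in> ?I" using tT len_image by blast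
  \<comment> \<open>The derivative gives strict growth close to \<open>t\<close>; monotonicity
    carries it to all smaller parameters.\<close>
  have inc: "len s < ?u" if "0 \<le> s" "s < t" for s
  proof -
    obtain d where d: "d > 0" "\<And>h. h > 0 \<Longrightarrow> h < d \<Longrightarrow> len (t - h) < len t"
      using DERIV_pos_inc_left[OF D k] by blast
    define h where "h = min (d/2) (t - s)"
    have h: "0 < h" "h < d" "s \<le> t - h" using d(1) that by (auto simp: h_def)
    have "len s \<le> len (t - h)" by (rule len_mono) (use h that t in auto)
    then show ?thesis using d(2)[OF h(1,2)] by simp
  qed
  have inc': "?u < len s" if "s \<le> T" "t < s" for s
  proof -
    obtain d where d: "d > 0" "\<And>h. h > 0 \<Longrightarrow> h < d \<Longrightarrow> len t < len (t + h)"
      using DERIV_pos_inc_right[OF D k] by blast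
    define h where "h = min (d/2) (s - t)"
    have h: "0 < h" "h < d" "t + h \<le> s" using d(1) that by (auto simp: h_def)
    have "len (t + h) \<le> len s" by (rule len_mono) (use h that t in auto)
    then show ?thesis using d(2)[OF h(1,2)] by simp
  qed
  have iu: "inv_len ?u = t"
  proof (rule ccontr)
    assume ne: "inv_len ?u \<noteq> t"
    then show False using inc[of "inv_len ?u"] inc'[of "inv_len ?u"] inv_len[OF uI]
      by (cases "inv_len ?u < t") auto
  qed
  have lim: "(inv_len \<longlongrightarrow> t) (at ?u within ?I)"
  proof (rule tendstoI)
    fix e :: real assume e: "0 < e"
    \<comment> \<open>Clamping keeps \<open>p\<close> and \<open>q\<close> in \<open>{0..T}\<close>,
      where \<open>len_mono\<close> holds; \<open>e/2\<close> keeps them strictly within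
      \<open>e\<close> of \<open>t\<close>.\<close>
    define p where "p = max 0 (t - e/2)"
    define q where "q = min T (t + e/2)"
    have p: "0 \<le> p" "p < t" "t - e < p" and q: "q \<le> T" "t < q" "q < t + e"
      using t e by (auto simp: p_def q_def)
    have pu: "len p < ?u" "?u < len q" using inc[OF p(1,2)] inc'[OF q(1,2)] by auto
    have "\<forall>\<^sub>F y in at ?u within ?I. y \<in> {len p<..<len q}"
      unfolding eventually_at_topological using pu by (intro exI[of _ "{len p<..<len q}"]) auto
    moreover have "\<forall>\<^sub>F y in at ?u within ?I. y \<in> ?I" by (simp add: eventually_at_filter)
    ultimately show "\<forall>\<^sub>F y in at ?u within ?I. dist (inv_len y) t < e"
    proof eventually_elim
      case (elim y)
      note i = inv_len[OF elim(2)]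
      have "p < inv_len y"
      proof (rule ccontr)
        assume "\<not> p < inv_len y"
        then have "len (inv_len y) \<le> len p" using i(1) p t by (intro len_mono) auto
        then show False using i(2) elim(1) by simp
      qed
      moreover have "inv_len y < q"
      proof (rule ccontr)
        assume "\<not> inv_len y < q"
        then have "len q \<le> len (inv_len y)" using i(1) q t by (intro len_mono) auto
        then show False using i(2) elim(1) by simp
      qed
      ultimately show ?case using p q by (simp add: dist_real_def)
    qed
  qed
  \<comment> \<open>\<open>inv_len\<close> avoids the value \<open>t\<close> away from
    \<open>len t\<close>, so the difference quotients of \<open>len\<close> at \<open>t\<close> can
    be composed with it.\<close>
  have evn: "\<forall>\<^sub>F y in at ?u within ?I. inv_len y \<noteq> t"
  proof -
    have "\<forall>\<^sub>F y in at ?u within ?I. y \<in> ?I \<and> y \<noteq> ?u" by (simp add: eventually_at_filter)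
    then show ?thesis by eventually_elim (use inv_len(2) in auto)
  qed
  have "(inv_len has_real_derivative 1 / k) (at ?u within ?I)"
    unfolding has_field_derivative_iff iu
  proof -
    have "((\<lambda>s. (len s - len t) / (s - t)) \<longlongrightarrow> k) (at t)" using D by (simp add: has_field_derivative_iff)
    moreover have "filterlim inv_len (at t) (at ?u within ?I)"
      unfolding filterlim_at using lim evn by auto
    ultimately have "((\<lambda>y. (len (inv_len y) - len t) / (inv_len y - t)) \<longlongrightarrow> k) (at ?u within ?I)"
      by (rule filterlim_compose)
    then have "((\<lambda>y. inverse ((len (inv_len y) - len t) / (inv_len y - t))) \<longlongrightarrow> inverse k) (at ?u within ?I)"
      by (rule tendsto_inverse) (use k in simp)
    moreover have "\<forall>\<^sub>F y in at ?u within ?I. inverse ((len (inv_len y) - len t) / (inv_len y - t)) = (inv_len y - t) / (y - ?u)"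
    proof -
      have "\<forall>\<^sub>F y in at ?u within ?I. y \<in> ?I" by (simp add: eventually_at_filter)
      then show ?thesis by eventually_elim (simp add: inv_len(2))
    qed
    ultimately have "((\<lambda>y. (inv_len y - t) / (y - ?u)) \<longlongrightarrow> inverse k) (at ?u within ?I)"
      by (rule Lim_transform_eventually)
    then show "((\<lambda>y. (inv_len y - t) / (y - ?u)) \<longlongrightarrow> 1 / k) (at ?u within ?I)" by (simp add: inverse_eq_divide)
  qed
  then have I: "(inv_len has_vector_derivative 1 / k) (at ?u within ?I)"
    by (simp add: has_real_derivative_iff_has_vector_derivative)
  obtain c where c: "c \<in> A" "\<gamma> t \<in> fst c" using chart_ex[OF path_mem[OF tT]] by blast
  have vt: "v \<in> tangent_space A (\<gamma> t)" and vc: "((\<lambda>s. snd c (\<gamma> s)) has_vector_derivative v c) (at t within {0..T})"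
    using v c by (auto simp: has_velocity_alt)
  have "((\<lambda>s. snd c (\<gamma> s)) has_vector_derivative v c) (at (inv_len ?u) within inv_len ` ?I)"
    unfolding iu by (rule has_vector_derivative_within_subset[OF vc]) (use inv_len(1) in auto)
  from vector_diff_chain_within[OF I this]
  have d: "((\<lambda>u. snd c (reparam u)) has_vector_derivative (1 / k) *\<^sub>R v c) (at ?u within ?I)"
    by (simp add: o_def reparam_def)
  have r: "reparam ?u = \<gamma> t" by (rule reparam_len[OF tT])
  have "has_velocity A ?I reparam ?u (tangent_of c (reparam ?u) ((1 / k) *\<^sub>R v c))"
    by (rule has_velocity_chart[OF reparam_cont _ uI c(1) _ d]) (use r c reparam_image path_in in auto)
  moreover have "(\<lambda>c. (1 / k) *\<^sub>R v c) = tangent_of c (\<gamma> t) ((1 / k) *\<^sub>R v c)"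
    using tangent_eq_tangent_of[OF tangent_scale[OF vt] c] .
  ultimately show ?thesis using r by simp
qed

text \<open>The times of speed 0 may form a set of positive measure, so excluding a null set of
  times is not enough; what counts is that the image of all bad times under \<open>len\<close> is
  null.\<close>

lemma reparam_unit_speed:
  "AE u in lebesgue_on {0..len T}. \<exists>v. has_velocity A {0..len T} reparam u v \<and> kobayashi_metric M A (reparam u) v = 1"
proof -
  let ?NV = "{t\<in>{0..T}. \<not> (\<exists>v. has_velocity A {0..T} \<gamma> t v)}"
  let ?ND = "{t\<in>{0<..<T}. \<not> (len has_real_derivative speed t) (at t)}"
  let ?Z = "{t\<in>{0..T}. speed' t = 0}"
  have n2: "negligible ?ND"
    using lebesgue_differentiation_real[OF speed_integrable] by (simp add: len_eq[abs_def])
  define N where "N = ?NV \<union> ?ND \<union> {0, T}"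
  have N: "negligible N" unfolding N_def using velocity_ae n2 by (intro negligible_Un) auto
  \<comment> \<open>\<open>speed'\<close> vanishes almost everywhere on \<open>E\<close>: the part
    in \<open>N\<close> is null, and on the rest it is 0.\<close>
  define E where "E = (N \<union> ?Z) \<inter> {0..T}"
  have F: "(\<lambda>t. indicat_real {0..T} t *\<^sub>R speed' t) \<in> borel_measurable lebesgue"
    using speed'_integrable unfolding set_integrable_def by (rule borel_measurable_integrable)
  have "?Z = {0..T} \<inter> ((\<lambda>t. indicat_real {0..T} t *\<^sub>R speed' t) -` {0} \<inter> space lebesgue)" by auto
  also have "\<dots> \<in> sets lebesgue" by (intro sets.Int measurable_sets[OF F]) auto
  finally have Zm: "?Z \<in> sets lebesgue" .
  have Em: "E \<in> sets lebesgue" unfolding E_def by (rule sets.Int[OF sets.Un[OF negligible_imp_sets[OF N] Zm]]) simp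
  have E0: "(LINT x:E|lebesgue. speed' x) = 0"
    unfolding set_lebesgue_integral_def
  proof (rule integral_eq_zero_AE)
    have "AE x in lebesgue. x \<notin> N" using N by (intro AE_not_in) (simp add: negligible_iff_null_sets)
    then show "AE x in lebesgue. indicat_real E x *\<^sub>R speed' x = 0"
      by eventually_elim (auto simp: E_def split: split_indicator)
  qed
  have neg: "negligible (len ` E)"
    by (rule negligible_image_indefinite_integral[OF speed'_integrable speed'_nonneg len_diff Em _ E0 T]) (auto simp: E_def)
  have good: "\<exists>v. has_velocity A {0..len T} reparam u v \<and> kobayashi_metric M A (reparam u) v = 1"
    if u: "u \<in> {0..len T}" "u \<notin> len ` E" for u
  proof -
    obtain t where t: "t \<in> {0..T}" "u = len t" using u(1) len_image by blast
    have tE: "t \<notin> E" using u(2) t by blast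
    then have tN: "t \<notin> N" "speed' t \<noteq> 0" using t(1) by (auto simp: E_def)
    then have t0: "t \<in> {0<..<T}" using t(1) by (auto simp: N_def)
    obtain v where v: "has_velocity A {0..T} \<gamma> t v" using tN(1) t(1) by (auto simp: N_def)
    have D: "(len has_real_derivative speed t) (at t)" using tN(1) t0 by (auto simp: N_def)
    have k: "0 < speed t" using tN(2) by (auto simp: speed'_def max_def split: if_splits)
    have vt: "v \<in> tangent_space A (\<gamma> t)" using v by (simp add: has_velocity_def)
    have "kobayashi_metric M A (\<gamma> t) (\<lambda>c. (1 / speed t) *\<^sub>R v c) = (1 / speed t) * kobayashi_metric M A (\<gamma> t) v"
      by (rule kobayashi_metric_scale[OF path_mem[OF t(1)] vt]) (use k in simp)
    also have "kobayashi_metric M A (\<gamma> t) v = speed t" by (simp add: speed_def velocity_eq[OF v t(1)])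
    finally have "kobayashi_metric M A (\<gamma> t) (\<lambda>c. (1 / speed t) *\<^sub>R v c) = 1" using k by simp
    then show ?thesis using reparam_velocity[OF t0 v D k] reparam_len[OF t(1)] t(2) by auto
  qed
  have "AE u in lebesgue. u \<notin> len ` E" using neg by (intro AE_not_in) (simp add: negligible_iff_null_sets)
  then have "AE u in lebesgue. u \<in> {0..len T} \<longrightarrow>
      (\<exists>v. has_velocity A {0..len T} reparam u v \<and> kobayashi_metric M A (reparam u) v = 1)"
    by eventually_elim (use good in blast)
  then show ?thesis by (subst AE_restrict_space_iff) auto
qed

text \<open>On an interval of stationary points the speed is 0, so \<open>len\<close> is constant
  there. Conversely, equal lengths at \<open>s < t\<close> make \<open>\<gamma>\<close> constant in
  between, hence stationary inside.\<close>

lemma len_inj_iff: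
  "inj_on len {0..T} \<longleftrightarrow> \<not> contains_nontrivial_interval (stationary_set A {0..T} \<gamma>)"
proof
  assume inj: "inj_on len {0..T}"
  show "\<not> contains_nontrivial_interval (stationary_set A {0..T} \<gamma>)"
  proof
    assume "contains_nontrivial_interval (stationary_set A {0..T} \<gamma>)"
    then obtain a b where ab: "a < b" "{a..b} \<subseteq> stationary_set A {0..T} \<gamma>"
      by (auto simp: contains_nontrivial_interval_def)
    then have abT: "{a..b} \<subseteq> {0..T}" unfolding stationary_set_def by blast
    have z: "speed' t = 0" if "t \<in> {a..b}" for t
    proof -
      have "has_velocity A {0..T} \<gamma> t (\<lambda>_. 0)" "t \<in> {0..T}" using that ab(2) by (auto simp: stationary_set_def)
      then show ?thesis
        using velocity_eq[of t "\<lambda>_. 0"] kobayashi_metric_zero[OF path_mem, of t] by (simp add: speed'_def speed_def)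
    qed
    have "a \<in> {0..T}" "b \<in> {0..T}" using ab(1) abT by auto
    moreover from this have "len b - len a = (LINT x:{a..b}|lebesgue. speed' x)"
      using ab(1) by (intro len_diff) auto
    moreover have "(LINT x:{a..b}|lebesgue. speed' x) = (LINT x:{a..b}|lebesgue. 0)"
      unfolding set_lebesgue_integral_def
      by (rule Bochner_Integration.integral_cong) (use z in \<open>auto split: split_indicator\<close>)
    ultimately show False using inj ab(1) by (auto dest!: inj_onD[of len _ a b] simp: set_lebesgue_integral_def)
  qed
next
  assume nc: "\<not> contains_nontrivial_interval (stationary_set A {0..T} \<gamma>)"
  have "False" if st: "s \<in> {0..T}" "t \<in> {0..T}" "s < t" "len s = len t" for s t
  proof -
    have const: "\<gamma> r = \<gamma> s" if r: "r \<in> {s..t}" for r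
    proof -
      have "len s \<le> len r" "len r \<le> len t" using len_mono[of s r] len_mono[of r t] r st by auto
      then have "len s = len r" using st(4) by simp
      then show ?thesis using len_const_imp[of s r] r st by auto
    qed
    \<comment> \<open>The middle third stays away from \<open>s\<close> and \<open>t\<close>, where
      the derivative need not exist because \<open>\<gamma>\<close> may move on the other
      side.\<close>
    have "{(2 * s + t)/3..(s + 2 * t)/3} \<subseteq> stationary_set A {0..T} \<gamma>"
    proof
      fix r assume "r \<in> {(2 * s + t)/3..(s + 2 * t)/3}"
      then have r: "s < r" "r < t" using st(3) by auto
      have rT: "r \<in> {0..T}" using r st by auto
      obtain c where c: "c \<in> A" "\<gamma> r \<in> fst c" using chart_ex[OF path_mem[OF rT]] by blast
      have "((\<lambda>x. snd c (\<gamma> s)) has_vector_derivative 0) (at r within {0..T})" by simp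
      then have "((\<lambda>x. snd c (\<gamma> x)) has_vector_derivative 0) (at r within {0..T})"
      proof (rule has_vector_derivative_transform_within[of _ _ _ _ "min (r - s) (t - r)"])
        fix x assume "dist x r < min (r - s) (t - r)"
        then have "x \<in> {s..t}" by (auto simp: dist_real_def abs_if split: if_splits)
        then show "snd c (\<gamma> s) = snd c (\<gamma> x)" using const[of x] by simp
      qed (use r rT in auto)
      from has_velocity_chart[OF path_cont path_in rT c this]
      have "has_velocity A {0..T} \<gamma> r (tangent_of c (\<gamma> r) 0)" .
      moreover have "(\<lambda>_. 0) = tangent_of c (\<gamma> r) 0"
        using tangent_eq_tangent_of[OF tangent_zero[OF path_mem[OF rT]] c] .
      ultimately show "r \<in> stationary_set A {0..T} \<gamma>" using rT by (simp add: stationary_set_def)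
    qed
    moreover have "(2 * s + t)/3 < (s + 2 * t)/3" using st(3) by simp
    ultimately show False using nc unfolding contains_nontrivial_interval_def by blast
  qed
  then show "inj_on len {0..T}" by (intro linorder_inj_onI) auto
qed

lemma reparam_eq: "reparam = length_reparam M A T \<gamma>"
  by (simp add: fun_eq_iff reparam_def length_reparam_def inv_len_def len_def)

text \<open>\<open>len\<close> is always onto \<open>{0..len T}\<close> and \<open>reparam\<close>
  is always absolutely continuous, so injectivity of \<open>len\<close> decides.\<close>

lemma length_reparametrizable_iff:
  "length_reparametrizable M A T \<gamma> \<longleftrightarrow> \<not> contains_nontrivial_interval (stationary_set A {0..T} \<gamma>)"
  unfolding len_inj_iff[symmetric] length_reparametrizable_def Let_def
  using reparam_ac len_image by (simp add: bij_betw_def len_def[symmetric] reparam_eq[symmetric])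

end

theorem theorem1p2:
  fixes M :: "'a::{t2_space, second_countable_topology} set"
    and A :: "('a, 'n::finite) chart set"
    and \<gamma> :: "real \<Rightarrow> 'a"
    and T :: real
  assumes "complex_manifold M A"
    and "kobayashi_hyperbolic M A"
    and "abs_continuous_path M A {0..T} \<gamma>"
    and "\<not> \<gamma> constant_on {0..T}"
  shows "(\<exists>\<tau> \<sigma>.
            abs_continuous_path M A {0..\<tau>} \<sigma> \<and>
            \<gamma> ` {0..T} = \<sigma> ` {0..\<tau>} \<and>
            (AE t in lebesgue_on {0..\<tau>}.
               \<exists>v. has_velocity A {0..\<tau>} \<sigma> t v \<and> kobayashi_metric M A (\<sigma> t) v = 1) \<and>
            (\<not> contains_nontrivial_interval (stationary_set A {0..T} \<gamma>) \<longrightarrow>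
               \<tau> = kobayashi_length M A T \<gamma> T \<and>
               (\<forall>t\<in>{0..\<tau>}. \<sigma> t = length_reparam M A T \<gamma> t))) \<and>
         (length_reparametrizable M A T \<gamma> \<longleftrightarrow>
            \<not> contains_nontrivial_interval (stationary_set A {0..T} \<gamma>))"
proof -
  \<comment> \<open>Otherwise the domain is empty or a single point, and every path on it is
    constant.\<close>
  have T: "0 < T"
  proof (rule ccontr)
    assume "\<not> 0 < T"
    then have "{0..T} = {} \<or> {0..T} = {0}" by auto
    then show False using assms(4) by (auto simp: constant_on_def)
  qed
  interpret hyperbolic_path M A \<gamma> T
    using assms T by unfold_locales
  show ?thesis
  proof (intro conjI exI impI ballI)
    \<comment> \<open>The same \<open>\<tau>\<close> and \<open>\<sigma>\<close> serve whether or
      not \<open>len\<close> is injective, so no case distinction on the stationary set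
      arises.\<close>
    show "abs_continuous_path M A {0..len T} reparam" by (rule reparam_ac)
    show "\<gamma> ` {0..T} = reparam ` {0..len T}" by (rule reparam_image[symmetric])
    show "AE t in lebesgue_on {0..len T}.
        \<exists>v. has_velocity A {0..len T} reparam t v \<and> kobayashi_metric M A (reparam t) v = 1"
      by (rule reparam_unit_speed)
    show "len T = kobayashi_length M A T \<gamma> T" by (simp add: len_def)
    show "reparam t = length_reparam M A T \<gamma> t" for t by (simp add: reparam_eq)
  qed (rule length_reparametrizable_iff)
qed

end
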